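(* The $\mathbb{Q}$-algebra $\mathcal{C}_0(K)$, with generators $i$ and $j$, has defining relations (1) $i^m j^{m+1} i^{m+1} j^{m+2} = i^{2m+1} j^{2m+3}$ for all $m\ge 0$; (2) $i^{n+2} j^{n+1} i^{n+1} j^{n} = i^{2n+3} j^{2n+1}$ for all $n\ge 0$; (3) $i^m j^m$ and $i^n j^n$ commute for all $m,n\ge 1$. (That is, $\mathcal{C}_0(K)$ is the quotient of the free associative unital $\mathbb{Q}$-algebra on $i,j$ by the two-sided ideal generated by these relations.) Moreover, define in $\mathcal{C}_0(K)$ the elements $$\mathcal{R}(1)=ij-ji,\quad \mathcal{R}(s+1)=i\,\mathcal{R}(1)^s j\ (s\ge 1),\quad \mathcal{P}(m)=\mathcal{R}(1)^m j\ (m\ge 0),\quad \mathcal{I}(n)=i\,\mathcal{R}(1)^n\ (n\ge 0).$$ Then the products $$\mathcal{P}(m_1)\cdots\mathcal{P}(m_a)\,\mathcal{R}(s_1)\cdots\mathcal{R}(s_t)\,\mathcal{I}(n_1)\cdots\mathcal{I}(n_b)$$ with $a,t,b\ge 0$, $0\le m_1\le\cdots\le m_a$, $s_1\ge\cdots\ge s_t\ge 1$ and $n_1\ge\cdots\ge n_b\ge 0$ form a $\mathbb{Q}$-basis of $\mathcal{C}_0(K)$.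
   Context: $K$ is the Kronecker quiver $i\rightrightarrows j$ (two vertices $i,j$ and two arrows from $i$ to $j$). Let $q$ be an indeterminate. Let $\mathcal{C}'_q(K)$ be the associative unital $\mathbb{Q}(q)$-algebra generated by two elements $i$ and $j$ subject to the relations $$i^3j-(q^2+q+1)i^2ji+q(q^2+q+1)iji^2-q^3ji^3=0,$$ $$ij^3-(q^2+q+1)jij^2+q(q^2+q+1)j^2ij-q^3j^3i=0.$$ The generic composition algebra $\mathcal{C}_q(K)$ is the $\mathbb{Q}[q]$-subalgebra of $\mathcal{C}'_q(K)$ generated by $i$ and $j$. Its specialisation at $q=0$ is the $\mathbb{Q}$-algebra $\mathcal{C}_0(K)=\mathcal{C}_q(K)/q\,\mathcal{C}_q(K)$; the images of $i,j$ are again denoted $i,j$. *)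

theory Defs
  imports
    "HOL-Library.Poly_Mapping"
    "HOL-Computational_Algebra.Polynomial_Factorial"
begin

section \<open>Free algebras and two-sided ideals\<close>

datatype 'a free_monoid = Free_Monoid (letters: "'a list")

instantiation free_monoid :: (type) monoid_add
begin

text \<open>The free monoid is written additively because \<open>poly_mapping\<close> takes its convolution
  product from a (possibly non-commutative) \<open>monoid_add\<close> of exponents.\<close>

definition zero_free_monoid :: "'a free_monoid"
  where "0 = Free_Monoid []"

definition plus_free_monoid :: "'a free_monoid \<Rightarrow> 'a free_monoid \<Rightarrow> 'a free_monoid"
  where "u + v = Free_Monoid (letters u @ letters v)"

instance
  by standard (simp_all add: zero_free_monoid_def plus_free_monoid_def)

end

lemma free_monoid_add_eq_0_iff: "u + v = 0 \<longleftrightarrow> u = 0 \<and> v = (0 :: 'a free_monoid)"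
  by (cases u; cases v) (auto simp: zero_free_monoid_def plus_free_monoid_def)

type_synonym ('a, 'k) free_algebra = "'a free_monoid \<Rightarrow>\<^sub>0 'k"

definition fa_gen :: "'a \<Rightarrow> ('a, 'k::ring_1) free_algebra"
  where "fa_gen a = Poly_Mapping.single (Free_Monoid [a]) 1"

definition fa_scale :: "'k::ring_1 \<Rightarrow> ('a, 'k) free_algebra \<Rightarrow> ('a, 'k) free_algebra"
  where "fa_scale c p = Poly_Mapping.single 0 c * p"

lemma lookup_single_zero_mult:
  "Poly_Mapping.lookup (Poly_Mapping.single 0 c * p) w = c * Poly_Mapping.lookup p w"
  for p :: "('a, 'k::ring_1) free_algebra"
proof -
  have "Poly_Mapping.lookup (Poly_Mapping.single 0 c * p) w =
      (\<Sum>l. Poly_Mapping.lookup (Poly_Mapping.single 0 c) l *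
        (\<Sum>v. Poly_Mapping.lookup p v when w = l + v))"
    by (simp add: lookup_mult)
  also have "\<dots> = (\<Sum>l. (c * (\<Sum>v. Poly_Mapping.lookup p v when w = l + v)) when l = 0)"
    by (rule Sum_any.cong) (auto simp: lookup_single when_def)
  also have "\<dots> = c * Poly_Mapping.lookup p w"
    by simp
  finally show ?thesis .
qed

lemma lookup_fa_scale: "Poly_Mapping.lookup (fa_scale c p) w = c * Poly_Mapping.lookup p w"
  by (simp add: fa_scale_def lookup_single_zero_mult)

lemma fa_scale_mult_left: "fa_scale c p * r = fa_scale c (p * r)"
  by (simp add: fa_scale_def mult.assoc)

lemma mult_single_zero_commute:
  "p * Poly_Mapping.single 0 c = Poly_Mapping.single 0 c * p"
  for p :: "('a, 'k::comm_ring_1) free_algebra"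
proof (rule poly_mapping_eqI)
  fix w
  have inner: "(\<Sum>v. Poly_Mapping.lookup (Poly_Mapping.single 0 c) v when w = l + v) =
      (c when w = l)" for l :: "'a free_monoid"
  proof -
    have "(\<Sum>v. Poly_Mapping.lookup (Poly_Mapping.single 0 c) v when w = l + v) =
        (\<Sum>v. (c when w = l) when v = (0 :: 'a free_monoid))"
      by (rule Sum_any.cong) (auto simp: lookup_single when_def)
    then show ?thesis by simp
  qed
  have "Poly_Mapping.lookup (p * Poly_Mapping.single 0 c) w =
      (\<Sum>l. Poly_Mapping.lookup p l * (c when w = l))"
    by (simp add: lookup_mult inner)
  also have "\<dots> = (\<Sum>l. (Poly_Mapping.lookup p l * c) when l = w)"
    by (rule Sum_any.cong) (auto simp: when_def)
  also have "\<dots> = c * Poly_Mapping.lookup p w"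
    by (simp add: mult.commute)
  finally show "Poly_Mapping.lookup (p * Poly_Mapping.single 0 c) w =
      Poly_Mapping.lookup (Poly_Mapping.single 0 c * p) w"
    by (simp add: lookup_single_zero_mult)
qed

lemma fa_scale_mult_right: "p * fa_scale c r = fa_scale c (p * r)"
  for p :: "('a, 'k::comm_ring_1) free_algebra"
  by (metis fa_scale_def mult.assoc mult_single_zero_commute)

lemma vector_space_fa_scale:
  "vector_space (fa_scale :: 'k::field \<Rightarrow> ('a, 'k) free_algebra \<Rightarrow> _)"
  by standard
    (auto intro!: poly_mapping_eqI simp: lookup_fa_scale lookup_add algebra_simps)

lemma lookup_mult_zero:
  "Poly_Mapping.lookup (p * r) 0 = Poly_Mapping.lookup p 0 * Poly_Mapping.lookup r 0"
  for p r :: "('a, 'k::ring_1) free_algebra"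
proof -
  have inner: "(\<Sum>v. Poly_Mapping.lookup r v when l + v = 0) =
      (Poly_Mapping.lookup r 0 when l = 0)" for l
  proof -
    have "(\<Sum>v. Poly_Mapping.lookup r v when l + v = 0) =
        (\<Sum>v. (Poly_Mapping.lookup r 0 when l = 0) when v = (0 :: 'a free_monoid))"
      by (rule Sum_any.cong) (auto simp: when_def free_monoid_add_eq_0_iff)
    then show ?thesis by simp
  qed
  have "Poly_Mapping.lookup (p * r) 0 =
      (\<Sum>l. Poly_Mapping.lookup p l * (Poly_Mapping.lookup r 0 when l = 0))"
    by (simp add: lookup_mult inner)
  also have "\<dots> = (\<Sum>l. (Poly_Mapping.lookup p 0 * Poly_Mapping.lookup r 0) when l = (0 :: 'a free_monoid))"
    by (rule Sum_any.cong) (auto simp: when_def)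
  finally show ?thesis by simp
qed

lemma lookup_fa_gen_zero [simp]: "Poly_Mapping.lookup (fa_gen a) 0 = 0"
  by (simp add: fa_gen_def lookup_single zero_free_monoid_def)

inductive_set ideal_gen :: "'a::ring_1 set \<Rightarrow> 'a set" for S :: "'a set" where
  zero: "0 \<in> ideal_gen S"
| gen: "x \<in> S \<Longrightarrow> x \<in> ideal_gen S"
| add: "x \<in> ideal_gen S \<Longrightarrow> y \<in> ideal_gen S \<Longrightarrow> x + y \<in> ideal_gen S"
| mult_left: "x \<in> ideal_gen S \<Longrightarrow> a * x \<in> ideal_gen S"
| mult_right: "x \<in> ideal_gen S \<Longrightarrow> x * a \<in> ideal_gen S"

lemma ideal_gen_uminus: "x \<in> ideal_gen S \<Longrightarrow> - x \<in> ideal_gen S"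
  using ideal_gen.mult_left[of x S "- 1"] by simp

lemma ideal_gen_diff: "x \<in> ideal_gen S \<Longrightarrow> y \<in> ideal_gen S \<Longrightarrow> x - y \<in> ideal_gen S"
  using ideal_gen.add[OF _ ideal_gen_uminus] by fastforce

definition is_algebra_hom ::
    "('k::field \<Rightarrow> 'a::ring_1 \<Rightarrow> 'a) \<Rightarrow> ('k \<Rightarrow> 'b::ring_1 \<Rightarrow> 'b) \<Rightarrow> ('a \<Rightarrow> 'b) \<Rightarrow> bool"
  where "is_algebra_hom s1 s2 f \<longleftrightarrow>
    Vector_Spaces.linear s1 s2 f \<and> f 1 = 1 \<and> (\<forall>x y. f (x * y) = f x * f y)"

section \<open>The algebra \<open>C'\<^sub>q(K)\<close> over \<open>\<rat>(q)\<close>\<close>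

datatype vertex = VI | VJ

definition q_indet :: "rat poly fract"
  where "q_indet = to_fract [:0, 1:]"

definition serre_relations :: "(vertex, rat poly fract) free_algebra set"
  where "serre_relations = (let i = fa_gen VI; j = fa_gen VJ in
    {i ^ 3 * j - fa_scale (q_indet ^ 2 + q_indet + 1) (i ^ 2 * j * i)
        + fa_scale (q_indet * (q_indet ^ 2 + q_indet + 1)) (i * j * i ^ 2) - fa_scale (q_indet ^ 3) (j * i ^ 3),
     i * j ^ 3 - fa_scale (q_indet ^ 2 + q_indet + 1) (j * i * j ^ 2)
        + fa_scale (q_indet * (q_indet ^ 2 + q_indet + 1)) (j ^ 2 * i * j) - fa_scale (q_indet ^ 3) (j ^ 3 * i)})"

lemma serre_ideal_lookup_zero:
  "x \<in> ideal_gen serre_relations \<Longrightarrow> Poly_Mapping.lookup x 0 = 0"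
  by (induction rule: ideal_gen.induct)
    (auto simp: serre_relations_def Let_def lookup_add lookup_minus lookup_mult_zero
      lookup_fa_scale power2_eq_square power3_eq_cube)

quotient_type comp_alg_frac = "(vertex, rat poly fract) free_algebra" /
    "\<lambda>x y. x - y \<in> ideal_gen serre_relations"
proof (rule equivpI)
  show "reflp (\<lambda>x y. x - y \<in> ideal_gen serre_relations)"
    by (auto intro!: reflpI ideal_gen.zero)
  show "symp (\<lambda>x y. x - y \<in> ideal_gen serre_relations)"
    by (rule sympI, drule ideal_gen_uminus) simp
  show "transp (\<lambda>x y. x - y \<in> ideal_gen serre_relations)"
    by (rule transpI, drule (1) ideal_gen.add) simp
qed

instantiation comp_alg_frac :: ring_1
begin

lift_definition zero_comp_alg_frac :: comp_alg_frac is 0 .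

lift_definition one_comp_alg_frac :: comp_alg_frac is 1 .

lift_definition plus_comp_alg_frac :: "comp_alg_frac \<Rightarrow> comp_alg_frac \<Rightarrow> comp_alg_frac" is "(+)"
  by (drule (1) ideal_gen.add) (simp add: algebra_simps)

lift_definition uminus_comp_alg_frac :: "comp_alg_frac \<Rightarrow> comp_alg_frac" is uminus
  by (drule ideal_gen_uminus) simp

lift_definition minus_comp_alg_frac :: "comp_alg_frac \<Rightarrow> comp_alg_frac \<Rightarrow> comp_alg_frac" is "(-)"
  by (drule (1) ideal_gen_diff) (simp add: algebra_simps)

lift_definition times_comp_alg_frac :: "comp_alg_frac \<Rightarrow> comp_alg_frac \<Rightarrow> comp_alg_frac" is "(*)"
proof -
  fix x x' y y' :: "(vertex, rat poly fract) free_algebra"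
  assume "x - x' \<in> ideal_gen serre_relations" "y - y' \<in> ideal_gen serre_relations"
  then have "(x - x') * y + x' * (y - y') \<in> ideal_gen serre_relations"
    by (intro ideal_gen.add ideal_gen.mult_left ideal_gen.mult_right)
  then show "x * y - x' * y' \<in> ideal_gen serre_relations"
    by (simp add: algebra_simps)
qed

instance
proof
  show "(0 :: comp_alg_frac) \<noteq> 1"
    by transfer (auto dest: serre_ideal_lookup_zero simp: lookup_minus)
qed (transfer; simp add: algebra_simps ideal_gen.zero)+

end

lift_definition frac_gen :: "vertex \<Rightarrow> comp_alg_frac" is fa_gen .

definition frac_scale :: "rat poly fract \<Rightarrow> comp_alg_frac \<Rightarrow> comp_alg_frac"
  where "frac_scale c x = abs_comp_alg_frac (fa_scale c (rep_comp_alg_frac x))"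

lemma abs_rep_diff: "rep_comp_alg_frac (abs_comp_alg_frac p) - p \<in> ideal_gen serre_relations"
  by (simp flip: comp_alg_frac.abs_eq_iff
      add: Quotient3_abs_rep[OF Quotient3_comp_alg_frac])

lemma frac_scale_abs: "frac_scale c (abs_comp_alg_frac p) = abs_comp_alg_frac (fa_scale c p)"
proof -
  have "fa_scale c (rep_comp_alg_frac (abs_comp_alg_frac p) - p) \<in> ideal_gen serre_relations"
    unfolding fa_scale_def by (rule ideal_gen.mult_left[OF abs_rep_diff])
  then show ?thesis
    unfolding frac_scale_def comp_alg_frac.abs_eq_iff
    by (simp add: fa_scale_def right_diff_distrib)
qed

lemma frac_scale_mult_left: "frac_scale c x * y = frac_scale c (x * y)"
  by (induction x; induction y)
    (simp add: frac_scale_abs times_comp_alg_frac.abs_eq fa_scale_mult_left)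

lemma frac_scale_mult_right: "x * frac_scale c y = frac_scale c (x * y)"
  by (induction x; induction y)
    (simp add: frac_scale_abs times_comp_alg_frac.abs_eq fa_scale_mult_right)

lemma vector_space_frac_scale: "vector_space frac_scale"
proof
  fix a b x y
  note vs = vector_space.vector_space_assms[OF vector_space_fa_scale]
  show "frac_scale a (x + y) = frac_scale a x + frac_scale a y"
    by (induction x; induction y) (simp add: frac_scale_abs plus_comp_alg_frac.abs_eq vs)
  show "frac_scale (a + b) x = frac_scale a x + frac_scale b x"
    by (induction x) (simp add: frac_scale_abs plus_comp_alg_frac.abs_eq vs)
  show "frac_scale a (frac_scale b x) = frac_scale (a * b) x"
    by (induction x) (simp add: frac_scale_abs vs)
  show "frac_scale 1 x = x"
    by (induction x) (simp add: frac_scale_abs vs)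
qed

text \<open>The coefficient of the empty word, used to see that the rings below are non-trivial.\<close>

definition frac_counit :: "comp_alg_frac \<Rightarrow> rat poly fract"
  where "frac_counit x = Poly_Mapping.lookup (rep_comp_alg_frac x) 0"

lemma frac_counit_abs: "frac_counit (abs_comp_alg_frac p) = Poly_Mapping.lookup p 0"
  using serre_ideal_lookup_zero[OF abs_rep_diff[of p]]
  by (simp add: frac_counit_def lookup_minus)

lemma frac_counit_simps [simp]:
  "frac_counit 1 = 1"
  "frac_counit (x + y) = frac_counit x + frac_counit y"
  "frac_counit (x * y) = frac_counit x * frac_counit y"
  "frac_counit (frac_scale c x) = c * frac_counit x"
  "frac_counit (frac_gen v) = 0"
  by (induction x; induction y;
      simp add: frac_counit_abs one_comp_alg_frac.abs_eq plus_comp_alg_frac.abs_eq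
        times_comp_alg_frac.abs_eq frac_scale_abs frac_gen.abs_eq
        lookup_add lookup_mult_zero lookup_fa_scale)+

section \<open>The generic composition algebra \<open>C\<^sub>q(K)\<close> over \<open>\<rat>[q]\<close>\<close>

inductive_set generic_comp_alg :: "comp_alg_frac set" where
  gen: "frac_gen v \<in> generic_comp_alg"
| one: "1 \<in> generic_comp_alg"
| add: "x \<in> generic_comp_alg \<Longrightarrow> y \<in> generic_comp_alg \<Longrightarrow> x + y \<in> generic_comp_alg"
| mult: "x \<in> generic_comp_alg \<Longrightarrow> y \<in> generic_comp_alg \<Longrightarrow> x * y \<in> generic_comp_alg"
| scale: "x \<in> generic_comp_alg \<Longrightarrow> frac_scale (to_fract c) x \<in> generic_comp_alg"

lemma generic_comp_alg_zero: "0 \<in> generic_comp_alg"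
  using generic_comp_alg.scale[OF generic_comp_alg.one, of 0]
  by (simp add: module.scale_zero_left[OF vector_space_frac_scale[folded module_iff_vector_space]])

lemma generic_comp_alg_uminus: "x \<in> generic_comp_alg \<Longrightarrow> - x \<in> generic_comp_alg"
  using generic_comp_alg.scale[of x "- 1"]
  by (simp add: module.scale_minus_left[OF vector_space_frac_scale[folded module_iff_vector_space]]
      vector_space.vector_space_assms[OF vector_space_frac_scale])

lemma generic_comp_alg_diff:
  "x \<in> generic_comp_alg \<Longrightarrow> y \<in> generic_comp_alg \<Longrightarrow> x - y \<in> generic_comp_alg"
  using generic_comp_alg.add[OF _ generic_comp_alg_uminus] by fastforce

lemma frac_counit_generic: "x \<in> generic_comp_alg \<Longrightarrow> \<exists>r. frac_counit x = to_fract r"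
proof (induction rule: generic_comp_alg.induct)
  case (gen v)
  then show ?case by (intro exI[of _ 0]) simp
next
  case one
  then show ?case by (intro exI[of _ 1]) simp
next
  case (add x y)
  then obtain r r' where "frac_counit x = to_fract r" "frac_counit y = to_fract r'" by blast
  then show ?case by (intro exI[of _ "r + r'"]) simp
next
  case (mult x y)
  then obtain r r' where "frac_counit x = to_fract r" "frac_counit y = to_fract r'" by blast
  then show ?case by (intro exI[of _ "r * r'"]) simp
next
  case (scale x c)
  then obtain r where "frac_counit x = to_fract r" by blast
  then show ?case by (intro exI[of _ "c * r"]) simp
qed

typedef comp_alg_q = generic_comp_alg
  by (rule exI) (rule generic_comp_alg.one)

setup_lifting type_definition_comp_alg_q

instantiation comp_alg_q :: ring_1
begin

lift_definition zero_comp_alg_q :: comp_alg_q is 0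
  by (rule generic_comp_alg_zero)

lift_definition one_comp_alg_q :: comp_alg_q is 1
  by (rule generic_comp_alg.one)

lift_definition plus_comp_alg_q :: "comp_alg_q \<Rightarrow> comp_alg_q \<Rightarrow> comp_alg_q" is "(+)"
  by (rule generic_comp_alg.add)

lift_definition uminus_comp_alg_q :: "comp_alg_q \<Rightarrow> comp_alg_q" is uminus
  by (rule generic_comp_alg_uminus)

lift_definition minus_comp_alg_q :: "comp_alg_q \<Rightarrow> comp_alg_q \<Rightarrow> comp_alg_q" is "(-)"
  by (rule generic_comp_alg_diff)

lift_definition times_comp_alg_q :: "comp_alg_q \<Rightarrow> comp_alg_q \<Rightarrow> comp_alg_q" is "(*)"
  by (rule generic_comp_alg.mult)

instance
  by standard (transfer; simp add: algebra_simps)+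

end

lift_definition q_gen :: "vertex \<Rightarrow> comp_alg_q" is frac_gen
  by (rule generic_comp_alg.gen)

lift_definition q_scale :: "rat poly \<Rightarrow> comp_alg_q \<Rightarrow> comp_alg_q"
  is "\<lambda>c. frac_scale (to_fract c)"
  by (rule generic_comp_alg.scale)

lemma q_scale_mult_left: "q_scale c x * y = q_scale c (x * y)"
  by transfer (rule frac_scale_mult_left)

lemma q_scale_mult_right: "x * q_scale c y = q_scale c (x * y)"
  by transfer (rule frac_scale_mult_right)

lemma module_q_scale: "module q_scale"
  by standard (transfer; simp add: vector_space.vector_space_assms[OF vector_space_frac_scale])+

section \<open>The specialisation \<open>C\<^sub>0(K) = C\<^sub>q(K) / q C\<^sub>q(K)\<close>\<close>

definition q_multiples :: "comp_alg_q set"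
  where "q_multiples = range (q_scale [:0, 1:])"

lemma q_multiples_closed:
  shows "0 \<in> q_multiples"
    and "x \<in> q_multiples \<Longrightarrow> y \<in> q_multiples \<Longrightarrow> x + y \<in> q_multiples"
    and "x \<in> q_multiples \<Longrightarrow> y \<in> q_multiples \<Longrightarrow> x - y \<in> q_multiples"
    and "x \<in> q_multiples \<Longrightarrow> - x \<in> q_multiples"
    and "x \<in> q_multiples \<Longrightarrow> z * x \<in> q_multiples"
    and "x \<in> q_multiples \<Longrightarrow> x * z \<in> q_multiples"
    and "x \<in> q_multiples \<Longrightarrow> q_scale c x \<in> q_multiples"
  unfolding q_multiples_def
  by (auto simp: q_scale_mult_left q_scale_mult_right
      module.scale_left_commute[OF module_q_scale, of c]
      simp flip: module.scale_right_distrib[OF module_q_scale]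
        module.scale_right_diff_distrib[OF module_q_scale]
        module.scale_minus_right[OF module_q_scale]
      intro: range_eqI[of _ _ 0] module.scale_zero_right[OF module_q_scale, symmetric])

lemma one_notin_q_multiples: "1 \<notin> q_multiples"
proof
  assume "1 \<in> q_multiples"
  then obtain z where z: "1 = q_scale [:0, 1:] z"
    by (auto simp: q_multiples_def)
  have "frac_counit (Rep_comp_alg_q 1) = frac_counit (Rep_comp_alg_q (q_scale [:0, 1:] z))"
    using z by simp
  then have eq: "1 = to_fract [:0, 1:] * frac_counit (Rep_comp_alg_q z)"
    by (simp add: one_comp_alg_q.rep_eq q_scale.rep_eq)
  obtain r where "frac_counit (Rep_comp_alg_q z) = to_fract r"
    using frac_counit_generic[OF Rep_comp_alg_q] by blast
  with eq have "to_fract 1 = to_fract ([:0, 1:] * r)"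
    by (simp only: to_fract_mult to_fract_1)
  then have "1 = [:0, 1:] * r"
    by (simp only: to_fract_eq_iff)
  then have "poly 1 0 = poly ([:0, 1:] * r) 0"
    by simp
  then show False
    by simp
qed

quotient_type comp_alg_0 = comp_alg_q / "\<lambda>x y. x - y \<in> q_multiples"
proof (rule equivpI)
  show "reflp (\<lambda>x y. x - y \<in> q_multiples)"
    by (auto intro!: reflpI q_multiples_closed(1))
  show "symp (\<lambda>x y. x - y \<in> q_multiples)"
    by (rule sympI, drule q_multiples_closed(4)) simp
  show "transp (\<lambda>x y. x - y \<in> q_multiples)"
    by (rule transpI, drule (1) q_multiples_closed(2)) simp
qed

instantiation comp_alg_0 :: ring_1
begin

lift_definition zero_comp_alg_0 :: comp_alg_0 is 0 .

lift_definition one_comp_alg_0 :: comp_alg_0 is 1 .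

lift_definition plus_comp_alg_0 :: "comp_alg_0 \<Rightarrow> comp_alg_0 \<Rightarrow> comp_alg_0" is "(+)"
  by (drule (1) q_multiples_closed(2)) (simp add: algebra_simps)

lift_definition uminus_comp_alg_0 :: "comp_alg_0 \<Rightarrow> comp_alg_0" is uminus
  by (drule q_multiples_closed(4)) simp

lift_definition minus_comp_alg_0 :: "comp_alg_0 \<Rightarrow> comp_alg_0 \<Rightarrow> comp_alg_0" is "(-)"
  by (drule (1) q_multiples_closed(3)) (simp add: algebra_simps)

lift_definition times_comp_alg_0 :: "comp_alg_0 \<Rightarrow> comp_alg_0 \<Rightarrow> comp_alg_0" is "(*)"
proof -
  fix x x' y y' :: comp_alg_q
  assume "x - x' \<in> q_multiples" "y - y' \<in> q_multiples"
  then have "(x - x') * y + x' * (y - y') \<in> q_multiples"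
    by (intro q_multiples_closed(2,5,6))
  then show "x * y - x' * y' \<in> q_multiples"
    by (simp add: algebra_simps)
qed

instance
proof
  show "(0 :: comp_alg_0) \<noteq> 1"
    by transfer (use one_notin_q_multiples q_multiples_closed(4) in fastforce)
qed (transfer; simp add: algebra_simps q_multiples_closed(1))+

end

lift_definition gen0 :: "vertex \<Rightarrow> comp_alg_0" is q_gen .

text \<open>The \<open>\<rat>\<close>-structure is the one induced by the constant polynomials in \<open>\<rat>[q]\<close>.\<close>

lift_definition scale0 :: "rat \<Rightarrow> comp_alg_0 \<Rightarrow> comp_alg_0" is "\<lambda>c. q_scale [:c:]"
  by (drule q_multiples_closed(7))
    (simp add: module.scale_right_diff_distrib[OF module_q_scale])

global_interpretation C0: vector_space scale0
proof
  fix a b :: rat and x y :: comp_alg_0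
  note mod = module_q_scale[unfolded module_def]
  show "scale0 a (x + y) = scale0 a x + scale0 a y"
    by transfer (simp add: mod q_multiples_closed(1))
  show "scale0 (a + b) x = scale0 a x + scale0 b x"
  proof transfer
    fix a b :: rat and x :: comp_alg_q
    have "q_scale ([:a:] + [:b:]) x = q_scale [:a:] x + q_scale [:b:] x"
      using mod by blast
    then show "q_scale [:a + b:] x - (q_scale [:a:] x + q_scale [:b:] x) \<in> q_multiples"
      by (simp add: q_multiples_closed(1))
  qed
  show "scale0 a (scale0 b x) = scale0 (a * b) x"
    by transfer (simp add: mod mult.commute q_multiples_closed(1))
  show "scale0 1 x = x"
    by transfer (simp add: mod q_multiples_closed(1) flip: one_pCons)
qed

lemma scale0_mult_left: "scale0 c x * y = scale0 c (x * y)"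
  by transfer (simp add: q_scale_mult_left q_multiples_closed(1))

lemma scale0_mult_right: "x * scale0 c y = scale0 c (x * y)"
  by transfer (simp add: q_scale_mult_right q_multiples_closed(1))

section \<open>Relations and basis elements\<close>

definition kronecker_relations :: "(vertex, rat) free_algebra set"
  where "kronecker_relations = (let i = fa_gen VI; j = fa_gen VJ in
    {i ^ m * j ^ (m + 1) * i ^ (m + 1) * j ^ (m + 2) - i ^ (2 * m + 1) * j ^ (2 * m + 3) | m. True}
    \<union> {i ^ (n + 2) * j ^ (n + 1) * i ^ (n + 1) * j ^ n - i ^ (2 * n + 3) * j ^ (2 * n + 1) | n. True}
    \<union> {(i ^ m * j ^ m) * (i ^ n * j ^ n) - (i ^ n * j ^ n) * (i ^ m * j ^ m) | m n. 1 \<le> m \<and> 1 \<le> n})"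

definition R1 :: comp_alg_0
  where "R1 = gen0 VI * gen0 VJ - gen0 VJ * gen0 VI"

text \<open>Only the values of \<open>elt_R\<close> at \<open>s \<ge> 1\<close> are meaningful.\<close>

definition elt_R :: "nat \<Rightarrow> comp_alg_0"
  where "elt_R s = (if s = 1 then R1 else gen0 VI * R1 ^ (s - 1) * gen0 VJ)"

definition elt_P :: "nat \<Rightarrow> comp_alg_0"
  where "elt_P m = R1 ^ m * gen0 VJ"

definition elt_I :: "nat \<Rightarrow> comp_alg_0"
  where "elt_I n = gen0 VI * R1 ^ n"

definition pbw_index :: "(nat list \<times> nat list \<times> nat list) set"
  where "pbw_index = {(ms, ss, ns). sorted_wrt (\<le>) ms \<and>
    sorted_wrt (\<ge>) ss \<and> (\<forall>s \<in> set ss. 1 \<le> s) \<and> sorted_wrt (\<ge>) ns}"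

definition pbw_elt :: "nat list \<times> nat list \<times> nat list \<Rightarrow> comp_alg_0"
  where "pbw_elt = (\<lambda>(ms, ss, ns).
    prod_list (map elt_P ms) * prod_list (map elt_R ss) * prod_list (map elt_I ns))"

end

theory Submission
  imports Defs "HOL-Library.Function_Algebras"
begin

text \<open>
  Over \<open>\<rat>(q)\<close> put \<open>R\<^sub>1 = ij - ji\<close>, \<open>P\<^sub>0 = j\<close>, \<open>(1 + q) P\<^sub>m\<^sub>+\<^sub>1 = R\<^sub>1 P\<^sub>m - q P\<^sub>m R\<^sub>1\<close>, dually
  \<open>I\<^sub>n\<close>, and \<open>R\<^sub>m\<^sub>+\<^sub>1 = I\<^sub>0 P\<^sub>m - q\<^sup>m P\<^sub>m I\<^sub>0\<close>. The two Serre relations say that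
  \<open>P\<^sub>1 P\<^sub>0 = q\<^sup>2 P\<^sub>0 P\<^sub>1\<close> and \<open>I\<^sub>0 I\<^sub>1 = q\<^sup>2 I\<^sub>1 I\<^sub>0\<close>; by induction on the degree they imply
  \<open>R\<^sub>a R\<^sub>b = R\<^sub>b R\<^sub>a\<close>, \<open>P\<^sub>n\<^sub>+\<^sub>1 P\<^sub>n = q\<^sup>2 P\<^sub>n P\<^sub>n\<^sub>+\<^sub>1\<close> and \<open>I\<^sub>n I\<^sub>n\<^sub>+\<^sub>1 = q\<^sup>2 I\<^sub>n\<^sub>+\<^sub>1 I\<^sub>n\<close>. At \<open>q = 0\<close> the
  \<open>R\<^sub>s\<close> commute and \<open>P\<^sub>n\<^sub>+\<^sub>1 P\<^sub>n = 0 = I\<^sub>n I\<^sub>n\<^sub>+\<^sub>1\<close>. In any ring these rules are equivalent to the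
  relations (1)--(3), and they straighten every word into ordered products. Hence ordered products
  span both the algebra presented by (1)--(3) and \<open>C\<^sub>0(K)\<close>, and it remains to see that they are
  independent in \<open>C\<^sub>0(K)\<close>. The algebra \<open>C'\<^sub>q(K)\<close> acts on functions of integer strings with matrix
  coefficients in \<open>\<rat>[q]\<close>; at \<open>q = 1\<close> the generators act as derivations, and coefficients between
  strings in which every letter moves separate the ordered products. This gives a
  \<open>\<rat>[q]\<close>-valued functional on \<open>C\<^sub>q(K)\<close> vanishing on all ordered products but one. If that one were
  redundant modulo \<open>q\<close>, every value of the functional would be divisible by every power of \<open>q\<close>.
\<close>

text \<open>\<open>C'_q(K)\<close> is a form of the positive part of quantum affine sl_2.
  \<open>P\<close>, \<open>R\<close> and \<open>I\<close> are its preprojective, imaginary and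
  preinjective root vectors, and the relations proved for them are Drinfeld's loop relations. The
  obstacle is that the theorem lives at \<open>q = 0\<close>, whereas the loop relations are derived
  by cancelling polynomials in \<open>q\<close>, and the separation of ordered products is seen at
  \<open>q = 1\<close>. Relations descend to \<open>q = 0\<close> easily: the only denominators in
  the root vectors are powers of \<open>1 + q\<close>, which is 1 there, so it is enough to
  localise. Independence does not descend in this way: inverting the matrix of pairings gives a
  functional whose single nonzero value \<open>d\<close> on ordered products is a polynomial that
  may itself be divisible by \<open>q\<close>. The spanning result, proved beforehand, does the work
  that a unit \<open>d\<close> would do: it forces the set \<open>V\<close> of all values into
  \<open>q V\<close> once a product is redundant.\<close>

section \<open>Defining relations and straightening rules\<close>

text \<open>Reversing products and exchanging \<open>i\<close> with \<open>j\<close> swaps the relations (1) and (2), so the opposite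
  ring turns every statement about the \<open>P\<^sub>m\<close> into its dual about the \<open>I\<^sub>n\<close>.\<close>

typedef 'a opp = "UNIV :: 'a set"
  morphisms unopp opp ..

setup_lifting type_definition_opp

instantiation opp :: (ring_1) ring_1
begin

lift_definition zero_opp :: "'a opp" is 0 .
lift_definition one_opp :: "'a opp" is 1 .
lift_definition plus_opp :: "'a opp \<Rightarrow> 'a opp \<Rightarrow> 'a opp" is "(+)" .
lift_definition minus_opp :: "'a opp \<Rightarrow> 'a opp \<Rightarrow> 'a opp" is "(-)" .
lift_definition uminus_opp :: "'a opp \<Rightarrow> 'a opp" is uminus .
lift_definition times_opp :: "'a opp \<Rightarrow> 'a opp \<Rightarrow> 'a opp" is "\<lambda>x y. y * x" .

instance
  by standard (transfer; simp add: algebra_simps)+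

end

lemma opp_mult: "opp x * opp y = opp (y * x)"
  by (metis UNIV_I opp_inverse times_opp.rep_eq unopp_inverse)

lemma opp_add: "opp x + opp y = opp (x + y)"
  by (metis UNIV_I opp_inverse plus_opp.rep_eq unopp_inverse)

lemma opp_diff: "opp x - opp y = opp (x - y)"
  by (metis UNIV_I opp_inverse minus_opp.rep_eq unopp_inverse)

lemma opp_power: "opp x ^ n = opp (x ^ n)"
  by (induction n) (simp_all add: one_opp_def opp_mult power_commutes)

lemma opp_eq_iff: "opp x = opp y \<longleftrightarrow> x = y"
  by (simp add: opp_inject)

lemma opp_eq_0_iff: "opp x = 0 \<longleftrightarrow> x = 0"
  by (simp add: opp_inject zero_opp_def)

lemmas opp_simps = opp_mult opp_add opp_diff opp_power opp_eq_iff opp_eq_0_iff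

locale two_gen =
  fixes i j :: "'a::ring_1"
begin

definition R :: 'a where "R = i * j - j * i"
definition P :: "nat \<Rightarrow> 'a" where "P m = R ^ m * j"
definition I :: "nat \<Rightarrow> 'a" where "I n = i * R ^ n"
definition Rs :: "nat \<Rightarrow> 'a" where "Rs s = (if s = 1 then R else i * R ^ (s - 1) * j)"
definition E :: "nat \<Rightarrow> 'a" where "E m = i ^ m * j ^ m"

lemma P_0 [simp]: "P 0 = j" and I_0 [simp]: "I 0 = i" and Rs_1: "Rs (Suc 0) = R"
  by (simp_all add: P_def I_def Rs_def)

lemma R_mult_P: "R * P m = P (Suc m)"
  by (simp add: P_def mult.assoc)

lemma I_mult_R: "I n * R = I (Suc n)"
  by (simp add: I_def mult.assoc power_commutes)

text \<open>For \<open>m = n = 0\<close> the product is \<open>i * j = R + j * i\<close> and not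
  \<open>Rs 1 = R\<close>; hence the hypothesis, and the special case in \<open>Rs\<close>.\<close>

lemma I_mult_P: "m + n \<noteq> 0 \<Longrightarrow> I n * P m = Rs (Suc (m + n))"
  by (auto simp: I_def P_def Rs_def mult.assoc)
     (metis add.commute mult.assoc power_add)+

lemma ij_eq: "i * j = R + j * i"
  by (simp add: R_def)

lemma E_0 [simp]: "E 0 = 1"
  by (simp add: E_def)

lemma E_1: "E (Suc 0) = i * j"
  by (simp add: E_def)

lemma i_E_j: "i * (E m * j) = E (Suc m)"
  by (simp add: E_def mult.assoc power_commutes)

end

text \<open>Case 0 of (1) and (2), and equally case 0 of \<open>P (n+1) P n = 0\<close> and
  \<open>I n I (n+1) = 0\<close>: the ground common to both systems, on which the identities for
  either direction are built.\<close>

locale two_gen_base = two_gen +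
  assumes Rjj: "R * j * j = 0" and iiR: "i * i * R = 0"
begin

lemma Rs_j: "2 \<le> s \<Longrightarrow> Rs s * j = 0"
proof -
  assume "2 \<le> s"
  then obtain k where "s = Suc (Suc k)" by (metis Suc_le_D numeral_2_eq_2 Suc_le_mono)
  then have "Rs s * j = i * R ^ k * (R * j * j)"
    by (simp add: Rs_def mult.assoc power_Suc2 del: power_Suc)
  then show ?thesis by (simp add: Rjj)
qed

lemma i_Rs: "2 \<le> s \<Longrightarrow> i * Rs s = 0"
proof -
  assume "2 \<le> s"
  then obtain k where "s = Suc (Suc k)" by (metis Suc_le_D numeral_2_eq_2 Suc_le_mono)
  then have "i * Rs s = (i * i * R) * R ^ k * j"
    by (simp add: Rs_def mult.assoc)
  then show ?thesis by (simp add: iiR)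
qed

text \<open>\<open>R j j = 0\<close> reads \<open>j i j j = i j j j\<close>: in front of
  \<open>j j\<close>, letters \<open>j\<close> pass \<open>i\<close> freely.\<close>

lemma j_i_jj: "j ^ k * (i * (j * j)) = i * j ^ (k + 2)"
proof (induction k)
  case 0
  then show ?case by (simp add: power2_eq_square)
next
  case (Suc k)
  have "i * j ^ (Suc k + 2) = i * j * j * j ^ Suc k"
    by (simp add: mult.assoc power2_eq_square flip: power_add power_Suc)
  also have "\<dots> = (i * j) * (j * j * j ^ k)"
    by (simp add: mult.assoc)
  also have "\<dots> = R * j * j * j ^ k + j * (i * (j * j * j ^ k))"
    unfolding ij_eq by (simp add: distrib_right mult.assoc)
  also have "\<dots> = j * (i * j ^ (k + 2))"
    unfolding Rjj by (simp add: mult.assoc)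
  also have "\<dots> = j ^ Suc k * (i * (j * j))"
    unfolding Suc.IH[symmetric] by (simp add: mult.assoc)
  finally show ?case by simp
qed

text \<open>After swapping the factors the product is \<open>i^m j^m i j j\<close>, to which
  \<open>j_i_jj\<close> applies.\<close>

lemma E1_E_j:
  assumes "E 1 * E m = E m * E 1"
  shows "E 1 * E m * j = E (Suc m) * j"
proof -
  have "E 1 * E m * j = i ^ m * (j ^ m * (i * (j * j)))"
    by (simp only: assms) (simp add: E_def mult.assoc)
  also have "\<dots> = E (Suc m) * j"
    unfolding j_i_jj by (simp add: E_def mult.assoc power_commutes)
      (metis mult.assoc power_Suc power_Suc2)
  finally show ?thesis .
qed

text \<open>Since \<open>E 1 = R + j i\<close>, the product \<open>E 1 E m j\<close> has a part in
  which \<open>R\<close> raises the index of each \<open>P k\<close>, and a part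
  \<open>j E (m+1)\<close>, which is the summand \<open>k = 0\<close>.\<close>

lemma E_j_sum:
  assumes "\<And>k. k < m \<Longrightarrow> E 1 * E k = E k * E 1"
  shows "E m * j = (\<Sum>k\<le>m. P k * E (m - k))"
  using assms
proof (induction m)
  case 0
  then show ?case by simp
next
  case (Suc m)
  have IH: "E m * j = (\<Sum>k\<le>m. P k * E (m - k))"
    using Suc by simp
  have "E (Suc m) * j = E 1 * E m * j"
    using E1_E_j Suc.prems by simp
  also have "\<dots> = R * (E m * j) + j * (i * (E m * j))"
    by (simp add: E_1 ij_eq algebra_simps)
  also have "R * (E m * j) = (\<Sum>k\<le>m. P (Suc k) * E (m - k))"
    unfolding IH by (simp add: sum_distrib_left R_mult_P flip: mult.assoc)
  also have "j * (i * (E m * j)) = P 0 * E (Suc m)"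
    by (simp add: i_E_j)
  finally show ?case
    by (simp add: sum.atMost_Suc_shift add.commute del: sum.atMost_Suc)
qed

text \<open>Obtained by multiplying \<open>E_j_sum\<close> by \<open>i\<close>. As \<open>R + j i = E 1\<close>, the recursion expresses the \<open>E m\<close> through
  \<open>E 1\<close> and the \<open>Rs s\<close> with \<open>s \<ge> 2\<close> and conversely, which is why (3) amounts to commutativity of the \<open>Rs s\<close>.\<close>

lemma E_rec:
  assumes "\<And>k. k < m \<Longrightarrow> E 1 * E k = E k * E 1"
  shows "E (Suc m) = E 1 * E m + (\<Sum>k<m. Rs (k + 2) * E (m - Suc k))"
proof -
  have "E (Suc m) = i * (\<Sum>k\<le>m. P k * E (m - k))"
    using E_j_sum[OF assms] i_E_j by metis
  also have "\<dots> = i * j * E m + (\<Sum>k<m. i * P (Suc k) * E (m - Suc k))"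
    by (cases m) (simp_all add: sum.atMost_Suc_shift lessThan_Suc_atMost sum_distrib_left
        distrib_left mult.assoc del: sum.atMost_Suc)
  also have "(\<Sum>k<m. i * P (Suc k) * E (m - Suc k)) = (\<Sum>k<m. Rs (k + 2) * E (m - Suc k))"
    using I_mult_P[of _ 0] by (intro sum.cong) auto
  finally show ?thesis by (simp add: E_1)
qed

text \<open>Both products vanish. Hence for these \<open>Rs s\<close> commuting with
  \<open>R\<close> is the same as commuting with \<open>E 1 = R + j i\<close>.\<close>

lemma comm_ji_Rs: "2 \<le> s \<Longrightarrow> j * i * Rs s = Rs s * (j * i)"
  by (metis Rs_j i_Rs mult.assoc mult_zero_left mult_zero_right)

lemma comm_R_iff: "2 \<le> s \<Longrightarrow> R * Rs s = Rs s * R \<longleftrightarrow> E 1 * Rs s = Rs s * E 1"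
  using comm_ji_Rs[of s] by (simp add: E_1 ij_eq algebra_simps)

end

locale two_gen_comm = two_gen_base +
  assumes comm_E: "\<And>a b. E a * E b = E b * E a"
    and comm_Rs_E: "\<And>s a. 2 \<le> s \<Longrightarrow> Rs s * E a = E a * Rs s"
begin

text \<open>By \<open>E_rec\<close>, \<open>E (a+1)\<close> is \<open>E 1 E a\<close> plus terms
  with a factor \<open>Rs s\<close>, \<open>s \<ge> 2\<close>, which commutes up to \<open>j\<close>
  and kills it. \<open>E1_E_j\<close> then absorbs \<open>E 1\<close>.\<close>

lemma E_E_j: "E a * (E b * j) = E (a + b) * j"
proof (induction a)
  case 0
  then show ?case by simp
next
  case (Suc a)
  have z: "Rs (k + 2) * E c * (E b * j) = 0" for k c
  proof -
    have "Rs (k + 2) * E c * (E b * j) = E c * E b * (Rs (k + 2) * j)"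
      by (simp only: comm_Rs_E[of "k + 2" c] comm_Rs_E[of "k + 2" b] mult.assoc[symmetric] le_add2)
         (simp only: mult.assoc comm_Rs_E[of "k + 2"
             b] le_add2 mult.assoc[of "Rs (k + 2)", symmetric])
    then show ?thesis using Rs_j[of "k + 2"] by simp
  qed
  have "E (Suc a) = E 1 * E a + (\<Sum>k<a. Rs (k + 2) * E (a - Suc k))"
    by (rule E_rec) (rule comm_E)
  then have "E (Suc a) * (E b * j) = E 1 * (E a * (E b * j))"
    using z by (simp add: distrib_right sum_distrib_right mult.assoc)
  also have "\<dots> = E (Suc a + b) * j"
    using Suc.IH E1_E_j[OF comm_E, of "a + b"] by (simp add: mult.assoc)
  finally show ?case .
qed

text \<open>Both sides expand by \<open>E_j_sum\<close> and \<open>E_E_j\<close> into terms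
  \<open>P k E (2m+1-k) j\<close>, the left one over \<open>k \<le> m\<close>, the right one over
  \<open>k \<le> 2m+1\<close>. The summands \<open>k > m\<close> remain.\<close>

lemma rel1_iff:
  "i ^ m * j ^ (m + 1) * i ^ (m + 1) * j ^ (m + 2) = i ^ (2 * m + 1) * j ^ (2 * m + 3) \<longleftrightarrow>
    (\<Sum>k\<in>{m<..2*m+1}. \<Sum>l\<le>2*m+1-k. P k * P l * E (2*m+1-k-l)) = 0"
proof -
  let ?f = "\<lambda>k. P k * (E (2*m+1-k) * j)"
  have Ej: "E n * j = (\<Sum>k\<le>n. P k * E (n - k))" for n
    using E_j_sum comm_E by blast
  have "i ^ m * j ^ (m + 1) * i ^ (m + 1) * j ^ (m + 2) = E m * j * (E (m + 1) * j)"
    by (simp add: E_def mult.assoc power_commutes flip: power_Suc2)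
  also have "\<dots> = (\<Sum>k\<le>m. P k * (E (m - k) * (E (m + 1) * j)))"
    by (subst Ej) (simp add: sum_distrib_right mult.assoc)
  also have "\<dots> = (\<Sum>k\<le>m. ?f k)"
    by (intro sum.cong) (auto simp: E_E_j mult_2 Suc_diff_le)
  finally have lhs: "i ^ m * j ^ (m + 1) * i ^ (m + 1) * j ^ (m + 2) = (\<Sum>k\<le>m. ?f k)" .
  have "i ^ (2 * m + 1) * j ^ (2 * m + 3) = E (2 * m + 1) * j * j"
    by (simp add: E_def mult.assoc power_commutes numeral_3_eq_3)
  also have "\<dots> = (\<Sum>k\<le>2*m+1. ?f k)"
    by (subst Ej) (simp add: sum_distrib_right mult.assoc distrib_right)
  also have "{..2*m+1} = {..m} \<union> {m<..2*m+1}"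
    by auto
  also have "(\<Sum>k\<in>{..m} \<union> {m<..2*m+1}. ?f k) = (\<Sum>k\<le>m. ?f k) + (\<Sum>k\<in>{m<..2*m+1}. ?f k)"
    by (rule sum.union_disjoint) auto
  finally have rhs: "i ^ (2 * m + 1) * j ^ (2 * m + 3) = \<dots>" .
  have "(\<Sum>k\<in>{m<..2*m+1}. ?f k) = (\<Sum>k\<in>{m<..2*m+1}. \<Sum>l\<le>2*m+1-k. P k * P l * E (2*m+1-k-l))"
    unfolding Ej by (simp add: sum_distrib_left mult.assoc)
  then show ?thesis unfolding lhs rhs by simp
qed

lemma P_P_zero:
  assumes "P (Suc n) * P n = 0" "n < m"
  shows "P m * P n = 0"
proof -
  have "P m = R ^ (m - Suc n) * P (Suc n)"
    using assms(2) by (simp add: P_def flip: mult.assoc power_add power_Suc)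
  then show ?thesis using assms(1) by (simp add: mult.assoc)
qed

text \<open>In the remainder of \<open>rel1_iff\<close> always \<open>l \<le> m < k\<close>. Given
  the cases below \<open>m\<close>, only \<open>k = m+1\<close>, \<open>l = m\<close> survives, with
  \<open>E 0 = 1\<close>: the system is triangular.\<close>

lemma rel1_iff_PP:
  "(\<forall>m. i ^ m * j ^ (m + 1) * i ^ (m + 1) * j ^ (m + 2) = i ^ (2 * m + 1) * j ^ (2 * m + 3)) \<longleftrightarrow>
    (\<forall>m. P (Suc m) * P m = 0)"
  (is "?L \<longleftrightarrow> ?R")
proof
  assume ?R
  then have "P k * P l = 0" if "l < k" for k l using P_P_zero that by blast
  then show ?L unfolding rel1_iff by (intro allI sum.neutral ballI) auto
next
  assume L: ?L
  show ?R
  proof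
    fix m show "P (Suc m) * P m = 0"
    proof (induction m rule: less_induct)
      case (less m)
      then have z: "P k * P l = 0" if "l < m" "l < k" for k l using P_P_zero that by blast
      let ?S = "\<lambda>k. \<Sum>l\<le>2*m+1-k. P k * P l * E (2*m+1-k-l)"
      have "0 = sum ?S {m<..2*m+1}"
        using L unfolding rel1_iff by simp
      also have "{m<..2*m+1} = insert (Suc m) {Suc m<..2*m+1}" by auto
      also have "sum ?S \<dots> = ?S (Suc m) + sum ?S {Suc m<..2*m+1}" by simp
      also have "sum ?S {Suc m<..2*m+1} = 0"
        by (intro sum.neutral ballI) (auto intro!: sum.neutral simp: z)
      also have "?S (Suc m) = (\<Sum>l<m. P (Suc m) * P l * E (m - l)) + P (Suc m) * P m"
        by (simp flip: lessThan_Suc_atMost)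
      also have "(\<Sum>l<m. P (Suc m) * P l * E (m - l)) = 0"
        by (intro sum.neutral ballI) (auto simp: z)
      finally show ?case by simp
    qed
  qed
qed

end

lemma two_gen_opp:
  "two_gen.R (opp j) (opp i) = opp (two_gen.R i j)"
  "two_gen.P (opp j) (opp i) n = opp (two_gen.I i j n)"
  "two_gen.I (opp j) (opp i) n = opp (two_gen.P i j n)"
  "two_gen.Rs (opp j) (opp i) n = opp (two_gen.Rs i j n)"
  "two_gen.E (opp j) (opp i) n = opp (two_gen.E i j n)"
  by (simp_all add: two_gen.R_def two_gen.P_def two_gen.I_def two_gen.Rs_def two_gen.E_def
      opp_simps mult.assoc)

section \<open>Equivalence of the rules at \<open>q = 0\<close> with the relations (1)-(3)\<close>

locale kron_rules = two_gen +
  assumes comm_Rs: "\<And>a b. 1 \<le> a \<Longrightarrow> 1 \<le> b \<Longrightarrow> Rs a * Rs b = Rs b * Rs a"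
    and P_Suc_P: "\<And>n. P (Suc n) * P n = 0"
    and I_I_Suc: "\<And>n. I n * I (Suc n) = 0"

locale kron_rels = two_gen +
  assumes rel1: "\<And>m. i ^ m * j ^ (m + 1) * i ^ (m + 1) * j ^ (m + 2) =
      i ^ (2 * m + 1) * j ^ (2 * m + 3)"
    and rel2: "\<And>n. i ^ (n + 2) * j ^ (n + 1) * i ^ (n + 1) * j ^ n = i ^ (2 * n + 3) * j ^ (2 * n
        + 1)"
    and rel3: "\<And>m n. 1 \<le> m \<Longrightarrow> 1 \<le> n \<Longrightarrow> (i ^ m * j ^ m) * (i ^ n * j ^ n) =
        (i ^ n * j ^ n) * (i ^ m * j ^ m)"

sublocale kron_rules \<subseteq> two_gen_base
proof
  show "R * j * j = 0" using P_Suc_P[of 0] by (simp add: P_def)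
  show "i * i * R = 0" using I_I_Suc[of 0] by (simp add: I_def mult.assoc)
qed

sublocale kron_rels \<subseteq> two_gen_base
proof
  show "R * j * j = 0" using rel1[of 0]
    by (simp add: R_def numeral_3_eq_3 power2_eq_square algebra_simps)
  show "i * i * R = 0" using rel2[of 0]
    by (simp add: R_def numeral_3_eq_3 power2_eq_square algebra_simps)
qed

sublocale kron_rels \<subseteq> two_gen_comm
proof
  show comm_E: "E a * E b = E b * E a" for a b
    using rel3[of a b] by (cases "a = 0 \<or> b = 0") (auto simp: E_def)
  show "Rs s * E a = E a * Rs s" if "2 \<le> s" for s a
    using that
  proof (induction s rule: less_induct)
    case (less s)
    then obtain m where s: "s = Suc (Suc m)" by (metis Suc_le_D numeral_2_eq_2 Suc_le_mono)
    \<comment> \<open>The last summand is \<open>Rs s * E 0\<close>, so the recursion can be solved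
      for \<open>Rs s\<close>.\<close>
    have "E s = E 1 * E (Suc m) + (\<Sum>k<Suc m. Rs (k + 2) * E (Suc m - Suc k))"
      unfolding s by (rule E_rec) (rule comm_E)
    then have "Rs s = E s - E 1 * E (Suc m) - (\<Sum>k<m. Rs (k + 2) * E (m - k))"
      by (simp add: s algebra_simps)
    moreover have "Rs (k + 2) * E (m - k) * E a = E a * (Rs (k + 2) * E (m - k))" if "k < m" for k
      using less.IH[of "k + 2"] that comm_E[of a] by (simp add: s) (metis mult.assoc)
    moreover have "E 1 * E (Suc m) * E a = E a * (E 1 * E (Suc m))"
      by (metis comm_E mult.assoc)
    ultimately show ?case
      using comm_E[of s a]
      by (simp add: left_diff_distrib right_diff_distrib sum_distrib_left sum_distrib_right)
  qed
qed

context kron_rels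
begin

lemma comm_Rs_Rs:
  assumes "2 \<le> s" "2 \<le> t"
  shows "Rs s * Rs t = Rs t * Rs s"
  using assms(2)
proof (induction t rule: less_induct)
  case (less t)
  then obtain m where t: "t = Suc (Suc m)" by (metis Suc_le_D numeral_2_eq_2 Suc_le_mono)
  have "E t = E 1 * E (Suc m) + (\<Sum>k<Suc m. Rs (k + 2) * E (Suc m - Suc k))"
    unfolding t by (rule E_rec) (rule comm_E)
  then have "Rs t = E t - E 1 * E (Suc m) - (\<Sum>k<m. Rs (k + 2) * E (m - k))"
    by (simp add: t algebra_simps)
  moreover have "Rs (k + 2) * E (m - k) * Rs s = Rs s * (Rs (k + 2) * E (m - k))" if "k < m" for k
    using less.IH[of "k + 2"] that comm_Rs_E[OF assms(1)] by (simp add: t) (metis mult.assoc)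
  moreover have "E 1 * E (Suc m) * Rs s = Rs s * (E 1 * E (Suc m))"
    by (metis comm_Rs_E[OF assms(1)] mult.assoc)
  ultimately show ?case
    using comm_Rs_E[OF assms(1), of t]
    by (simp add: left_diff_distrib right_diff_distrib sum_distrib_left sum_distrib_right)
qed

lemma rels_comm_Rs:
  assumes "1 \<le> a" "1 \<le> b"
  shows "Rs a * Rs b = Rs b * Rs a"
proof -
  have "R * Rs s = Rs s * R" if "2 \<le> s" for s
    using that comm_Rs_E comm_R_iff by simp
  then show ?thesis
    using assms comm_Rs_Rs[of a b] Rs_1
    by (cases "a = 1"; cases "b = 1") (auto simp: numeral_2_eq_2 Suc_le_eq)
qed

lemma rels_P_Suc_P: "P (Suc n) * P n = 0"
  using rel1_iff_PP rel1 by blast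

end

lemma (in kron_rels) kron_rels_opp: "kron_rels (opp j) (opp i)"
proof
  show "opp j ^ m * opp i ^ (m + 1) * opp j ^ (m + 1) * opp i ^ (m + 2) =
      opp j ^ (2 * m + 1) * opp i ^ (2 * m + 3)" for m
    using rel2[of m] by (simp only: opp_simps mult.assoc)
  show "opp j ^ (n + 2) * opp i ^ (n + 1) * opp j ^ (n + 1) * opp i ^ n =
      opp j ^ (2 * n + 3) * opp i ^ (2 * n + 1)" for n
    using rel1[of n] by (simp only: opp_simps mult.assoc)
  show "opp j ^ m * opp i ^ m * (opp j ^ n * opp i ^ n) =
      opp j ^ n * opp i ^ n * (opp j ^ m * opp i ^ m)"
    if "1 \<le> m" "1 \<le> n" for m n
    using rel3[OF that] by (simp only: opp_simps)
qed

sublocale kron_rels \<subseteq> kron_rules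
proof
  show "I n * I (Suc n) = 0" for n
    using kron_rels.rels_P_Suc_P[OF kron_rels_opp, of n] by (simp add: two_gen_opp opp_simps)
qed (fact rels_comm_Rs rels_P_Suc_P)+

sublocale kron_rules \<subseteq> two_gen_comm
proof
  have Rs2: "E 1 * Rs s = Rs s * E 1" if "2 \<le> s" for s
    using comm_Rs[of 1 s] that comm_R_iff[of s] Rs_1 by simp
  \<comment> \<open>\<open>E_rec\<close> presupposes that \<open>E 1\<close> commutes with the
    smaller \<open>E k\<close>. Claiming this for every \<open>x\<close> that commutes with
    \<open>E 1\<close> and the \<open>Rs s\<close> lets the induction supply it, with
    \<open>x = E 1\<close>.\<close>
  have main: "E m * x = x * E m"
    if "E 1 * x = x * E 1" "\<And>s. 2 \<le> s \<Longrightarrow> Rs s * x = x * Rs s" for m x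
    using that
  proof (induction m arbitrary: x rule: less_induct)
    case (less m)
    show ?case
    proof (cases m)
      case (Suc n)
      have "E 1 * E k = E k * E 1" if "k < n" for k
        using less.IH[of k "E 1"] Rs2 that Suc by simp
      then have "E m = E 1 * E n + (\<Sum>k<n. Rs (k + 2) * E (n - Suc k))"
        unfolding Suc by (rule E_rec)
      moreover have "E 1 * E n * x = x * (E 1 * E n)"
        using less.IH[of n x] less.prems Suc by (metis lessI mult.assoc)
      moreover have "Rs (k + 2) * E (n - Suc k) * x = x * (Rs (k + 2) * E (n - Suc k))" if "k < n"
          for k
        using less.IH[of "n - Suc k" x] less.prems Suc that
        by (metis diff_less_Suc less_SucI le_add2 mult.assoc)
      ultimately show ?thesis
        by (simp add: distrib_left distrib_right sum_distrib_left sum_distrib_right)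
    qed simp
  qed
  show RsE: "Rs s * E a = E a * Rs s" if "2 \<le> s" for s a
    using main[of "Rs s" a] Rs2 comm_Rs that by simp
  show "E a * E b = E b * E a" for a b
    by (rule main) (use main[of "E 1" b] Rs2 RsE in auto)
qed

lemma (in kron_rules) kron_rules_opp: "kron_rules (opp j) (opp i)"
  by standard (simp_all add: two_gen_opp opp_simps comm_Rs P_Suc_P I_I_Suc)

sublocale kron_rules \<subseteq> kron_rels
proof
  interpret opp: kron_rules "opp j" "opp i" by (rule kron_rules_opp)
  show "i ^ m * j ^ (m + 1) * i ^ (m + 1) * j ^ (m + 2) = i ^ (2 * m + 1) * j ^ (2 * m + 3)" for m
    using rel1_iff_PP P_Suc_P by blast
  show "i ^ (n + 2) * j ^ (n + 1) * i ^ (n + 1) * j ^ n = i ^ (2 * n + 3) * j ^ (2 * n + 1)" for n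
  proof -
    have "opp j ^ n * opp i ^ (n + 1) * opp j ^ (n + 1) * opp i ^ (n + 2) =
        opp j ^ (2 * n + 1) * opp i ^ (2 * n + 3)"
      using opp.rel1_iff_PP opp.P_Suc_P by blast
    then show ?thesis by (simp only: opp_simps mult.assoc)
  qed
  show "(i ^ m * j ^ m) * (i ^ n * j ^ n) = (i ^ n * j ^ n) * (i ^ m * j ^ m)" for m n
    using comm_E[of m n] by (simp add: E_def)
qed

section \<open>Ordered products span\<close>

context two_gen
begin

definition pbw :: "nat list \<times> nat list \<times> nat list \<Rightarrow> 'a" where
  "pbw = (\<lambda>(ms, ss, ns). prod_list (map P ms) * prod_list (map Rs ss) * prod_list (map I ns))"

text \<open>Sums without coefficients suffice, because straightening a word yields only sums of
  ordered products or 0. So no field of scalars enters and the result serves any ring.\<close>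

inductive_set pbw_sums :: "'a set" where
  zero: "0 \<in> pbw_sums"
| add: "x \<in> pbw_index \<Longrightarrow> y \<in> pbw_sums \<Longrightarrow> pbw x + y \<in> pbw_sums"

lemma pbw_in_sums: "x \<in> pbw_index \<Longrightarrow> pbw x \<in> pbw_sums"
  using pbw_sums.add[OF _ pbw_sums.zero] by simp

lemma pbw_sums_add: "x \<in> pbw_sums \<Longrightarrow> y \<in> pbw_sums \<Longrightarrow> x + y \<in> pbw_sums"
  by (induction rule: pbw_sums.induct) (auto simp: add.assoc intro: pbw_sums.add)

lemma pbw_sums_mult:
  assumes "\<And>x. x \<in> pbw_index \<Longrightarrow> a * pbw x \<in> pbw_sums" "y \<in> pbw_sums"
  shows "a * y \<in> pbw_sums"
  using assms(2,1)
  by (induction rule: pbw_sums.induct) (auto simp: distrib_left intro: pbw_sums_add pbw_sums.zero)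

end

context kron_rules
begin

lemma P_P: "n < m \<Longrightarrow> P m * P n = 0"
  using P_P_zero P_Suc_P by blast

lemma I_I: "m < n \<Longrightarrow> I m * I n = 0"
  using kron_rules.P_P[OF kron_rules_opp, of m n] by (simp add: two_gen_opp opp_simps)

lemma R_pow_Rs: "1 \<le> s \<Longrightarrow> R ^ m * Rs s = Rs s * R ^ m"
  using comm_Rs[of 1 s] Rs_1 by (simp add: power_commuting_commutes)

lemma Rs_P: "2 \<le> s \<Longrightarrow> Rs s * P m = 0"
  using R_pow_Rs[of s m] Rs_j[of s] unfolding P_def
  by (metis mult.assoc mult_zero_right numeral_le_one_iff one_le_numeral order_trans)

lemma Rs_insert:
  assumes "sorted_wrt (\<ge>) ss" "\<forall>s\<in>set ss. 1 \<le> s" "1 \<le> s"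
  shows "\<exists>ts. sorted_wrt (\<ge>) ts \<and> set ts = insert s (set ss) \<and>
    prod_list (map Rs ts) = Rs s * prod_list (map Rs ss)"
  using assms
proof (induction ss)
  case Nil
  show ?case by (rule exI[of _ "[s]"]) simp
next
  case (Cons t ss)
  show ?case
  proof (cases "t \<le> s")
    case True
    then show ?thesis using Cons.prems by (intro exI[of _ "s # t # ss"]) auto
  next
    case False
    obtain ts where "sorted_wrt (\<ge>) ts" "set ts = insert s (set ss)"
      "prod_list (map Rs ts) = Rs s * prod_list (map Rs ss)"
      using Cons by auto
    then show ?thesis using Cons.prems False comm_Rs[of s t]
      by (intro exI[of _ "t # ts"]) (auto simp flip: mult.assoc)
  qed
qed

lemma Rs_mult_pbw:
  assumes "([], ss, ns) \<in> pbw_index" "1 \<le> s"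
  shows "Rs s * pbw ([], ss, ns) \<in> pbw_sums"
proof -
  obtain ts where "sorted_wrt (\<ge>) ts" "set ts = insert s (set ss)"
      "prod_list (map Rs ts) = Rs s * prod_list (map Rs ss)"
    using Rs_insert[of ss s] assms by (auto simp: pbw_index_def)
  then have "([], ts, ns) \<in> pbw_index" "Rs s * pbw ([], ss, ns) = pbw ([], ts, ns)"
    using assms by (auto simp: pbw_index_def pbw_def mult.assoc)
  then show ?thesis using pbw_in_sums by simp
qed

text \<open>\<open>R P m = P (m+1)\<close> stays in order unless the next factor is again
  \<open>P m\<close>, and then \<open>P (m+1) P m = 0\<close>.\<close>

lemma R_mult_pbw:
  assumes "x \<in> pbw_index"
  shows "R * pbw x \<in> pbw_sums"
proof -
  obtain ms ss ns where x: "x = (ms, ss, ns)" by (cases x)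
  show ?thesis
  proof (cases ms)
    case Nil
    then show ?thesis using Rs_mult_pbw[of ss ns 1] assms Rs_1 by (simp add: x)
  next
    case (Cons m ms')
    have eq: "R * pbw x = pbw (Suc m # ms', ss, ns)"
      by (simp add: x Cons pbw_def flip: R_mult_P mult.assoc)
    show ?thesis
    proof (cases "\<exists>ms''. ms' = m # ms''")
      case True
      then have "pbw (Suc m # ms', ss, ns) = 0"
        by (auto simp: pbw_def P_P simp flip: mult.assoc)
      then show ?thesis by (simp add: eq pbw_sums.zero)
    next
      case False
      have "Suc m \<le> k" if "k \<in> set ms'" for k
        using assms that False by (cases ms') (auto simp: x Cons pbw_index_def)
      then have "(Suc m # ms', ss, ns) \<in> pbw_index"
        using assms by (auto simp: x Cons pbw_index_def)
      then show ?thesis by (simp add: eq pbw_in_sums)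
    qed
  qed
qed

lemma j_mult_pbw:
  assumes "x \<in> pbw_index"
  shows "j * pbw x \<in> pbw_sums"
proof -
  obtain ms ss ns where x: "x = (ms, ss, ns)" by (cases x)
  then have "j * pbw x = pbw (0 # ms, ss, ns)" "(0 # ms, ss, ns) \<in> pbw_index"
    using assms by (auto simp: pbw_def pbw_index_def mult.assoc)
  then show ?thesis using pbw_in_sums by simp
qed

text \<open>\<open>i\<close> kills a leading \<open>Rs s\<close> with \<open>s \<ge> 2\<close>.
  Otherwise, the indices being decreasing, all are 1 and \<open>i R^t = I t\<close>, which is in
  order or annihilates the first \<open>I n\<close>.\<close>

lemma i_mult_pbw_Nil:
  assumes "([], ss, ns) \<in> pbw_index"
  shows "i * pbw ([], ss, ns) \<in> pbw_sums"
proof (cases "\<exists>s ss'. ss = s # ss' \<and> 2 \<le> s")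
  case True
  then have "i * pbw ([], ss, ns) = 0"
    by (auto simp: pbw_def i_Rs simp flip: mult.assoc)
  then show ?thesis by (simp add: pbw_sums.zero)
next
  case False
  have "\<forall>s\<in>set ss. s = 1"
    using assms False by (cases ss) (fastforce simp: pbw_index_def not_le numeral_2_eq_2
        less_Suc_eq_le)+
  then have "ss = replicate (length ss) 1"
    by (simp add: replicate_length_same)
  then have "prod_list (map Rs ss) = R ^ length ss"
    by (metis Rs_1 One_nat_def map_replicate prod_list_replicate)
  then have eq: "i * pbw ([], ss, ns) = I (length ss) * prod_list (map I ns)"
    by (simp add: pbw_def I_def mult.assoc)
  show ?thesis
  proof (cases "\<exists>n ns'. ns = n # ns' \<and> length ss < n")
    case True
    then show ?thesis unfolding eq by (auto simp: I_I pbw_sums.zero simp flip: mult.assoc)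
  next
    case False
    have "n \<le> length ss" if "n \<in> set ns" for n
      using assms False that by (cases ns) (fastforce simp: pbw_index_def)+
    then have "([], [], length ss # ns) \<in> pbw_index"
      using assms by (auto simp: pbw_index_def)
    then show ?thesis using pbw_in_sums[of "([], [], length ss # ns)"] unfolding eq
        by (simp add: pbw_def)
  qed
qed

text \<open>A leading \<open>P 0 = j\<close> is split by \<open>i j = R + j i\<close>; a leading
  \<open>P m\<close> with \<open>m > 0\<close> becomes \<open>Rs (m+1)\<close>, which annihilates
  any further \<open>P\<close>.\<close>

lemma i_mult_pbw:
  assumes "x \<in> pbw_index"
  shows "i * pbw x \<in> pbw_sums"
proof -
  obtain ms ss ns where x: "x = (ms, ss, ns)" by (cases x)
  show ?thesis using assms unfolding x
  proof (induction ms)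
    case Nil
    then show ?case by (rule i_mult_pbw_Nil)
  next
    case (Cons m ms)
    then have idx: "(ms, ss, ns) \<in> pbw_index" by (auto simp: pbw_index_def)
    show ?case
    proof (cases m)
      case 0
      have "i * pbw (m # ms, ss, ns) = i * j * pbw (ms, ss, ns)"
        by (simp add: 0 pbw_def mult.assoc)
      then have "i * pbw (m # ms, ss, ns) = R * pbw (ms, ss, ns) + j * (i * pbw (ms, ss, ns))"
        by (simp add: ij_eq distrib_right mult.assoc)
      then show ?thesis
        using R_mult_pbw[OF idx] Cons.IH[OF idx] pbw_sums_mult[of j] j_mult_pbw pbw_sums_add by simp
    next
      case (Suc k)
      have "i * pbw (m # ms, ss, ns) = I 0 * P m * pbw (ms, ss, ns)"
        by (simp add: pbw_def mult.assoc)
      then have eq: "i * pbw (m # ms, ss, ns) = Rs (Suc m) * pbw (ms, ss, ns)"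
        using I_mult_P[of m 0] Suc by simp
      show ?thesis
      proof (cases ms)
        case Nil
        then show ?thesis using Rs_mult_pbw[of ss ns "Suc m"] idx unfolding eq by simp
      next
        case (Cons m' ms')
        then have "Rs (Suc m) * pbw (ms, ss, ns) = 0"
          using Suc by (simp add: pbw_def Rs_P flip: mult.assoc)
        then show ?thesis by (simp add: eq pbw_sums.zero)
      qed
    qed
  qed
qed

lemma word_in_pbw_sums: "prod_list (map (case_vertex i j) w) \<in> pbw_sums"
proof (induction w)
  case Nil
  show ?case using pbw_in_sums[of "([], [], [])"] by (simp add: pbw_def pbw_index_def)
next
  case (Cons v w)
  then show ?case
    by (cases v) (simp_all add: pbw_sums_mult i_mult_pbw j_mult_pbw)
qed

end

section \<open>Loop relations over a central parameter\<close>

text \<open>\<open>Q\<close> is \<open>q\<close> and \<open>Z\<close> is \<open>1 / (q - 1)\<close>. With the convention \<open>R 0 = Z\<close> the relation between \<open>R 1\<close> and \<open>P m\<close>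
  becomes the case \<open>a = 0\<close> of \<open>C a m = 0\<close> below.\<close>

locale loop_ring =
  fixes Q Z :: "'a::ring_1" and P I R :: "nat \<Rightarrow> 'a"
  assumes Q_central: "Q * x = x * Q" and Z_central: "Z * x = x * Z"
    and QZ: "Q * Z = 1 + Z"
    and R_0: "R 0 = Z" and R_1: "R (Suc 0) = I 0 * P 0 - P 0 * I 0"
    and R_P: "R (Suc 0) * P m = Q * (P m * R (Suc 0)) + (1 + Q) * P (Suc m)"
    and I_R: "I n * R (Suc 0) = Q * (R (Suc 0) * I n) + (1 + Q) * I (Suc n)"
    and P_P: "P (Suc 0) * P 0 = Q * (Q * (P 0 * P (Suc 0)))"
    and I_I: "I 0 * I (Suc 0) = Q * (Q * (I (Suc 0) * I 0))"
    and Q_cancel: "Q * x = 0 \<Longrightarrow> x = 0"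
    and Q1_cancel: "(1 + Q) * x = 0 \<Longrightarrow> x = 0"
    and QQ1_cancel: "(1 + Q * Q) * x = 0 \<Longrightarrow> x = 0"
    and Q_sum_cancel: "(Q ^ a + (\<Sum>k\<le>a. Q ^ (2 * k))) * x = 0 \<Longrightarrow> x = 0"
begin

lemma Q_left: "x * (Q * y) = Q * (x * y)"
  by (metis Q_central mult.assoc)

lemma Qpow_central: "Q ^ k * x = x * Q ^ k"
  by (metis Q_central power_commuting_commutes)

lemma Qpow_left: "x * (Q ^ k * y) = Q ^ k * (x * y)"
  by (metis Qpow_central mult.assoc)

lemmas cen =
  Q_central[of "P m" for m, symmetric] Q_central[of "I m" for m, symmetric] Q_central[of "R m"
      for m, symmetric]
  Q_left[of "P m" for m] Q_left[of "I m" for m] Q_left[of "R m" for m]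
  Qpow_central[of _ "P m" for m, symmetric] Qpow_central[of _ "I m"
      for m, symmetric] Qpow_central[of _ "R m" for m, symmetric]
  Qpow_left[of "P m" for m] Qpow_left[of "I m" for m] Qpow_left[of "R m" for m]
  Qpow_central[of _ Q, symmetric] Qpow_left[of Q, symmetric] power_add mult.assoc

text \<open>The relations to be proved are \<open>c n m = R (n + m + 1)\<close>, \<open>C a m = 0\<close> and \<open>C' a n = 0\<close>; the last two
  move \<open>R (a + 1)\<close> past \<open>P m\<close> and \<open>I n\<close>.\<close>

definition c :: "nat \<Rightarrow> nat \<Rightarrow> 'a" where
  "c n m = I n * P m - Q ^ (n + m) * (P m * I n)"

definition C :: "nat \<Rightarrow> nat \<Rightarrow> 'a" where
  "C a m = R (Suc a) * P m - Q * (Q * (R a * P (Suc m))) - Q ^ Suc a * (P m * R (Suc a))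
      + Q ^ a * (P (Suc m) * R a)"

definition C' :: "nat \<Rightarrow> nat \<Rightarrow> 'a" where
  "C' a n = I n * R (Suc a) - Q * (Q * (I (Suc n) * R a)) - Q ^ Suc a * (R (Suc a) * I n)
      + Q ^ a * (R a * I (Suc n))"

lemma Qpow_cancel: "Q ^ k * x = 0 \<Longrightarrow> x = 0"
  by (induction k) (auto simp: mult.assoc dest: Q_cancel)

text \<open>Both index shifts are twisted commutators with \<open>R 1\<close>. Once
  \<open>c n m\<close> commutes with \<open>R 1\<close>, cancelling \<open>1 + Q\<close> gives
  \<open>c (n+1) m = c n (m+1)\<close>.\<close>

lemma c_shift: "(1 + Q) * (c (Suc n) m - c n (Suc m)) = Q * (c n m * R (Suc 0) - R (Suc 0) * c n m)"
proof -
  have 1: "(1 + Q) * I (Suc n) = I n * R (Suc 0) - Q * (R (Suc 0) * I n)"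
    by (simp add: I_R)
  have 2: "(1 + Q) * P (Suc m) = R (Suc 0) * P m - Q * (P m * R (Suc 0))"
    by (simp add: R_P)
  have "(1 + Q) * (c (Suc n) m - c n (Suc m)) =
    ((1 + Q) * I (Suc n)) * P m - Q * (Q ^ (n + m) * (P m * ((1 + Q) * I (Suc n))))
    - I n * ((1 + Q) * P (Suc m)) + Q * (Q ^ (n + m) * (((1 + Q) * P (Suc m)) * I n))"
    by (simp add: c_def cen algebra_simps)
  also have "\<dots> = Q * (c n m * R (Suc 0) - R (Suc 0) * c n m)"
    unfolding 1 2 by (simp add: c_def cen algebra_simps)
  finally show ?thesis .
qed

text \<open>Compares the ways of moving \<open>R (a + 2)\<close> through \<open>I n * P m\<close> and through \<open>P m * I n\<close>.\<close>

lemma comm_recursion: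
  assumes "C (Suc a) m = 0" "C a m = 0" "C' (Suc a) n = 0" "C' a n = 0"
  shows "Q * (R (a + 2) * c n m - c n m * R (a + 2)) - R (Suc a) * c (Suc n) m
    + Q * (Q * (c (Suc n) m * R (Suc a))) + c n (Suc m) * R (Suc a) - Q * (Q * (R (Suc a) * c n
        (Suc m)))
    - Q * (c (Suc n) (Suc m) * R a - R a * c (Suc n) (Suc m)) = 0"
    (is "?X = 0")
proof -
  have "Q ^ Suc a * ?X =
      I n * C (Suc a) m - C' (Suc a) n * P m - Q * (Q * (I (Suc n) * C a m)) + Q * (Q * (C' a n *
          P (Suc m)))
      - Q ^ Suc a * (Q * (Q ^ (n + m) * (C (Suc a) m * I n - P m * C' (Suc a) n - C a m * I (Suc n)
          + P (Suc m) * C' a n)))"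
    by (simp add: c_def C_def C'_def cen algebra_simps)
  then have "Q ^ Suc a * ?X = 0" by (simp add: assms)
  then show ?thesis by (rule Qpow_cancel)
qed

text \<open>The q-commutator with \<open>R 1\<close> raises the index of \<open>P\<close> and passes
  through \<open>R a\<close> and \<open>R (a+1)\<close>, so it carries \<open>C a m\<close> to
  \<open>(1 + Q) C a (m+1)\<close>.\<close>

lemma C_Suc:
  assumes "R (Suc 0) * R a = R a * R (Suc 0)" "R (Suc 0) * R (Suc a) = R (Suc a) * R (Suc 0)"
      "C a m = 0"
  shows "C a (Suc m) = 0"
proof -
  have 2: "(1 + Q) * P (Suc m) = R (Suc 0) * P m - Q * (P m * R (Suc 0))" for m
    by (simp add: R_P)
  have com: "R (Suc 0) * (R a * x) = R a * (R (Suc 0) * x)"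
    "R (Suc 0) * (R (Suc a) * x) = R (Suc a) * (R (Suc 0) * x)" for x
    using assms by (metis mult.assoc)+
  have "(1 + Q) * C a (Suc m) = R (Suc a) * ((1 + Q) * P (Suc m)) - Q * (Q * (R a * ((1
      + Q) * P (Suc (Suc m)))))
     - Q ^ Suc a * (((1 + Q) * P (Suc m)) * R (Suc a)) + Q ^ a * (((1 + Q) * P (Suc (Suc m))) * R
         a)"
    by (simp add: C_def cen algebra_simps)
  also have "\<dots> = R (Suc 0) * C a m - Q * (C a m * R (Suc 0))"
    unfolding 2 by (simp add: C_def cen com assms(1,2) algebra_simps)
  finally show ?thesis using assms(3) Q1_cancel by simp
qed

text \<open>This is what fixes \<open>Z\<close>: the identity amounts to
  \<open>(Q * Q - 1) * Z = Q + 1\<close>.\<close>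

lemma C_0: "C 0 m = 0"
proof -
  have "Z * x = x * Z" "Q * (Z * x) = x + Z * x" "Q * (x * Z) = x + Z * x" for x
    using Z_central QZ Q_left by (metis, metis distrib_right mult.assoc mult_1_left, metis
        Z_central distrib_right mult.assoc mult_1_left)
  then show ?thesis
    by (simp add: C_def R_0 R_P cen algebra_simps)
qed

text \<open>The q-commutator of \<open>I 0\<close> with the Serre relation \<open>P_P\<close> is
  exactly \<open>C 1 0\<close> once \<open>I 0\<close> has been moved to the right.\<close>

lemma C_1_0:
  assumes "c 0 1 = R 2"
  shows "C 1 0 = 0"
proof -
  let ?F = "P (Suc 0) * P 0 - Q * (Q * (P 0 * P (Suc 0)))"
  have c: "I 0 * P (Suc 0) = R (Suc (Suc 0)) + Q * (P (Suc 0) * I 0)"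
    using assms by (simp add: c_def numeral_2_eq_2 algebra_simps)
  have d: "I 0 * P 0 = R (Suc 0) + P 0 * I 0"
    using R_1 by simp
  have cd: "I 0 * (P (Suc 0) * x) = R (Suc (Suc 0)) * x + Q * (P (Suc 0) * (I 0 * x))"
    "I 0 * (P 0 * x) = R (Suc 0) * x + P 0 * (I 0 * x)" for x
    unfolding mult.assoc[symmetric] c d by (simp_all add: algebra_simps)
  have "I 0 * ?F - Q * (?F * I 0) = C 1 0"
    by (simp add: C_def cen c d cd algebra_simps)
  then show ?thesis using P_P by simp
qed

text \<open>Drinfeld's quadratic relation between \<open>P (k+1)\<close>, \<open>P 0\<close>,
  \<open>P k\<close> and \<open>P 1\<close>, up to the twist \<open>Q ^ k\<close>. It is chosen
  because its twisted commutator with \<open>I 0\<close> is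
  \<open>C (k+1) 0 + Q ^ k C 1 k\<close>.\<close>

definition serre_comb :: "nat \<Rightarrow> 'a" where
  "serre_comb k = P (Suc k) * P 0 + Q ^ k * (P (Suc 0) * P k)
    - Q * (Q * (Q ^ k * (P 0 * P (Suc k)))) - Q * (Q * (P k * P (Suc 0)))"

lemma C_from_serre_comb:
  assumes c: "\<And>a. a \<le> Suc k \<Longrightarrow> c 0 a = R (Suc a)" and "C 1 k = 0" "serre_comb k = 0"
  shows "C (Suc k) 0 = 0"
proof -
  have c': "I 0 * P a = R (Suc a) + Q ^ a * (P a * I 0)" if "a \<le> Suc k" for a
    using c[OF that] by (simp add: c_def algebra_simps)
  have c'': "I 0 * (P a * x) = R (Suc a) * x + Q ^ a * (P a * (I 0 * x))" if "a \<le> Suc k" for a x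
    unfolding mult.assoc[symmetric] c'[OF that] by (simp add: algebra_simps)
  have "I 0 * serre_comb k - Q ^ Suc k * (serre_comb k * I 0) = C (Suc k) 0 + Q ^ k * C 1 k"
    by (simp add: serre_comb_def C_def cen c'[of 0] c''[of 0] c'[of k] c''[of k] c'[of "Suc 0"]
        c''[of "Suc 0"]
        c'[of "Suc k"] c''[of "Suc k"] algebra_simps)
  then show ?thesis using assms by simp
qed

text \<open>A combination of products \<open>P a * P b\<close> is a list of central weights and index pairs. Commuting it with
  \<open>R 1\<close> and \<open>R 2\<close> acts on the indices by \<open>D = s + q t\<close> and \<open>q D\<^sup>2 - (1 + q\<^sup>2) s t\<close>, where \<open>s\<close> and \<open>t\<close> shift
  the first and the second index; so a vanishing combination stays zero under \<open>s t\<close>.\<close>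

definition combination :: "(nat \<Rightarrow> nat \<Rightarrow> 'a) \<Rightarrow> ('a \<times> nat \<times> nat) list \<Rightarrow> 'a" where
  "combination f L = (\<Sum>(w, a, b)\<leftarrow>L. w * f a b)"

abbreviation F :: "nat \<Rightarrow> nat \<Rightarrow> 'a" where "F a b \<equiv> P a * P b"
abbreviation T1 :: "nat \<Rightarrow> nat \<Rightarrow> 'a" where "T1 a b \<equiv> F (Suc a) b + Q * F a (Suc b)"
abbreviation T2 :: "nat \<Rightarrow> nat \<Rightarrow> 'a" where
  "T2 a b \<equiv> Q * F (Suc (Suc a)) b + (Q * Q - 1) * F (Suc a) (Suc b)
      + Q * (Q * (Q * F a (Suc (Suc b))))"

lemma combination_linear:
  assumes "\<forall>(w, a, b) \<in> set L. \<forall>x. w * x = x * w"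
  shows "combination (\<lambda>a b. x * f a b * y + z * g a b) L = x * combination f L * y
      + z * combination g L"
  using assms
proof (induction L)
  case Nil
  then show ?case by (simp add: combination_def)
next
  case (Cons t L)
  obtain w a b where t: "t = (w, a, b)" by (cases t)
  have w: "w * (u * v) = u * (w * v)" for u v
    using Cons.prems by (simp add: t) (metis mult.assoc)
  have "combination (\<lambda>a b. x * f a b * y + z * g a b) (t # L) = w * (x * f a b * y + z * g a b)
      + (x * combination f L * y + z * combination g L)"
    using Cons by (simp add: combination_def t)
  then show ?case
    by (simp add: combination_def t w algebra_simps)
qed

lemma R1_F: "R (Suc 0) * F a b = (Q * Q) * F a b * R (Suc 0) + (1 + Q) * T1 a b"
proof -
  have "R (Suc 0) * (P m * x) = Q * (P m * (R (Suc 0) * x)) + (1 + Q) * (P (Suc m) * x)" for m x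
    unfolding mult.assoc[symmetric] R_P by (simp add: algebra_simps)
  then show ?thesis
    by (simp add: R_P cen algebra_simps)
qed

lemma R2_F:
  assumes "\<And>m. C 1 m = 0"
  shows "R 2 * F a b = (Q * Q * Q * Q) * F a b * R 2 + (1 * ((Q * Q * (Q * Q
      - 1)) * T1 a b * R (Suc 0)) + (1 + Q) * Q * T2 a b)"
proof -
  have 2: "R 2 * P m = Q * (Q * (P m * R 2)) - Q * (P (Suc m) * R (Suc 0))
      + Q * (Q * (R (Suc 0) * P (Suc m)))" for m
    using assms[of m] by (simp add: C_def numeral_2_eq_2 algebra_simps)
  have 2: "R 2 * P m = Q * (Q * (P m * R 2)) + (Q * Q - 1) * (Q * (P (Suc m) * R (Suc 0)))
      + Q * (Q * ((1 + Q) * P (Suc (Suc m))))" for m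
    unfolding 2 R_P by (simp add: algebra_simps)
  have t2: "R 2 * (P m * x) = Q * (Q * (P m * (R 2 * x))) + (Q * Q
      - 1) * (Q * (P (Suc m) * (R (Suc 0) * x))) + Q * (Q * ((1 + Q) * (P (Suc (Suc m)) *
      x)))" for m x
    unfolding mult.assoc[symmetric] 2 by (simp add: algebra_simps)
  have 1: "R (Suc 0) * (P m * x) = Q * (P m * (R (Suc 0) * x)) + (1 + Q) * (P (Suc m) * x)" for m x
    unfolding mult.assoc[symmetric] R_P by (simp add: algebra_simps)
  show ?thesis
    by (simp add: R_P 2 t2 1 cen algebra_simps)
qed

end

context loop_ring
begin

definition central_weights :: "('a \<times> nat \<times> nat) list \<Rightarrow> bool" where
  "central_weights L \<longleftrightarrow> (\<forall>(w, a, b) \<in> set L. \<forall>x. w * x = x * w)"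

definition D1_list :: "('a \<times> nat \<times> nat) list \<Rightarrow> ('a \<times> nat \<times> nat) list" where
  "D1_list L = concat (map (\<lambda>(w, a, b). [(w, Suc a, b), (Q * w, a, Suc b)]) L)"

lemma combination_D1: "central_weights L \<Longrightarrow> combination f (D1_list L) =
    combination (\<lambda>a b. f (Suc a) b + Q * f a (Suc b)) L"
proof (induction L)
  case (Cons t L)
  obtain w a b where t: "t = (w, a, b)" by (cases t)
  have "Q * (w * u) = w * (Q * u)" for u
    using Q_left by simp
  then show ?case
    using Cons by (simp add: combination_def t D1_list_def central_weights_def algebra_simps)
qed (simp add: combination_def D1_list_def)

lemma central_D1_list: "central_weights L \<Longrightarrow> central_weights (D1_list L)"
  unfolding central_weights_def D1_list_def
  by (auto simp: mult.assoc Q_left)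

lemma combination_D1_zero:
  assumes "central_weights L" "combination F L = 0"
  shows "combination F (D1_list L) = 0"
proof -
  have "combination (\<lambda>a b. R (Suc 0) * F a b * 1 + 0 * 0) L = R (Suc 0) * combination F L * 1
      + 0 * combination (\<lambda>_ _. 0) L"
    using assms(1) unfolding central_weights_def by (rule combination_linear)
  moreover have "combination (\<lambda>a b. (Q * Q) * F a b * R (Suc 0) + (1 + Q) * T1 a b) L =
      (Q * Q) * combination F L * R (Suc 0) + (1 + Q) * combination T1 L"
    using assms(1) unfolding central_weights_def by (rule combination_linear)
  ultimately have "(1 + Q) * combination T1 L = 0"
    using assms(2) by (simp only: R1_F) simp
  then show ?thesis
    using Q1_cancel combination_D1[OF assms(1)] by simp
qed

lemma combination_shift_zero:
  assumes "\<And>m. C 1 m = 0" "central_weights L" "combination F L = 0"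
  shows "combination (\<lambda>a b. F (Suc a) (Suc b)) L = 0"
proof -
  note lin = combination_linear[OF assms(2)[unfolded central_weights_def]]
  have T1: "combination T1 L = 0"
    using combination_D1_zero[OF assms(2,3)] combination_D1[OF assms(2)] by simp
  have "combination (\<lambda>a b. R 2 * F a b * 1 + 0 * 0) L = R 2 * combination F L * 1
      + 0 * combination (\<lambda>_ _. 0) L"
    by (rule lin)
  moreover have "combination (\<lambda>a b. (Q * Q * Q * Q) * F a b * R 2 + 1 * ((Q * Q * (Q * Q
      - 1)) * T1 a b * R (Suc 0) + (1 + Q) * Q * T2 a b)) L
      = (Q * Q * Q * Q) * combination F L * R 2 + 1 * ((Q * Q * (Q * Q - 1)) * combination T1 L *
          R (Suc 0) + (1 + Q) * Q * combination T2 L)"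
    by (subst lin) (subst lin, rule refl)
  ultimately have "(1 + Q) * (Q * combination T2 L) = 0"
    using assms(3) T1 unfolding R2_F[OF assms(1)] by (simp add: mult.assoc)
  then have T2: "combination T2 L = 0"
    using Q1_cancel Q_cancel by blast
  have "combination F (D1_list (D1_list L)) = 0"
    using assms combination_D1_zero central_D1_list by blast
  then have T11: "combination (\<lambda>a b. T1 (Suc a) b + Q * T1 a (Suc b)) L = 0"
    by (simp add: combination_D1 central_D1_list assms(2))
  have "combination (\<lambda>a b. (- Q) * (T1 (Suc a) b + Q * T1 a (Suc b)) * 1 + 1 * T2 a b) L
      = (- Q) * combination (\<lambda>a b. T1 (Suc a) b + Q * T1 a (Suc b)) L * 1 + 1 * combination T2 L"
    by (rule lin)
  moreover have "\<dots> = 0" using T2 T11 by simp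
  moreover have "(\<lambda>a b. (- Q) * (T1 (Suc a) b + Q * T1 a (Suc b)) * 1 + 1 * T2 a b)
     = (\<lambda>a b. - (1 + Q * Q) * F (Suc a) (Suc b) * 1 + 0 * 0)"
    by (intro ext) (simp add: cen algebra_simps)
  moreover have "combination (\<lambda>a b. - (1 + Q * Q) * F (Suc a) (Suc b) * 1 + 0 * 0) L
      = - (1 + Q * Q) * combination (\<lambda>a b. F (Suc a) (Suc b)) L * 1 + 0 * combination (\<lambda>_ _. 0) L"
    by (rule lin)
  ultimately have "- (1 + Q * Q) * combination (\<lambda>a b. F (Suc a) (Suc b)) L * 1
      + 0 * combination (\<lambda>_ _. 0) L = 0"
    by (simp only:)
  then have "(1 + Q * Q) * combination (\<lambda>a b. F (Suc a) (Suc b)) L = 0"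
    by (simp only: mult_1_right mult_zero_left add_0_right minus_mult_left[symmetric]
        neg_equal_0_iff_equal)
  then show ?thesis
    by (rule QQ1_cancel)
qed

definition PP_list :: "('a \<times> nat \<times> nat) list" where
  "PP_list = [(1, 1, 0), (- (Q * Q), 0, 1)]"

definition serre_list :: "nat \<Rightarrow> ('a \<times> nat \<times> nat) list" where
  "serre_list k = [(1, Suc k, 0), (Q ^ k, 1, k), (- (Q * Q * Q ^ k), 0, Suc k), (- (Q * Q), k, 1)]"

lemma central_lists: "central_weights PP_list" "central_weights (serre_list k)"
proof -
  have QQ: "Q * Q = Q ^ 2" "Q ^ 2 * Q ^ k = Q ^ (2 + k)"
    by (simp_all only: power2_eq_square power_add)
  have c: "1 * x = x * 1" "Q ^ n * x = x * Q ^ n" "- (Q ^ n) * x = x * - (Q ^ n)" for x n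
    using Qpow_central[of n x] by simp_all
  have Cons: "central_weights ((w, a, b) # L) \<longleftrightarrow> (\<forall>x. w * x = x * w) \<and> central_weights L"
    and Nil: "central_weights []" for w a b L
    by (simp_all add: central_weights_def)
  show "central_weights PP_list"
    unfolding PP_list_def QQ Cons by (intro conjI allI c Nil)
  show "central_weights (serre_list k)"
    unfolding serre_list_def QQ Cons by (intro conjI allI c Nil)
qed

lemma P_Suc_P:
  assumes "\<And>m. C 1 m = 0"
  shows "P (Suc n) * P n = Q * (Q * (P n * P (Suc n)))"
proof -
  have "combination (\<lambda>a b. F (a + n) (b + n)) PP_list = 0"
  proof (induction n)
    case 0
    then show ?case using P_P by (simp add: PP_list_def combination_def mult.assoc)
  next
    case (Suc n)
    let ?L = "map (\<lambda>(w, a, b). (w, a + n, b + n)) PP_list"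
    have "combination F ?L = 0" "central_weights ?L"
      using Suc central_lists(1) by (simp_all add: PP_list_def combination_def central_weights_def)
    then have "combination (\<lambda>a b. F (Suc a) (Suc b)) ?L = 0"
      using combination_shift_zero assms by blast
    then show ?case by (simp add: PP_list_def combination_def)
  qed
  then show ?thesis by (simp add: PP_list_def combination_def mult.assoc)
qed

text \<open>In terms of the shifts,
  \<open>serre_comb (k+2) = D serre_comb (k+1) - q s t serre_comb k\<close>, and both operations
  preserve vanishing. The initial values are twice the Serre relation and its image under
  \<open>D\<close>.\<close>

lemma serre_comb_zero:
  assumes "\<And>m. C 1 m = 0"
  shows "serre_comb k = 0"
proof -
  have eq: "serre_comb k = combination F (serre_list k)" for k
    by (simp add: serre_comb_def serre_list_def combination_def mult.assoc)
  show ?thesis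
  proof (induction k rule: induct_nat_012)
    case 0
    show ?case using P_P by (simp add: serre_comb_def)
  next
    case 1
    have "combination F (D1_list PP_list) = 0"
      using P_P by (intro combination_D1_zero central_lists) (simp add: PP_list_def
          combination_def mult.assoc)
    also have "combination F (D1_list PP_list) = serre_comb 1"
      by (simp add: PP_list_def combination_def D1_list_def serre_comb_def mult.assoc
          numeral_2_eq_2 algebra_simps)
    finally show ?case by simp
  next
    case (ge2 k)
    have "combination F (D1_list (serre_list (Suc k))) = 0"
      using ge2(2) unfolding eq by (intro combination_D1_zero central_lists)
    moreover have "combination (\<lambda>a b. F (Suc a) (Suc b)) (serre_list k) = 0"
      using ge2(1) unfolding eq by (intro combination_shift_zero assms central_lists)
    moreover have "serre_comb (Suc (Suc k)) = combination F (D1_list (serre_list (Suc k)))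
        - Q * combination (\<lambda>a b. F (Suc a) (Suc b)) (serre_list k)"
      by (simp add: combination_def D1_list_def serre_comb_def serre_list_def cen algebra_simps)
    ultimately show ?case by simp
  qed
qed

text \<open>The loop relations up to degree \<open>s\<close>. \<open>C a m\<close> is demanded for
  all \<open>m\<close> at once: \<open>Suc a < s\<close> makes \<open>R 1\<close> commute with
  \<open>R a\<close> and \<open>R (a+1)\<close>, which is what \<open>C_Suc\<close> needs to raise
  \<open>m\<close>.\<close>

definition level_ok :: "nat \<Rightarrow> bool" where
  "level_ok s \<longleftrightarrow> (\<forall>n m. n + m < s \<longrightarrow> c n m = R (Suc (n + m))) \<and>
    (\<forall>a b. a + b \<le> s \<longrightarrow> R a * R b = R b * R a) \<and>
    (\<forall>a m. Suc a < s \<longrightarrow> C a m = 0 \<and> C' a m = 0)"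

end

lemma (in loop_ring) loop_ring_opp:
  "loop_ring (opp Q) (opp Z) (\<lambda>n. opp (I n)) (\<lambda>n. opp (P n)) (\<lambda>n. opp (R n))"
proof
  have one: "1 = opp 1" by (simp add: one_opp_def)
  have QQ: "Q * (Q * x) = x * Q * Q" for x
    by (simp only: Q_central[of x] Q_central[of "x * Q"])
  have opp: "\<exists>y. x = opp y" for x :: "'a opp" by (metis unopp_inverse)
  show "opp Q * x = x * opp Q" "opp Z * x = x * opp Z" for x
  proof -
    obtain y where x: "x = opp y" using opp by blast
    show "opp Q * x = x * opp Q" "opp Z * x = x * opp Z"
      unfolding x opp_mult Q_central[of y] Z_central[of y] by (rule refl)+
  qed
  show "opp Q * opp Z = 1 + opp Z"
    unfolding one opp_mult opp_add Z_central[of Q] QZ by (rule refl)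
  show "opp (R 0) = opp Z" "opp (R (Suc 0)) = opp (P 0) * opp (I 0) - opp (I 0) * opp (P 0)"
    using R_0 R_1 by (simp_all add: opp_simps)
  show "x = 0" if "opp Q * x = 0" for x
  proof -
    obtain y where x: "x = opp y" using opp by blast
    have "Q * y = 0"
      using that unfolding x opp_mult opp_eq_0_iff Q_central[of y] .
    then show ?thesis using Q_cancel by (simp add: x opp_simps)
  qed
  show "x = 0" if "(1 + opp Q) * x = 0" for x
  proof -
    obtain y where x: "x = opp y" using opp by blast
    have "(1 + Q) * y = 0"
      using that Q_central[of y] by (simp add: x one opp_simps distrib_left distrib_right)
    then show ?thesis using Q1_cancel by (simp add: x opp_simps)
  qed
  show "x = 0" if "(1 + opp Q * opp Q) * x = 0" for x
  proof -
    obtain y where x: "x = opp y" using opp by blast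
    have "(1 + Q * Q) * y = 0"
      using that Qpow_central[of 2 y]
          by (simp add: x one opp_simps distrib_left distrib_right power2_eq_square)
    then show ?thesis using QQ1_cancel by (simp add: x opp_simps)
  qed
  show "x = 0" if "(opp Q ^ a + (\<Sum>k\<le>a. opp Q ^ (2 * k))) * x = 0" for a x
  proof -
    obtain y where x: "x = opp y" using opp by blast
    have s: "(\<Sum>k\<le>a. opp (Q ^ (2 * k))) = opp (\<Sum>k\<le>a. Q ^ (2 * k))"
      by (induction a) (simp_all add: opp_simps)
    have "y * (Q ^ a + (\<Sum>k\<le>a. Q ^ (2 * k))) = (Q ^ a + (\<Sum>k\<le>a. Q ^ (2 * k))) * y"
      by (simp add: distrib_left distrib_right sum_distrib_left sum_distrib_right Qpow_central[of
          _ y])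
    then have "(Q ^ a + (\<Sum>k\<le>a. Q ^ (2 * k))) * y = 0"
      using that by (simp add: x opp_simps s)
    then show ?thesis using Q_sum_cancel by (simp add: x opp_simps)
  qed
  show "opp (R (Suc 0)) * opp (I m) = opp Q * (opp (I m) * opp (R (Suc 0))) + (1
      + opp Q) * opp (I (Suc m))" for m
    unfolding one opp_mult opp_add opp_eq_iff I_R
    by (simp only: distrib_left distrib_right mult_1_left mult_1_right Q_central[of
        "R (Suc 0) * I m"] Q_central[of "I (Suc m)"])
  show "opp (P n) * opp (R (Suc 0)) = opp Q * (opp (R (Suc 0)) * opp (P n)) + (1
      + opp Q) * opp (P (Suc n))" for n
    unfolding one opp_mult opp_add opp_eq_iff R_P
    by (simp only: distrib_left distrib_right mult_1_left mult_1_right Q_central[of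
        "P n * R (Suc 0)"] Q_central[of "P (Suc n)"])
  show "opp (I (Suc 0)) * opp (I 0) = opp Q * (opp Q * (opp (I 0) * opp (I (Suc 0))))"
    unfolding opp_mult opp_eq_iff I_I by (rule QQ)
  show "opp (P 0) * opp (P (Suc 0)) = opp Q * (opp Q * (opp (P (Suc 0)) * opp (P 0)))"
    unfolding opp_mult opp_eq_iff P_P by (rule QQ)
qed

context loop_ring
begin

lemma opp_c: "loop_ring.c (opp Q) (\<lambda>n. opp (I n)) (\<lambda>n. opp (P n)) n m = opp (c m n)"
  unfolding loop_ring.c_def[OF loop_ring_opp] c_def opp_mult opp_power opp_diff
    Qpow_central[of _ "P n * I m"] add.commute[of n m] by (rule refl)

lemma opp_C: "loop_ring.C (opp Q) (\<lambda>n. opp (I n)) (\<lambda>n. opp (R n)) a m = opp (C' a m)"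
proof -
  have QQ: "Q * (Q * x) = x * Q * Q" for x
    by (simp only: Q_central[of x] Q_central[of "x * Q"])
  show ?thesis
    unfolding loop_ring.C_def[OF loop_ring_opp] C'_def opp_mult opp_power opp_diff opp_add QQ
      Qpow_central[of _ "R (Suc a) * I m"] Qpow_central[of _ "R a * I (Suc m)"] by (rule refl)
qed

text \<open>The commutators \<open>d a\<close> of \<open>R a\<close> and \<open>R (t + 2 - a)\<close> satisfy \<open>d (a + 2) + d a = (q + 1 / q) d (a + 1)\<close> with
  \<open>d 0 = 0\<close>, so \<open>d a\<close> is the symmetric \<open>q\<close>-integer \<open>[a]\<close> times \<open>d 1\<close>. Antisymmetry gives
  \<open>([t + 1] + 1) d 1 = 0\<close>.\<close>

lemma level_step:
  assumes ok: "level_ok (Suc t)" and C0: "C t 0 = 0" "C' t 0 = 0"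
    and c0: "c 0 (Suc t) = R (Suc (Suc t))"
  shows "level_ok (Suc (Suc t))"
proof -
  define d where "d a = R a * R (Suc (Suc t) - a) - R (Suc (Suc t) - a) * R a" for a
  have cR: "c n m = R (Suc (n + m))" if "n + m < Suc t" for n m
    using ok that by (simp add: level_ok_def)
  have CC: "C a m = 0" "C' a m = 0" if "a < t" for a m
    using ok that by (simp_all add: level_ok_def)
  have rec: "Q * d (a + 2) + Q * d a = d (Suc a) + Q * (Q * d (Suc a))" if "a + 2 \<le> Suc t" for a
  proof -
    have "Suc a \<le> t" using that by simp
    then obtain m where t: "t = Suc (a + m)"
      using le_Suc_ex[of "Suc a" t] by auto
    \<comment> \<open>\<open>m = 0\<close> means \<open>a + 1 = t\<close>, the one case outside the
      induction hypothesis; \<open>C0\<close> supplies it.\<close>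
    have C1: "C (Suc a) m = 0" "C' (Suc a) 0 = 0"
      using C0 CC[of "Suc a"] by (cases m; simp add: t)+
    have C2: "C a m = 0" "C' a 0 = 0" using CC[of a] by (simp_all add: t)
    \<comment> \<open>For \<open>a = 0\<close> the value of \<open>c 1 (m+1)\<close> lies beyond the
      known degrees, but \<open>R 0\<close> is central.\<close>
    have z: "c (Suc 0) (Suc m) * R a - R a * c (Suc 0) (Suc m) = - d a"
    proof (cases a)
      case 0
      then show ?thesis using Z_central R_0 by (simp add: d_def)
    next
      case (Suc b)
      then show ?thesis using cR[of "Suc 0" "Suc m"] by (simp add: d_def t eval_nat_numeral)
    qed
    have "c 0 m = R (Suc m)" "c (Suc 0) m = R (Suc (Suc m))" "c 0 (Suc m) = R (Suc (Suc m))"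
      using cR[of 0 m] cR[of "Suc 0" m] cR[of 0 "Suc m"] by (simp_all add: t)
    then have "Q * d (a + 2) - R (Suc a) * R (Suc (Suc m)) + Q * (Q * (R (Suc (Suc m)) * R (Suc a)))
       + R (Suc (Suc m)) * R (Suc a) - Q * (Q * (R (Suc a) * R (Suc (Suc m)))) - Q * (- d a) = 0"
      using comm_recursion[OF C1(1) C2(1) C1(2) C2(2)] unfolding z by (simp add: d_def t)
    then show ?thesis
      by (simp add: d_def t algebra_simps)
  qed
  have d0: "d 0 = 0" using Z_central R_0 by (simp add: d_def)
  have geom: "Q ^ a * d (Suc a) = (\<Sum>k\<le>a. Q ^ (2 * k)) * d (Suc 0)" if "a \<le> t" for a
    using that
  proof (induction a rule: induct_nat_012)
    case 1
    then show ?case using rec[of 0] d0 by (simp add: numeral_2_eq_2 algebra_simps)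
  next
    case (ge2 a)
    let ?S = "\<lambda>a. (\<Sum>k\<le>a. Q ^ (2 * k)) * d (Suc 0)"
    have r: "Q * d (Suc (Suc (Suc a))) = d (Suc (Suc a)) + Q * (Q * d (Suc (Suc a)))
        - Q * d (Suc a)"
      using rec[of "Suc a"] ge2.prems by (simp add: algebra_simps)
    have "Q ^ Suc (Suc a) * d (Suc (Suc (Suc a))) = Q ^ Suc a * (Q * d (Suc (Suc (Suc a))))"
      by (simp add: power_Suc2 mult.assoc del: power_Suc)
    also have "\<dots> = Q ^ Suc a * d (Suc (Suc a)) + Q * (Q * (Q ^ Suc a * d (Suc (Suc a))))
        - Q * (Q * (Q ^ a * d (Suc a)))"
      unfolding r by (simp add: algebra_simps Q_left[of "Q ^ a"])
    also have "\<dots> = ?S (Suc a) + Q * (Q * ?S (Suc a)) - Q * (Q * ?S a)"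
      using ge2 by simp
    also have "\<dots> = ?S (Suc a) + Q * (Q * (Q ^ (2 * Suc a) * d (Suc 0)))"
      by (simp add: algebra_simps)
    also have "\<dots> = ?S (Suc (Suc a))"
      by (simp add: algebra_simps)
    finally show ?case .
  qed simp
  have "d (Suc t) = - d (Suc 0)" by (simp add: d_def)
  then have "(Q ^ t + (\<Sum>k\<le>t. Q ^ (2 * k))) * d (Suc 0) = 0"
    unfolding distrib_right geom[of t, symmetric, OF order_refl] by simp
  then have d1: "d (Suc 0) = 0" by (rule Q_sum_cancel)
  have d: "d a = 0" if a: "a \<le> Suc (Suc t)" for a
  proof -
    consider "a = 0" | b where "a = Suc b" "b \<le> t" | "a = Suc (Suc t)" using a
        by (cases a) (auto simp: le_Suc_eq)
    then show ?thesis
    proof cases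
      case 2
      then show ?thesis using geom[of b] d1 Qpow_cancel by simp
    next
      case 3
      then show ?thesis using d0 by (simp add: d_def)
    qed (simp add: d0)
  qed
  have comm: "R a * R b = R b * R a" if "a + b \<le> Suc (Suc t)" for a b
  proof (cases "a + b = Suc (Suc t)")
    case True
    then have "b = Suc (Suc t) - a" by simp
    then show ?thesis using d[of a] True by (simp add: d_def)
  next
    case False
    then show ?thesis using ok that by (simp add: level_ok_def)
  qed
  have cS: "c n m = R (Suc (Suc t))" if "n + m = Suc t" for n m
    using that
  proof (induction n arbitrary: m)
    case 0
    then show ?case using c0 by simp
  next
    case (Suc n)
    have "(1 + Q) * (c (Suc n) m - c n (Suc m)) = 0"
      using cR[of n m] comm[of "Suc (n + m)" "Suc 0"] Suc.prems by (simp add: c_shift)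
    then have "c (Suc n) m = c n (Suc m)" using Q1_cancel by fastforce
    then show ?case using Suc.IH[of "Suc m"] Suc.prems by simp
  qed
  have Ct: "C t m = 0" for m
    by (induction m) (use C0 C_Suc comm in auto)
  have Ct': "C' t m = 0" for m
  proof (induction m)
    case (Suc m)
    have "loop_ring.C (opp Q) (\<lambda>n. opp (I n)) (\<lambda>n. opp (R n)) t (Suc m) = 0"
      using Suc comm[of "Suc 0"] comm[of _ "Suc 0"]
      by (intro loop_ring.C_Suc[OF loop_ring_opp]) (simp_all add: opp_C opp_simps)
    then show ?case by (simp add: opp_C opp_simps)
  qed (rule C0)
  show ?thesis
    unfolding level_ok_def
  proof (intro conjI allI impI)
    show "c n m = R (Suc (n + m))" if "n + m < Suc (Suc t)" for n m
      using that cR[of n m] cS[of n m] by (cases "n + m = Suc t") auto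
    show "C a m = 0" "C' a m = 0" if "Suc a < Suc (Suc t)" for a m
      using that CC Ct Ct' by (cases "a = t"; simp)+
  qed (rule comm)
qed

text \<open>Degrees up to 3 are special: \<open>serre_comb_zero\<close> requires
  \<open>C 1 m = 0\<close> for all \<open>m\<close>, which is part of degree 3 and rests on
  \<open>C_1_0\<close>, whose dual needs \<open>c 1 0 = R 2\<close> from degree 2. From there on one
  step serves every degree.\<close>

lemma level_ok_all:
  assumes c0: "\<And>m. c 0 m = R (Suc m)"
  shows "level_ok s"
proof -
  have C0: "C 0 m = 0" "C' 0 m = 0" for m
    using C_0 loop_ring.C_0[OF loop_ring_opp, of m] by (simp_all add: opp_C opp_simps)
  have 1: "level_ok (Suc 0)"
  proof -
    have "R a * R b = R b * R a" if "a + b \<le> Suc 0" for a b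
    proof -
      from that have "a = 0 \<or> b = 0" by auto
      then show ?thesis using Z_central[of "R a"] Z_central[of "R b"] by (auto simp: R_0)
    qed
    then show ?thesis using c0[of 0] by (auto simp: level_ok_def)
  qed
  have 2: "level_ok (Suc (Suc 0))"
    using level_step[OF 1 C0 c0] .
  have C10: "C 1 0 = 0"
    using C_1_0 c0[of 1] by (simp add: numeral_2_eq_2)
  have C10': "C' 1 0 = 0"
  proof -
    have "c (Suc 0) 0 = R 2" using 2 by (auto simp: level_ok_def numeral_2_eq_2)
    then have "loop_ring.C (opp Q) (\<lambda>n. opp (I n)) (\<lambda>n. opp (R n)) 1 0 = 0"
      by (intro loop_ring.C_1_0[OF loop_ring_opp]) (simp add: opp_c opp_simps)
    then show ?thesis by (simp add: opp_C opp_simps)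
  qed
  have 3: "level_ok (Suc (Suc (Suc 0)))"
    using level_step[OF 2 _ _ c0] C10 C10' by simp
  then have C1: "C 1 m = 0" "C' 1 m = 0" for m
    by (auto simp: level_ok_def)
  then have C1op: "loop_ring.C (opp Q) (\<lambda>n. opp (I n)) (\<lambda>n. opp (R n)) 1 m = 0" for m
    by (simp add: opp_C opp_simps)
  have step: "level_ok (Suc (Suc (Suc k)))" for k
  proof (induction k)
    case 0
    show ?case by (rule 3)
  next
    case (Suc k)
    have c: "c n m = R (Suc (n + m))" if "n + m < Suc (Suc (Suc k))" for n m
      using Suc that by (auto simp: level_ok_def)
    have "C (Suc (Suc k)) 0 = 0"
      using c by (intro C_from_serre_comb serre_comb_zero C1) simp
    moreover have "loop_ring.C (opp Q) (\<lambda>n. opp (I n)) (\<lambda>n. opp (R n)) (Suc (Suc k)) 0 = 0"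
      using c by (intro loop_ring.C_from_serre_comb[OF loop_ring_opp] loop_ring.serre_comb_zero[OF
          loop_ring_opp] C1op)
        (simp add: opp_c opp_simps)
    ultimately show ?case
      by (intro level_step Suc c0) (simp_all add: opp_C opp_simps)
  qed
  consider "s = 0" | "s = 1" | "s = 2" | k where "s = Suc (Suc (Suc k))"
    by (metis One_nat_def Suc_1 not0_implies_Suc)
  then show ?thesis
    using 1 2 step by cases (auto simp: numeral_2_eq_2 level_ok_def)
qed

lemma loop_relations:
  assumes "\<And>m. c 0 m = R (Suc m)"
  shows "R a * R b = R b * R a"
    and "P (Suc n) * P n = Q * (Q * (P n * P (Suc n)))"
    and "I n * I (Suc n) = Q * (Q * (I (Suc n) * I n))"
proof -
  show "R a * R b = R b * R a"
    using level_ok_all[OF assms, of "a + b"] by (simp add: level_ok_def)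
  have C1: "C 1 m = 0" "C' 1 m = 0" for m
    using level_ok_all[OF assms, of "Suc (Suc (Suc 0))"] by (auto simp: level_ok_def)
  then show "P (Suc n) * P n = Q * (Q * (P n * P (Suc n)))"
    by (intro P_Suc_P)
  have "opp (I (Suc n)) * opp (I n) = opp Q * (opp Q * (opp (I n) * opp (I (Suc n))))"
    using C1 by (intro loop_ring.P_Suc_P[OF loop_ring_opp]) (simp add: opp_C opp_simps)
  then have "I n * I (Suc n) = I (Suc n) * I n * Q * Q"
    by (simp only: opp_simps)
  also have "\<dots> = Q * (Q * (I (Suc n) * I n))"
    by (simp only: Q_central[of "I (Suc n) * I n"] Q_central[of "I (Suc n) * I n * Q"])
  finally show "I n * I (Suc n) = Q * (Q * (I (Suc n) * I n))" .
qed

end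

section \<open>The loop generators of the Kronecker algebra\<close>

interpretation frac: vector_space frac_scale
  by (rule vector_space_frac_scale)

abbreviation frac_const :: "rat poly fract \<Rightarrow> comp_alg_frac" where
  "frac_const k \<equiv> frac_scale k 1"

lemma frac_const_mult: "frac_const k * x = frac_scale k x"
  by (simp add: frac_scale_mult_left)

lemma frac_const_mult_right: "x * frac_const k = frac_scale k x"
  by (simp add: frac_scale_mult_right)

lemma frac_const_power: "frac_const k ^ n = frac_const (k ^ n)"
  by (induction n) (simp_all add: frac_const_mult)

lemma frac_const_cancel: "k \<noteq> 0 \<Longrightarrow> frac_const k * x = 0 \<Longrightarrow> x = 0"
  by (simp add: frac_const_mult frac.scale_eq_0_iff)

abbreviation (input) "fi \<equiv> frac_gen VI"
abbreviation (input) "fj \<equiv> frac_gen VJ"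
abbreviation (input) "fq \<equiv> frac_const q_indet"

definition frac_R1 :: comp_alg_frac where "frac_R1 = fi * fj - fj * fi"

primrec frac_P :: "nat \<Rightarrow> comp_alg_frac" where
  "frac_P 0 = fj"
| "frac_P (Suc m) = frac_scale (1 / (1 + q_indet)) (frac_R1 * frac_P m - fq * (frac_P m * frac_R1))"

primrec frac_I :: "nat \<Rightarrow> comp_alg_frac" where
  "frac_I 0 = fi"
| "frac_I (Suc n) = frac_scale (1 / (1 + q_indet)) (frac_I n * frac_R1 - fq * (frac_R1 * frac_I n))"

definition frac_R :: "nat \<Rightarrow> comp_alg_frac" where
  "frac_R s = (case s of 0 \<Rightarrow> frac_const (1 / (q_indet - 1))
    | Suc m \<Rightarrow> fi * frac_P m - fq ^ m * (frac_P m * fi))"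

lemma to_fract_sum: "to_fract (sum f A) = (\<Sum>x\<in>A. to_fract (f x))"
  by (induction A rule: infinite_finite_induct) simp_all

lemma to_fract_power: "to_fract (x ^ n) = to_fract x ^ n"
  by (induction n) simp_all

lemma to_fract_nonzero: "poly p 1 \<noteq> (0::rat) \<Longrightarrow> to_fract p \<noteq> 0"
  by auto

text \<open>The scalars to be cancelled in \<open>loop_ring\<close>, and the denominator of
  \<open>Z\<close>. All but \<open>q - 1\<close> are polynomials with a positive value at 1;
  \<open>q - 1\<close> is nonzero at 0.\<close>

lemma q_nonzero:
  "q_indet \<noteq> 0" "1 + q_indet \<noteq> 0" "1 + q_indet * q_indet \<noteq> 0" "q_indet - 1 \<noteq> 0"
  "q_indet ^ a + (\<Sum>k\<le>a. q_indet ^ (2 * k)) \<noteq> 0"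
proof -
  let ?q = "[:0, 1:] :: rat poly"
  have "q_indet = to_fract ?q" "1 + q_indet = to_fract (1 + ?q)" "1 + q_indet * q_indet =
      to_fract (1 + ?q * ?q)"
      "q_indet ^ a + (\<Sum>k\<le>a. q_indet ^ (2 * k)) = to_fract (?q ^ a + (\<Sum>k\<le>a. ?q ^ (2 * k)))"
    by (simp_all only: q_indet_def to_fract_add to_fract_mult to_fract_1 to_fract_sum
        to_fract_power)
  moreover have "poly ?q 1 \<noteq> 0" "poly (1 + ?q) 1 \<noteq> 0" "poly (1 + ?q * ?q) 1 \<noteq> 0"
      "poly (?q ^ a + (\<Sum>k\<le>a. ?q ^ (2 * k))) 1 \<noteq> 0"
    by (simp_all add: poly_sum)
  ultimately show "q_indet \<noteq> 0" "1 + q_indet \<noteq> 0" "1 + q_indet * q_indet \<noteq> 0"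
    "q_indet ^ a + (\<Sum>k\<le>a. q_indet ^ (2 * k)) \<noteq> 0"
    by (metis to_fract_nonzero)+
  have "q_indet - 1 = to_fract (?q - 1)" by (simp add: q_indet_def)
  moreover have "poly (?q - 1) 0 \<noteq> 0" by simp
  ultimately show "q_indet - 1 \<noteq> 0" by (metis poly_0 to_fract_eq_0_iff)
qed

lemma frac_serre:
  "fi ^ 3 * fj - frac_scale (q_indet ^ 2 + q_indet + 1) (fi ^ 2 * fj * fi)
     + frac_scale (q_indet * (q_indet ^ 2 + q_indet + 1)) (fi * fj * fi ^ 2) - frac_scale (q_indet
         ^ 3) (fj * fi ^ 3) = 0"
  "fi * fj ^ 3 - frac_scale (q_indet ^ 2 + q_indet + 1) (fj * fi * fj ^ 2)
     + frac_scale (q_indet * (q_indet ^ 2 + q_indet + 1)) (fj ^ 2 * fi * fj) - frac_scale (q_indet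
         ^ 3) (fj ^ 3 * fi) = 0"
proof -
  have pow: "abs_comp_alg_frac p ^ n = abs_comp_alg_frac (p ^ n)" for p n
    by (induction n) (simp_all add: one_comp_alg_frac.abs_eq times_comp_alg_frac.abs_eq)
  have "abs_comp_alg_frac p = 0" if "p \<in> serre_relations" for p
    using ideal_gen.gen[OF that] by (simp add: zero_comp_alg_frac.abs_eq comp_alg_frac.abs_eq_iff)
  note z = this[unfolded serre_relations_def Let_def]
  show "fi ^ 3 * fj - frac_scale (q_indet ^ 2 + q_indet + 1) (fi ^ 2 * fj * fi)
     + frac_scale (q_indet * (q_indet ^ 2 + q_indet + 1)) (fi * fj * fi ^ 2) - frac_scale (q_indet
         ^ 3) (fj * fi ^ 3) = 0"
    unfolding frac_gen.abs_eq pow times_comp_alg_frac.abs_eq frac_scale_abs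
      plus_comp_alg_frac.abs_eq minus_comp_alg_frac.abs_eq
    by (rule z) (rule insertI1)
  show "fi * fj ^ 3 - frac_scale (q_indet ^ 2 + q_indet + 1) (fj * fi * fj ^ 2)
     + frac_scale (q_indet * (q_indet ^ 2 + q_indet + 1)) (fj ^ 2 * fi * fj) - frac_scale (q_indet
         ^ 3) (fj ^ 3 * fi) = 0"
    unfolding frac_gen.abs_eq pow times_comp_alg_frac.abs_eq frac_scale_abs
      plus_comp_alg_frac.abs_eq minus_comp_alg_frac.abs_eq
    by (rule z) (rule insertI2, rule insertI1)
qed

lemmas frac_simps = frac_const_mult frac_const_mult_right frac_scale_mult_left
    frac_scale_mult_right
  frac.scale_right_diff_distrib frac.scale_right_distrib frac.scale_left_distrib frac.scale_scale

interpretation frac_loop: loop_ring fq "frac_const (1 / (q_indet - 1))" frac_P frac_I frac_R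
proof
  note nz = q_nonzero
  fix x :: comp_alg_frac and m a :: nat
  have add: "1 + fq = frac_const (1 + q_indet)"
    "1 + fq * fq = frac_const (1 + q_indet * q_indet)"
    "fq ^ a + (\<Sum>k\<le>a. fq ^ (2 * k)) = frac_const (q_indet ^ a + (\<Sum>k\<le>a. q_indet ^ (2 * k)))"
    by (simp_all add: frac.scale_left_distrib frac_const_mult frac_const_power frac.scale_sum_left)
  show "fq * x = x * fq" "frac_const (1 / (q_indet - 1)) * x = x * frac_const (1 / (q_indet - 1))"
    by (simp_all add: frac_const_mult frac_const_mult_right)
  have "q_indet * (1 / (q_indet - 1)) = 1 + 1 / (q_indet - 1)"
    using nz(4) by (simp add: field_simps)
  then show "fq * frac_const (1 / (q_indet - 1)) = 1 + frac_const (1 / (q_indet - 1))"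
    unfolding frac_const_mult frac.scale_scale
        by (simp only: frac.scale_left_distrib frac.scale_one)
  show R1: "frac_R (Suc 0) = frac_I 0 * frac_P 0 - frac_P 0 * frac_I 0"
    by (simp add: frac_R_def)
  then have R1': "frac_R (Suc 0) = frac_R1" by (simp add: frac_R1_def)
  have half: "(1 + fq) * frac_scale (1 / (1 + q_indet)) y = y" for y
    using nz(2) by (simp add: add frac_const_mult)
  show "frac_R (Suc 0) * frac_P m = fq * (frac_P m * frac_R (Suc 0)) + (1 + fq) * frac_P (Suc m)"
    "frac_I m * frac_R (Suc 0) = fq * (frac_R (Suc 0) * frac_I m) + (1 + fq) * frac_I (Suc m)"
    by (simp_all add: R1' half)
  show "fq * x = 0 \<Longrightarrow> x = 0" "(1 + fq) * x = 0 \<Longrightarrow> x = 0" "(1 + fq * fq) * x = 0 \<Longrightarrow> x = 0"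
    "(fq ^ a + (\<Sum>k\<le>a. fq ^ (2 * k))) * x = 0 \<Longrightarrow> x = 0"
    unfolding add using frac_const_cancel nz by blast+
  have "(1 + fq) * (frac_P (Suc 0) * frac_P 0 - fq * (fq * (frac_P 0 * frac_P (Suc 0))))
    = (1 + fq) * frac_P (Suc 0) * fj - fq * (fq * (fj * ((1 + fq) * frac_P (Suc 0))))"
    by (simp add: frac_simps algebra_simps)
  also have "(1 + fq) * frac_P (Suc 0) = frac_R1 * fj - fq * (fj * frac_R1)"
    by (simp add: half)
  also have "(frac_R1 * fj - fq * (fj * frac_R1)) * fj - fq * (fq * (fj * (frac_R1 * fj
      - fq * (fj * frac_R1)))) = 0"
    using frac_serre(2)
    by (simp add: frac_R1_def frac_simps algebra_simps power2_eq_square numeral_3_eq_3)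
  finally show "frac_P (Suc 0) * frac_P 0 = fq * (fq * (frac_P 0 * frac_P (Suc 0)))"
    unfolding add using frac_const_cancel nz(2) by (metis eq_iff_diff_eq_0)
  have "(1 + fq) * (frac_I 0 * frac_I (Suc 0) - fq * (fq * (frac_I (Suc 0) * frac_I 0)))
    = fi * ((1 + fq) * frac_I (Suc 0)) - fq * (fq * ((1 + fq) * frac_I (Suc 0) * fi))"
    by (simp add: frac_simps algebra_simps)
  also have "(1 + fq) * frac_I (Suc 0) = fi * frac_R1 - fq * (frac_R1 * fi)"
    by (simp add: half)
  also have "fi * (fi * frac_R1 - fq * (frac_R1 * fi)) - fq * (fq * ((fi * frac_R1
      - fq * (frac_R1 * fi)) * fi)) = 0"
    using frac_serre(1)
    by (simp add: frac_R1_def frac_simps algebra_simps power2_eq_square numeral_3_eq_3)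
  finally show "frac_I 0 * frac_I (Suc 0) = fq * (fq * (frac_I (Suc 0) * frac_I 0))"
    unfolding add using frac_const_cancel nz(2) by (metis eq_iff_diff_eq_0)
qed (simp add: frac_R_def)

lemma frac_relations:
  "frac_R a * frac_R b = frac_R b * frac_R a"
  "frac_P (Suc n) * frac_P n = fq * (fq * (frac_P n * frac_P (Suc n)))"
  "frac_I n * frac_I (Suc n) = fq * (fq * (frac_I (Suc n) * frac_I n))"
proof -
  have "frac_loop.c 0 m = frac_R (Suc m)" for m
    by (simp add: frac_loop.c_def frac_R_def)
  note rel = frac_loop.loop_relations[OF this]
  show "frac_R a * frac_R b = frac_R b * frac_R a"
  "frac_P (Suc n) * frac_P n = fq * (fq * (frac_P n * frac_P (Suc n)))"
  "frac_I n * frac_I (Suc n) = fq * (fq * (frac_I (Suc n) * frac_I n))"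
    by (fact rel)+
qed

section \<open>Reduction modulo the parameter\<close>

lemma abs_comp_alg_0_simps:
  "abs_comp_alg_0 x + abs_comp_alg_0 y = abs_comp_alg_0 (x + y)"
  "abs_comp_alg_0 x - abs_comp_alg_0 y = abs_comp_alg_0 (x - y)"
  "abs_comp_alg_0 x * abs_comp_alg_0 y = abs_comp_alg_0 (x * y)"
  by (simp_all add: plus_comp_alg_0.abs_eq minus_comp_alg_0.abs_eq times_comp_alg_0.abs_eq)

interpretation q: module q_scale
  by (rule module_q_scale)

lemma abs_q_multiple: "abs_comp_alg_0 (q_scale [:0, 1:] z) = 0"
  by (simp add: zero_comp_alg_0.abs_eq comp_alg_0.abs_eq_iff q_multiples_def)

lemma abs_q_scale: "abs_comp_alg_0 (q_scale g z) = scale0 (poly g 0) (abs_comp_alg_0 z)"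
proof (cases g)
  case (pCons a h)
  have "q_scale g z = q_scale [:a:] z + q_scale [:0, 1:] (q_scale h z)"
    by (simp add: pCons flip: q.scale_left_distrib)
  then have "abs_comp_alg_0 (q_scale g z) = abs_comp_alg_0 (q_scale [:a:] z) + 0"
    by (simp only: abs_q_multiple flip: abs_comp_alg_0_simps)
  then show ?thesis by (simp add: pCons scale0.abs_eq)
qed

text \<open>\<open>x\<close> lies in the localisation of \<open>C\<^sub>q(K)\<close> at \<open>q = 0\<close> and has residue class \<open>y\<close>.\<close>

definition reduces :: "comp_alg_frac \<Rightarrow> comp_alg_0 \<Rightarrow> bool" where
  "reduces x y \<longleftrightarrow> (\<exists>f z. poly f 0 = 1 \<and> frac_scale (to_fract f) x = Rep_comp_alg_q z \<and> y =
      abs_comp_alg_0 z)"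

text \<open>Cross-multiplying by the denominators compares both classes inside
  \<open>C\<^sub>q(K)\<close>, and a denominator with value 1 at 0 acts as the identity on
  \<open>C\<^sub>0(K)\<close>.\<close>

lemma reduces_unique:
  assumes "reduces x y" "reduces x y'"
  shows "y = y'"
proof -
  obtain f z g z' where f: "poly f 0 = 1" "frac_scale (to_fract f) x = Rep_comp_alg_q z"
      "y = abs_comp_alg_0 z"
    and g: "poly g 0 = 1" "frac_scale (to_fract g) x = Rep_comp_alg_q z'" "y' = abs_comp_alg_0 z'"
    using assms unfolding reduces_def by blast
  have "Rep_comp_alg_q (q_scale g z) = Rep_comp_alg_q (q_scale f z')"
    by (simp add: q_scale.rep_eq mult.commute flip: f g)
  then have "q_scale g z = q_scale f z'" by (simp add: Rep_comp_alg_q_inject)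
  then have "scale0 (poly g 0) y = scale0 (poly f 0) y'" using f g by (metis abs_q_scale)
  then show ?thesis using f g by simp
qed

lemma reduces_add:
  assumes "reduces x y" "reduces x' y'"
  shows "reduces (x + x') (y + y')" "reduces (x - x') (y - y')"
proof -
  obtain f z g z' where f: "poly f 0 = 1" "frac_scale (to_fract f) x = Rep_comp_alg_q z"
      "y = abs_comp_alg_0 z"
    and g: "poly g 0 = 1" "frac_scale (to_fract g) x' = Rep_comp_alg_q z'" "y' = abs_comp_alg_0 z'"
    using assms unfolding reduces_def by blast
  have x: "frac_scale (to_fract (f * g)) x = Rep_comp_alg_q (q_scale g z)"
    "frac_scale (to_fract (f * g)) x' = Rep_comp_alg_q (q_scale f z')"
    by (simp_all add: q_scale.rep_eq mult.commute flip: f g)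
  have y: "y = abs_comp_alg_0 (q_scale g z)" "y' = abs_comp_alg_0 (q_scale f z')"
    using f g by (simp_all add: abs_q_scale)
  show "reduces (x + x') (y + y')" "reduces (x - x') (y - y')"
    unfolding reduces_def using f(1) g(1)
    by (intro exI[of _ "f * g"] exI[of _ "q_scale g z + q_scale f z'"] exI[of _ "q_scale g z
        - q_scale f z'"];
        simp only: frac.scale_right_distrib frac.scale_right_diff_distrib x y abs_comp_alg_0_simps
         plus_comp_alg_q.rep_eq minus_comp_alg_q.rep_eq poly_mult; simp)+
qed

lemma reduces_mult:
  assumes "reduces x y" "reduces x' y'"
  shows "reduces (x * x') (y * y')"
proof -
  obtain f z g z' where f: "poly f 0 = 1" "frac_scale (to_fract f) x = Rep_comp_alg_q z"
      "y = abs_comp_alg_0 z"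
    and g: "poly g 0 = 1" "frac_scale (to_fract g) x' = Rep_comp_alg_q z'" "y' = abs_comp_alg_0 z'"
    using assms unfolding reduces_def by blast
  have "frac_scale (to_fract (f * g)) (x * x') =
      frac_scale (to_fract f) x * frac_scale (to_fract g) x'"
    by (simp add: frac_scale_mult_left frac_scale_mult_right)
  then have "frac_scale (to_fract (f * g)) (x * x') = Rep_comp_alg_q (z * z')"
    by (simp add: f g times_comp_alg_q.rep_eq)
  then show ?thesis
    unfolding reduces_def f(3) g(3) abs_comp_alg_0_simps using f(1) g(1) by (metis poly_mult mult_1)
qed

lemma reduces_Rep: "reduces (Rep_comp_alg_q z) (abs_comp_alg_0 z)"
  unfolding reduces_def by (rule exI[of _ 1]) auto

lemma reduces_gen: "reduces (frac_gen v) (gen0 v)"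
  using reduces_Rep[of "q_gen v"] by (simp add: q_gen.rep_eq gen0.abs_eq)

lemma reduces_scale:
  assumes "reduces x y"
  shows "reduces (frac_scale (to_fract g) x) (scale0 (poly g 0) y)"
proof -
  obtain f z where f: "poly f 0 = 1" "frac_scale (to_fract f) x = Rep_comp_alg_q z"
      "y = abs_comp_alg_0 z"
    using assms unfolding reduces_def by blast
  have "frac_scale (to_fract f) (frac_scale (to_fract g) x) = Rep_comp_alg_q (q_scale g z)"
    by (simp add: q_scale.rep_eq mult.commute flip: f)
  then show ?thesis unfolding reduces_def using f by (metis abs_q_scale)
qed

lemma reduces_divide:
  assumes "reduces x y" "poly g 0 = 1"
  shows "reduces (frac_scale (1 / to_fract g) x) y"
proof -
  obtain f z where f: "poly f 0 = 1" "frac_scale (to_fract f) x = Rep_comp_alg_q z"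
      "y = abs_comp_alg_0 z"
    using assms unfolding reduces_def by blast
  have "g \<noteq> 0" using assms by auto
  then have "frac_scale (to_fract (f * g)) (frac_scale (1 / to_fract g) x) = Rep_comp_alg_q z"
    using f by simp
  then show ?thesis unfolding reduces_def using f assms by (metis poly_mult mult_1)
qed

lemma reduces_fq: "reduces x y \<Longrightarrow> reduces (fq * x) 0"
  using reduces_scale[of x y "[:0, 1:]"] by (simp add: frac_const_mult q_indet_def)

interpretation comp0: two_gen "gen0 VI" "gen0 VJ" .

lemma comp0_eqs:
  "comp0.R = R1" "comp0.P = elt_P" "comp0.I = elt_I" "comp0.Rs = elt_R" "comp0.pbw = pbw_elt"
proof -
  show "comp0.R = R1" by (simp add: comp0.R_def R1_def)
  then show "comp0.P = elt_P" "comp0.I = elt_I" "comp0.Rs = elt_R"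
    by (auto simp: fun_eq_iff comp0.P_def elt_P_def comp0.I_def elt_I_def comp0.Rs_def elt_R_def)
  then show "comp0.pbw = pbw_elt"
    by (auto simp: comp0.pbw_def pbw_elt_def)
qed

lemma reduces_R1: "reduces frac_R1 R1"
  unfolding frac_R1_def R1_def by (intro reduces_add reduces_mult reduces_gen)

lemma reduces_half: "reduces x y \<Longrightarrow> reduces (frac_scale (1 / (1 + q_indet)) x) y"
proof -
  have "1 + q_indet = to_fract [:1, 1:]"
    by (simp add: q_indet_def one_pCons flip: to_fract_1 to_fract_add)
  then show "reduces x y \<Longrightarrow> reduces (frac_scale (1 / (1 + q_indet)) x) y"
    using reduces_divide[of x y "[:1, 1:]"] by simp
qed

lemma reduces_P: "reduces (frac_P m) (elt_P m)"
proof (induction m)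
  case (Suc m)
  have "reduces (frac_R1 * frac_P m - fq * (frac_P m * frac_R1)) (R1 * elt_P m - 0)"
    by (rule reduces_add(2)[OF reduces_mult[OF reduces_R1 Suc] reduces_fq[OF reduces_mult[OF Suc
        reduces_R1]]])
  then show ?case
    using reduces_half comp0.R_mult_P[of m] unfolding comp0_eqs by simp
qed (simp add: elt_P_def reduces_gen)

lemma reduces_I: "reduces (frac_I n) (elt_I n)"
proof (induction n)
  case (Suc n)
  have "reduces (frac_I n * frac_R1 - fq * (frac_R1 * frac_I n)) (elt_I n * R1 - 0)"
    by (rule reduces_add(2)[OF reduces_mult[OF Suc reduces_R1] reduces_fq[OF reduces_mult[OF
        reduces_R1 Suc]]])
  then show ?case
    using reduces_half comp0.I_mult_R[of n] unfolding comp0_eqs by simp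
qed (simp add: elt_I_def reduces_gen)

lemma reduces_R: "1 \<le> s \<Longrightarrow> reduces (frac_R s) (elt_R s)"
proof (cases s)
  case (Suc m)
  show ?thesis
  proof (cases m)
    case 0
    then show ?thesis using reduces_R1 Suc by (simp add: frac_R_def frac_R1_def elt_R_def)
  next
    case (Suc k)
    have fq: "reduces (fq ^ Suc k * x) 0" if "reduces x y" for x y
      using that reduces_fq by (induction k) (auto simp: mult.assoc)
    have "reduces (fi * frac_P m - fq ^ m * (frac_P m * fi)) (gen0 VI * elt_P m - 0)"
      unfolding Suc
      by (rule reduces_add(2)[OF reduces_mult[OF reduces_gen reduces_P] fq[OF reduces_mult[OF
          reduces_P reduces_gen]]])
    moreover have "gen0 VI * elt_P m = elt_R s"
      using Suc \<open>s = Suc m\<close> by (simp add: elt_P_def elt_R_def mult.assoc)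
    ultimately show ?thesis using \<open>s = Suc m\<close> by (simp add: frac_R_def)
  qed
qed simp

interpretation comp0: kron_rules "gen0 VI" "gen0 VJ"
proof (unfold_locales, unfold comp0_eqs)
  fix a b :: nat
  assume "1 \<le> a" "1 \<le> b"
  then show "elt_R a * elt_R b = elt_R b * elt_R a"
    using reduces_mult reduces_R reduces_unique by (metis frac_relations(1))
next
  fix n
  have "reduces (fq * (fq * (frac_P n * frac_P (Suc n)))) 0"
    by (rule reduces_fq[OF reduces_fq[OF reduces_mult[OF reduces_P reduces_P]]])
  then show "elt_P (Suc n) * elt_P n = 0"
    using reduces_mult[OF reduces_P reduces_P] reduces_unique by (metis frac_relations(2))
  have "reduces (fq * (fq * (frac_I (Suc n) * frac_I n))) 0"
    by (rule reduces_fq[OF reduces_fq[OF reduces_mult[OF reduces_I reduces_I]]])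
  then show "elt_I n * elt_I (Suc n) = 0"
    using reduces_mult[OF reduces_I reduces_I] reduces_unique by (metis frac_relations(3))
qed

section \<open>A representation on functions of integer strings\<close>

definition evens :: "int list \<Rightarrow> nat" where "evens w = length (filter even w)"

lemma evens_simps [simp]: "evens [] = 0"
    "evens (a # w) = (if even a then Suc (evens w) else evens w)"
  by (simp_all add: evens_def)

text \<open>The tensor product of copies of the two-dimensional loop representation, a string of integers standing
  for a basis tensor: the parity of a letter is its weight, incrementing a letter twice is
  multiplication by the loop parameter. The operators act on functions of strings, contravariantly.\<close>

fun opi :: "'r::comm_ring_1 \<Rightarrow> (int list \<Rightarrow> 'r) \<Rightarrow> int list \<Rightarrow> 'r" where
  "opi q f [] = 0"
| "opi q f (a # w) = (if odd a then f ((a + 1) # w) else 0)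
    + (if even a then q else 1) * opi q (\<lambda>u. f (a # u)) w"

fun opj :: "'r::comm_ring_1 \<Rightarrow> (int list \<Rightarrow> 'r) \<Rightarrow> int list \<Rightarrow> 'r" where
  "opj q f [] = 0"
| "opj q f (a # w) = (if even a then q ^ evens w * f ((a + 1) # w) else 0)
    + opj q (\<lambda>u. f (a # u)) w"

lemma op_linear:
  "opi q (\<lambda>u. f u + g u) w = opi q f w + opi q g w"
  "opj q (\<lambda>u. f u + g u) w = opj q f w + opj q g w"
  "opi q (\<lambda>u. f u - g u) w = opi q f w - opi q g w"
  "opj q (\<lambda>u. f u - g u) w = opj q f w - opj q g w"
  "opi q (\<lambda>u. c * f u) w = c * opi q f w"
  "opj q (\<lambda>u. c * f u) w = c * opj q f w"
  "opi q (\<lambda>u. 0) w = 0"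
  "opj q (\<lambda>u. 0) w = 0"
  by (induction w arbitrary: f g)
    (simp_all add: distrib_left right_diff_distrib mult.left_commute)

text \<open>\<open>i\<close> turns an odd letter into an even one and \<open>j\<close> does the
  reverse, so moving the twist across costs \<open>q\<close> here and \<open>1 / q\<close> in
  \<open>opj_evens\<close>.\<close>

lemma opi_evens: "opi q (\<lambda>u. q ^ evens u * f u) w = q * (q ^ evens w * opi q f w)"
  by (induction w arbitrary: f) (simp_all add: op_linear mult.assoc mult.left_commute algebra_simps)

lemma opj_evens:
  assumes "q * k = 1"
  shows "opj q (\<lambda>u. q ^ evens u * f u) w = k * (q ^ evens w * opj q f w)"
proof (induction w arbitrary: f)
  case (Cons a w)
  have "k * (q * x) = x" for x
    using assms by (metis mult.assoc mult.commute mult_1_left)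
  with Cons show ?case
    by (cases "even a") (simp_all add: op_linear mult.assoc distrib_left mult.left_commute[of _ q])
qed simp

text \<open>The Serre element behaves like a skew-primitive one: when a letter is prefixed, all
  mixed terms cancel and only a power of \<open>q\<close> remains, one factor for each
  \<open>i\<close> if the letter is even.\<close>

lemma serre_opi:
  assumes "q * k = 1"
  shows "opi q (opi q (opi q (opj q f))) w - (q ^ 2 + q + 1) * opi q (opi q (opj q (opi q f))) w
      + q * (q ^ 2 + q + 1) * opi q (opj q (opi q (opi q f))) w
    - q ^ 3 * opj q (opi q (opi q (opi q f))) w = 0"
    (is "?S f w = 0")
proof (induction w arbitrary: f)
  case (Cons a w)
  have kq: "k * q = 1" "k * (q * x) = x" for x
    using assms(1) by (simp_all add: mult.commute flip: mult.assoc)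
  have "?S f (a # w) = (if even a then q ^ 3 else 1) * ?S (\<lambda>u. f (a # u)) w"
    by (cases "even a")
      (simp_all add: op_linear opi_evens opj_evens[OF assms(1)],
       simp_all add: algebra_simps power2_eq_square power3_eq_cube kq)
  then show ?case using Cons by simp
qed simp

lemma serre_opj:
  assumes "q * k = 1"
  shows "opi q (opj q (opj q (opj q f))) w - (q ^ 2 + q + 1) * opj q (opi q (opj q (opj q f))) w
      + q * (q ^ 2 + q + 1) * opj q (opj q (opi q (opj q f))) w
    - q ^ 3 * opj q (opj q (opj q (opi q f))) w = 0"
    (is "?S f w = 0")
proof (induction w arbitrary: f)
  case (Cons a w)
  have kq: "k * q = 1" "k * (q * x) = x" for x
    using assms(1) by (simp_all add: mult.commute flip: mult.assoc)
  have "?S f (a # w) = (if even a then q else 1) * ?S (\<lambda>u. f (a # u)) w"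
    by (cases "even a")
      (simp_all add: op_linear opi_evens opj_evens[OF assms(1)],
       simp_all add: algebra_simps power2_eq_square power3_eq_cube kq)
  then show ?case using Cons by simp
qed simp

section \<open>Linear extension from words, and the action of \<open>C'_q(K)\<close>\<close>

lemma free_algebra_induct [case_names single add]:
  fixes p :: "('a, 'k::ring_1) free_algebra"
  assumes single: "\<And>w c. Q (Poly_Mapping.single w c)" and add: "\<And>p r. Q p \<Longrightarrow> Q r \<Longrightarrow> Q (p + r)"
  shows "Q p"
proof (induction p rule: update_induct)
  case const
  show ?case using single[of _ 0] by simp
next
  case (update f w c)
  have "Poly_Mapping.update w c f = f + Poly_Mapping.single w c"
    using update(1) by (intro poly_mapping_eqI) (auto simp: lookup_update lookup_add lookup_single
        in_keys_iff when_def)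
  then show ?case using update single add by simp
qed

definition lin_ext :: "('k::ring_1 \<Rightarrow> 'b::ab_group_add \<Rightarrow> 'b) \<Rightarrow> ('a list \<Rightarrow> 'b) \<Rightarrow> ('a, 'k)
    free_algebra \<Rightarrow> 'b" where
  "lin_ext s h p = (\<Sum>w\<in>Poly_Mapping.keys p. s (Poly_Mapping.lookup p w) (h (letters w)))"

context
  fixes s :: "'k::comm_ring_1 \<Rightarrow> 'b::ab_group_add \<Rightarrow> 'b"
  assumes s: "module s"
begin

interpretation module s by (rule s)

lemma lin_ext_superset:
  assumes "finite A" "Poly_Mapping.keys p \<subseteq> A"
  shows "lin_ext s h p = (\<Sum>w\<in>A. s (Poly_Mapping.lookup p w) (h (letters w)))"
  unfolding lin_ext_def using assms by (intro sum.mono_neutral_left) (auto simp: in_keys_iff)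

lemma lin_ext_add: "lin_ext s h (p + r) = lin_ext s h p + lin_ext s h r"
proof -
  let ?A = "Poly_Mapping.keys p \<union> Poly_Mapping.keys r"
  have "lin_ext s h t = (\<Sum>w\<in>?A. s (Poly_Mapping.lookup t w) (h (letters w)))"
      if "t \<in> {p, r, p + r}" for t
    using that keys_add[of p r] by (intro lin_ext_superset) auto
  then show ?thesis
    by (simp add: lookup_add scale_left_distrib sum.distrib)
qed

lemma lin_ext_single: "lin_ext s h (Poly_Mapping.single w c) = s c (h (letters w))"
  by (simp add: lin_ext_def)

lemma lin_ext_0: "lin_ext s h 0 = 0"
  by (simp add: lin_ext_def)

lemma lin_ext_uminus: "lin_ext s h (- p) = - lin_ext s h p"
  using lin_ext_add[of h p "- p"] lin_ext_0[of h] by (metis add.right_inverse minus_unique)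

lemma lin_ext_diff: "lin_ext s h (p - r) = lin_ext s h p - lin_ext s h r"
  using lin_ext_add[of h p "- r"] lin_ext_uminus by simp

lemma lin_ext_scale: "lin_ext s h (fa_scale c p) = s c (lin_ext s h p)"
proof (induction p rule: free_algebra_induct)
  case (single w d)
  then show ?case by (simp add: fa_scale_def mult_single lin_ext_single)
next
  case (add p r)
  have "fa_scale c (p + r) = fa_scale c p + fa_scale c r" by (simp add: fa_scale_def distrib_left)
  then show ?case using add by (simp add: lin_ext_add scale_right_distrib)
qed

end

fun opw :: "'r::comm_ring_1 \<Rightarrow> vertex list \<Rightarrow> (int list \<Rightarrow> 'r) \<Rightarrow> int list \<Rightarrow> 'r" where
  "opw q [] f = f"
| "opw q (v # w) f = (case v of VI \<Rightarrow> opi q | VJ \<Rightarrow> opj q) (opw q w f)"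

lemma opw_append: "opw q (v @ w) f = opw q v (opw q w f)"
  by (induction v) simp_all

lemma opw_linear:
  "opw q w (\<lambda>u. f u + g u) u = opw q w f u + opw q w g u"
  "opw q w (\<lambda>u. c * f u) u = c * opw q w f u"
proof -
  have "opw q w (\<lambda>u. f u + g u) = (\<lambda>u. opw q w f u + opw q w g u)"
    by (induction w) (auto simp: op_linear split: vertex.split)
  then show "opw q w (\<lambda>u. f u + g u) u = opw q w f u + opw q w g u" by simp
  have "opw q w (\<lambda>u. c * f u) = (\<lambda>u. c * opw q w f u)"
    by (induction w) (auto simp: op_linear split: vertex.split)
  then show "opw q w (\<lambda>u. c * f u) u = c * opw q w f u" by simp
qed

lemma opw_0: "opw q w (\<lambda>u. 0) u = 0"
  using opw_linear(2)[of q w 0 "\<lambda>_. 0" u] by simp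

type_synonym states = "int list \<Rightarrow> rat poly fract"

definition fa_act :: "(vertex, rat poly fract) free_algebra \<Rightarrow> states \<Rightarrow> states" where
  "fa_act p f u = lin_ext (*) (\<lambda>w. opw q_indet w f u) p"

lemma module_mult: "module ((*) :: 'k::comm_ring_1 \<Rightarrow> _)"
  by standard (simp_all add: algebra_simps)

lemma fa_act_simps:
  "fa_act (p + r) f u = fa_act p f u + fa_act r f u"
  "fa_act (p - r) f u = fa_act p f u - fa_act r f u"
  "fa_act (fa_scale c p) f u = c * fa_act p f u"
  "fa_act (Poly_Mapping.single w c) f u = c * opw q_indet (letters w) f u"
  "fa_act 0 f u = 0"
  unfolding fa_act_def
  by (simp_all only: lin_ext_add[OF module_mult] lin_ext_diff[OF module_mult] lin_ext_scale[OF
      module_mult]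
      lin_ext_single[OF module_mult] lin_ext_0[OF module_mult])

lemma fa_act_0_right: "fa_act p (\<lambda>u. 0) u = 0"
  by (simp add: fa_act_def lin_ext_def opw_0)

lemma fa_act_single_mult:
  "fa_act (Poly_Mapping.single w c * r) f u = c * opw q_indet (letters w) (fa_act r f) u"
proof (induction r arbitrary: u rule: free_algebra_induct)
  case (single v d)
  have "opw q_indet (letters w) (fa_act (Poly_Mapping.single v d) f) u =
      opw q_indet (letters w) (\<lambda>u. d * opw q_indet (letters v) f u) u"
    by (rule arg_cong2[where f = "opw q_indet (letters w)"]) (auto simp: fa_act_simps)
  then show ?case
    by (simp add: mult_single fa_act_simps plus_free_monoid_def opw_append opw_linear)
next
  case (add p r)
  have "fa_act (p + r) f = (\<lambda>u. fa_act p f u + fa_act r f u)"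
    by (auto simp: fa_act_simps)
  then show ?case
    using add by (simp add: distrib_left fa_act_simps opw_linear)
qed

lemma fa_act_mult: "fa_act (p * r) f u = fa_act p (fa_act r f) u"
  by (induction p rule: free_algebra_induct)
    (simp_all add: fa_act_single_mult fa_act_simps distrib_right)

lemma fa_act_gen:
  "fa_act (fa_gen VI) f = opi q_indet f" "fa_act (fa_gen VJ) f = opj q_indet f"
  by (auto simp: fun_eq_iff fa_gen_def fa_act_simps)

lemma fa_act_1: "fa_act 1 f = f"
  by (auto simp: fun_eq_iff fa_act_simps zero_free_monoid_def simp flip: single_one)

lemma fa_act_ideal: "x \<in> ideal_gen serre_relations \<Longrightarrow> fa_act x f u = 0"
proof (induction arbitrary: f u rule: ideal_gen.induct)
  case (gen x)
  have q: "q_indet * inverse q_indet = 1" using q_nonzero(1) by simp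
  have mult: "fa_act (p * r) f = fa_act p (fa_act r f)" for p r f
    by (auto simp: fun_eq_iff fa_act_mult)
  show ?case
    using gen serre_opi[OF q, of f u] serre_opj[OF q, of f u]
    by (auto simp: serre_relations_def Let_def power2_eq_square power3_eq_cube mult.assoc
       fa_act_simps mult fa_act_gen)
next
  case (mult_left x a)
  then have "fa_act x f = (\<lambda>_. 0)" by auto
  then show ?case by (simp add: fa_act_mult fa_act_0_right)
qed (simp_all add: fa_act_simps fa_act_mult)

definition frac_act :: "comp_alg_frac \<Rightarrow> states \<Rightarrow> states" where
  "frac_act x = fa_act (rep_comp_alg_frac x)"

lemma frac_act_abs: "frac_act (abs_comp_alg_frac p) f u = fa_act p f u"
  using fa_act_ideal[OF abs_rep_diff[of p], of f u] by (simp add: frac_act_def fa_act_simps)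

lemma frac_act_simps:
  "frac_act (x + y) f u = frac_act x f u + frac_act y f u"
  "frac_act (x - y) f u = frac_act x f u - frac_act y f u"
  "frac_act (frac_scale c x) f u = c * frac_act x f u"
  "frac_act 1 f u = f u"
  "frac_act (frac_gen VI) f u = opi q_indet f u"
  "frac_act (frac_gen VJ) f u = opj q_indet f u"
  by (induction x; induction y; simp add: frac_act_abs plus_comp_alg_frac.abs_eq
      minus_comp_alg_frac.abs_eq
      one_comp_alg_frac.abs_eq frac_scale_abs frac_gen.abs_eq fa_act_simps fa_act_1 fa_act_gen)+

lemma frac_act_mult: "frac_act (x * y) f u = frac_act x (frac_act y f) u"
proof (induction x; induction y)
  fix p r
  have "frac_act (abs_comp_alg_frac r) f = fa_act r f" by (auto simp: frac_act_abs)
  then show "frac_act (abs_comp_alg_frac p * abs_comp_alg_frac r) f u =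
      frac_act (abs_comp_alg_frac p) (frac_act (abs_comp_alg_frac r) f) u"
    by (simp add: times_comp_alg_frac.abs_eq frac_act_abs fa_act_mult)
qed

section \<open>Integral form and specialisation at one\<close>

lemma op_hom:
  assumes h: "h 0 = 0" "h 1 = 1" "\<And>a b. h (a + b) = h a + h b" "\<And>a b. h (a * b) = h a * h b"
  shows "h (opi q f w) = opi (h q) (\<lambda>u. h (f u)) w" "h (opj q f w) = opj (h q) (\<lambda>u. h (f u)) w"
proof -
  have pow: "h (q ^ n) = h q ^ n" for n by (induction n) (simp_all add: h)
  show "h (opi q f w) = opi (h q) (\<lambda>u. h (f u)) w" "h (opj q f w) = opj (h q) (\<lambda>u. h (f u)) w"
    by (induction w arbitrary: f) (simp_all add: h pow)
qed

abbreviation pX :: "rat poly" where "pX \<equiv> [:0, 1:]"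

lemma to_fract_op:
  "opi q_indet (\<lambda>u. to_fract (f u)) w = to_fract (opi pX f w)"
  "opj q_indet (\<lambda>u. to_fract (f u)) w = to_fract (opj pX f w)"
  unfolding q_indet_def by (simp_all add: op_hom[of to_fract])

lemma frac_act_integral:
  "x \<in> generic_comp_alg \<Longrightarrow> \<exists>g. \<forall>u. frac_act x (\<lambda>u. to_fract (f u)) u = to_fract (g u)"
proof (induction arbitrary: f rule: generic_comp_alg.induct)
  case (gen v)
  show ?case by (cases v) (auto simp: frac_act_simps to_fract_op)
next
  case one
  show ?case by (auto simp: frac_act_simps)
next
  case (add x y)
  from add.IH[of f] obtain g g' where "\<And>u. frac_act x (\<lambda>u. to_fract (f u)) u = to_fract (g u)"
    "\<And>u. frac_act y (\<lambda>u. to_fract (f u)) u = to_fract (g' u)" by auto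
  then show ?case by (intro exI[of _ "\<lambda>u. g u + g' u"]) (simp add: frac_act_simps)
next
  case (mult x y)
  from mult.IH(2)[of f] obtain g where "\<And>u. frac_act y (\<lambda>u. to_fract (f u)) u = to_fract (g u)"
      by auto
  then have "frac_act y (\<lambda>u. to_fract (f u)) = (\<lambda>u. to_fract (g u))" by auto
  then show ?case using mult.IH(1)[of g] by (simp add: frac_act_mult)
next
  case (scale x c)
  from scale.IH[of f] obtain g where "\<And>u. frac_act x (\<lambda>u. to_fract (f u)) u = to_fract (g u)"
      by auto
  then show ?case by (intro exI[of _ "\<lambda>u. c * g u"]) (simp add: frac_act_simps)
qed

definition q_act :: "comp_alg_q \<Rightarrow> (int list \<Rightarrow> rat poly) \<Rightarrow> int list \<Rightarrow> rat poly" where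
  "q_act z f u = (THE g. to_fract g = frac_act (Rep_comp_alg_q z) (\<lambda>u. to_fract (f u)) u)"

lemma to_fract_q_act: "to_fract (q_act z f u) = frac_act (Rep_comp_alg_q z) (\<lambda>u. to_fract (f u)) u"
proof -
  obtain g where "frac_act (Rep_comp_alg_q z) (\<lambda>u. to_fract (f u)) u = to_fract (g u)"
    using frac_act_integral[OF Rep_comp_alg_q] by metis
  then have "\<exists>!g. to_fract g = frac_act (Rep_comp_alg_q z) (\<lambda>u. to_fract (f u)) u"
    by (auto intro!: ex1I[of _ "g u"])
  then show ?thesis unfolding q_act_def by (rule theI')
qed

lemma q_act_eqI: "to_fract a = frac_act (Rep_comp_alg_q z) (\<lambda>u. to_fract (f u)) u \<Longrightarrow> q_act z f u = a"
  by (simp flip: to_fract_q_act)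

lemma q_act_simps:
  "q_act (x + y) f u = q_act x f u + q_act y f u"
  "q_act (x - y) f u = q_act x f u - q_act y f u"
  "q_act (q_scale c x) f u = c * q_act x f u"
  "q_act 1 f u = f u"
  "q_act (x * y) f u = q_act x (q_act y f) u"
  "q_act (q_gen VI) f u = opi pX f u"
  "q_act (q_gen VJ) f u = opj pX f u"
  by (rule q_act_eqI; simp add: plus_comp_alg_q.rep_eq minus_comp_alg_q.rep_eq
      times_comp_alg_q.rep_eq
     one_comp_alg_q.rep_eq q_scale.rep_eq q_gen.rep_eq frac_act_simps frac_act_mult to_fract_q_act
         to_fract_op)+

definition q_R1 :: comp_alg_q where "q_R1 = q_gen VI * q_gen VJ - q_gen VJ * q_gen VI"

text \<open>Lifts of \<open>elt_P m\<close> that stay inside \<open>C\<^sub>q(K)\<close>: the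
  division by \<open>1 + q\<close> in \<open>frac_P\<close> is dropped, which changes nothing modulo
  \<open>q\<close>. The same holds for \<open>q_I\<close> and \<open>q_R\<close>.\<close>

primrec q_P :: "nat \<Rightarrow> comp_alg_q" where
  "q_P 0 = q_gen VJ"
| "q_P (Suc m) = q_R1 * q_P m - q_scale pX (q_P m * q_R1)"

primrec q_I :: "nat \<Rightarrow> comp_alg_q" where
  "q_I 0 = q_gen VI"
| "q_I (Suc n) = q_I n * q_R1 - q_scale pX (q_R1 * q_I n)"

definition q_R :: "nat \<Rightarrow> comp_alg_q" where
  "q_R s = q_gen VI * q_P (s - 1) - q_scale (pX ^ (s - 1)) (q_P (s - 1) * q_gen VI)"

definition q_pbw :: "nat list \<times> nat list \<times> nat list \<Rightarrow> comp_alg_q" where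
  "q_pbw = (\<lambda>(ms, ss, ns). prod_list (map q_P ms) * prod_list (map q_R ss) * prod_list (map q_I
      ns))"

lemma abs_q_R1: "abs_comp_alg_0 q_R1 = R1"
  by (simp add: q_R1_def R1_def gen0.abs_eq abs_comp_alg_0_simps)

lemma abs_q_P: "abs_comp_alg_0 (q_P m) = elt_P m"
proof (induction m)
  case (Suc m)
  have "abs_comp_alg_0 (q_P (Suc m)) = R1 * elt_P m - 0"
    by (simp only: q_P.simps abs_q_multiple Suc abs_q_R1 flip: abs_comp_alg_0_simps)
  then show ?case by (simp add: elt_P_def mult.assoc)
qed (simp add: elt_P_def gen0.abs_eq)

lemma abs_q_I: "abs_comp_alg_0 (q_I n) = elt_I n"
proof (induction n)
  case (Suc n)
  have "abs_comp_alg_0 (q_I (Suc n)) = elt_I n * R1 - 0"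
    by (simp only: q_I.simps abs_q_multiple Suc abs_q_R1 flip: abs_comp_alg_0_simps)
  then show ?case by (simp add: elt_I_def mult.assoc power_commutes)
qed (simp add: elt_I_def gen0.abs_eq)

lemma abs_q_R: "1 \<le> s \<Longrightarrow> abs_comp_alg_0 (q_R s) = elt_R s"
  by (cases "s = 1")
    (simp_all add: q_R_def elt_R_def R1_def abs_q_P abs_q_scale gen0.abs_eq poly_power elt_P_def
        mult.assoc
      flip: abs_comp_alg_0_simps)

lemma abs_prod_list: "abs_comp_alg_0 (prod_list zs) = prod_list (map abs_comp_alg_0 zs)"
  by (induction zs) (simp_all add: one_comp_alg_0.abs_eq flip: abs_comp_alg_0_simps)

lemma abs_q_pbw: "x \<in> pbw_index \<Longrightarrow> abs_comp_alg_0 (q_pbw x) = pbw_elt x"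
  by (auto simp: q_pbw_def pbw_elt_def pbw_index_def abs_prod_list abs_q_P abs_q_I abs_q_R
      simp flip: abs_comp_alg_0_simps cong: map_cong)

fun prim :: "(int \<Rightarrow> rat) \<Rightarrow> int \<Rightarrow> (int list \<Rightarrow> rat) \<Rightarrow> int list \<Rightarrow> rat" where
  "prim c d f [] = 0"
| "prim c d f (a # w) = c a * f ((a + d) # w) + prim c d (\<lambda>u. f (a # u)) w"

lemma prim_linear:
  "prim c d (\<lambda>u. f u + g u) w = prim c d f w + prim c d g w"
  "prim c d (\<lambda>u. k * f u) w = k * prim c d f w"
  by (induction w arbitrary: f g) (simp_all add: algebra_simps)

text \<open>Actions at two different letters commute; only both factors hitting the same letter
  contribute.\<close>

lemma prim_commutator:
  "prim c d (prim c' d' f) w - prim c' d' (prim c d f) w = prim (\<lambda>a. c a * c' (a + d)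
      - c' a * c (a + d')) (d + d') f w"
  by (induction w arbitrary: f) (simp_all add: prim_linear algebra_simps)

lemma op_prim:
  "opi 1 f w = prim (\<lambda>a. of_bool (odd a)) 1 f w"
  "opj 1 f w = prim (\<lambda>a. of_bool (even a)) 1 f w"
  by (induction w arbitrary: f) simp_all

definition acts_prim :: "comp_alg_q \<Rightarrow> (int \<Rightarrow> rat) \<Rightarrow> int \<Rightarrow> bool" where
  "acts_prim z c d \<longleftrightarrow> (\<forall>f u. poly (q_act z f u) 1 = prim c d (\<lambda>u. poly (f u) 1) u)"

lemma acts_prim_gen: "acts_prim (q_gen VI) (\<lambda>a. of_bool (odd a)) 1"
    "acts_prim (q_gen VJ) (\<lambda>a. of_bool (even a)) 1"
  by (simp_all add: acts_prim_def q_act_simps op_hom[of "\<lambda>p. poly p 1"] op_prim)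

lemma acts_prim_commutator:
  assumes "acts_prim z c d" "acts_prim z' c' d'" "poly k 1 = 1"
    and "e = d + d'" "\<And>a. b a = c a * c' (a + d) - c' a * c (a + d')"
  shows "acts_prim (z * z' - q_scale k (z' * z)) b e"
proof -
  have "b = (\<lambda>a. c a * c' (a + d) - c' a * c (a + d'))" using assms(5) by auto
  then show ?thesis
    using assms(1-4) unfolding acts_prim_def by (simp add: q_act_simps prim_commutator)
qed

lemma acts_prim_R1: "acts_prim q_R1 (\<lambda>a. if odd a then 1 else - 1) 2"
proof -
  have "q_R1 = q_gen VI * q_gen VJ - q_scale 1 (q_gen VJ * q_gen VI)" by (simp add: q_R1_def)
  moreover have "acts_prim (q_gen VI * q_gen VJ
      - q_scale 1 (q_gen VJ * q_gen VI)) (\<lambda>a. if odd a then 1 else - 1) 2"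
    by (rule acts_prim_commutator[OF acts_prim_gen]) auto
  ultimately show ?thesis by simp
qed

text \<open>\<open>R 1\<close> acts by -1 on even letters and by 1 on odd ones, and
  \<open>P m\<close> turns even into odd, so each commutator with \<open>R 1\<close> contributes the
  factor -2. For \<open>I\<close> the parities are exchanged.\<close>

lemma acts_prim_P: "acts_prim (q_P m) (\<lambda>a. (- 2) ^ m * of_bool (even a)) (2 * int m + 1)"
proof (induction m)
  case 0
  then show ?case using acts_prim_gen by simp
next
  case (Suc m)
  show ?case
    unfolding q_P.simps by (rule acts_prim_commutator[OF acts_prim_R1 Suc]) auto
qed

lemma acts_prim_I: "acts_prim (q_I n) (\<lambda>a. (- 2) ^ n * of_bool (odd a)) (2 * int n + 1)"
proof (induction n)
  case 0
  then show ?case using acts_prim_gen by simp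
next
  case (Suc n)
  show ?case
    unfolding q_I.simps by (rule acts_prim_commutator[OF Suc acts_prim_R1]) auto
qed

lemma acts_prim_R: "1 \<le> s \<Longrightarrow> acts_prim (q_R s) (\<lambda>a. (- 2) ^ (s - 1) * (if odd a then 1 else
    - 1)) (2 * int s)"
  unfolding q_R_def by (rule acts_prim_commutator[OF acts_prim_gen(1) acts_prim_P]) (auto simp:
      poly_power)

section \<open>Which letters a product of derivations moves\<close>

lemma prim_sum: "prim c d f w = (\<Sum>k<length w. c (w ! k) * f (w[k := w ! k + d]))"
  by (induction w arbitrary: f) (simp_all add: sum.lessThan_Suc_shift del: sum.lessThan_Suc)

text \<open>A tag records the letter at which an ordered factor acts and how far it moves it. Factors \<open>R\<^sub>s\<close> move
  letters of both parities with opposite signs; they are only ever placed at the letter \<open>1\<close>, so that no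
  cancellation occurs.\<close>

definition tags :: "(int \<times> int) set" where
  "tags = {(s, d). 0 < d \<and> (s = 1 \<or> s = 0 \<and> odd d)}"

text \<open>The exponent is \<open>m\<close> for the shift \<open>2m+1\<close> of \<open>P m\<close>
  and \<open>I m\<close>, and \<open>s-1\<close> for the shift \<open>2s\<close> of
  \<open>R s\<close>, so one formula covers all three kinds of factors.\<close>

definition coef :: "int \<times> int \<Rightarrow> int \<Rightarrow> rat" where
  "coef t a = (- 2) ^ nat ((snd t - 1) div 2) *
    (if odd (snd t) then of_bool (odd a = (fst t = 1)) else if odd a then 1 else - 1)"

lemma coef_self: "t \<in> tags \<Longrightarrow> coef t (fst t) \<noteq> 0"
  by (auto simp: tags_def coef_def)

lemma coef_other: "t \<in> tags \<Longrightarrow> t' \<in> tags \<Longrightarrow> snd t = snd t' \<Longrightarrow> t \<noteq> t' \<Longrightarrow> coef t (fst t') = 0"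
  by (auto simp: tags_def coef_def)

definition prims :: "(int \<times> int) list \<Rightarrow> (int list \<Rightarrow> rat) \<Rightarrow> int list \<Rightarrow> rat" where
  "prims L = foldr (\<lambda>t. prim (coef t) (snd t)) L"

definition moved :: "int list \<Rightarrow> int list \<Rightarrow> nat set" where
  "moved w b = {k. k < length w \<and> w ! k \<noteq> b ! k}"

definition moved_tags :: "int list \<Rightarrow> int list \<Rightarrow> (int \<times> int) multiset" where
  "moved_tags w b = image_mset (\<lambda>k. (w ! k, b ! k - w ! k)) (mset_set (moved w b))"

lemma finite_moved: "finite (moved w b)"
  by (simp add: moved_def)

abbreviation "delta b \<equiv> (\<lambda>u. of_bool (u = b))"

text \<open>Each factor changes a single letter, so at least \<open>card (moved w b)\<close> factors
  are needed to reach \<open>b\<close>.\<close>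

lemma prims_few:
  assumes "length L < card (moved w b)"
  shows "prims L (delta b) w = 0"
  using assms
proof (induction L arbitrary: w)
  case Nil
  then have "w \<noteq> b" by (auto simp: moved_def)
  then show ?case by (simp add: prims_def)
next
  case (Cons t L)
  have "prims L (delta b) (w[k := w ! k + snd t]) = 0" for k
  proof (rule Cons.IH)
    have "moved w b - {k} \<subseteq> moved (w[k := w ! k + snd t]) b"
      by (auto simp: moved_def)
    then have "card (moved w b - {k}) \<le> card (moved (w[k := w ! k + snd t]) b)"
      by (intro card_mono finite_moved)
    moreover have "card (moved w b) \<le> Suc (card (moved w b - {k}))"
      using card_Diff_singleton_if[of "moved w b" k] by (simp split: if_splits)
    ultimately show "length L < card (moved (w[k := w ! k + snd t]) b)"
      using Cons.prems by simp
  qed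
  then show ?case by (simp add: prims_def prim_sum)
qed

lemma prims_Cons_moved:
  assumes "t \<in> tags" "length b = length w" "Suc (length L) = card (moved w b)"
    "\<And>k. k \<in> moved w b \<Longrightarrow> (w ! k, b ! k - w ! k) \<in> tags"
  shows "prims (t # L) (delta b) w =
    (\<Sum>k\<in>{k \<in> moved w b. (w ! k, b ! k - w ! k) = t}. coef t (fst t) * prims L (delta b) (w[k := b
        ! k]))"
proof -
  let ?g = "\<lambda>k. coef t (w ! k) * prims L (delta b) (w[k := w ! k + snd t])"
  have pos: "0 < snd t" using assms(1) by (auto simp: tags_def)
  \<comment> \<open>Either letter \<open>k\<close> reaches its target under a wrong tag, and the
    coefficient is 0 by \<open>coef_other\<close>, or as many letters as before are still to be
    moved, and \<open>L\<close> is too short.\<close>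
  have "?g k = 0" if k: "k < length w" "\<not> (k \<in> moved w b \<and> (w ! k, b ! k - w ! k) = t)" for k
  proof (cases "k \<in> moved w b \<and> w ! k + snd t = b ! k")
    case True
    then have "snd t = b ! k - w ! k" by simp
    then show ?thesis
      using coef_other[OF assms(1) assms(4)[of k]] True k(2)
          by (metis fst_conv mult_zero_left snd_conv)
  next
    case False
    have "moved w b \<subseteq> moved (w[k := w ! k + snd t]) b"
      using False pos k(1) by (auto simp: moved_def nth_list_update)
    then have "length L < card (moved (w[k := w ! k + snd t]) b)"
      using card_mono[OF finite_moved] assms(3) by (metis Suc_le_eq)
    then show ?thesis by (simp add: prims_few)
  qed
  then have "sum ?g {..<length w} = sum ?g {k \<in> moved w b. (w ! k, b ! k - w ! k) = t}"
    by (intro sum.mono_neutral_right) (auto simp: moved_def)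
  also have "\<dots> = (\<Sum>k\<in>{k \<in> moved w b. (w ! k, b ! k - w ! k) =
      t}. coef t (fst t) * prims L (delta b) (w[k := b ! k]))"
    by (intro sum.cong) auto
  finally show ?thesis by (simp add: prims_def prim_sum)
qed

text \<open>Every matching of the factors with the moved letters contributes the same product of the
  numbers \<open>coef t (fst t)\<close>. Multiplying by this product once more makes all
  contributions positive, which excludes cancellation.\<close>

lemma prims_exact:
  assumes "set L \<subseteq> tags" "length b = length w" "length L = card (moved w b)"
    "\<And>k. k \<in> moved w b \<Longrightarrow> (w ! k, b ! k - w ! k) \<in> tags"
  shows "(mset L = moved_tags w b \<longrightarrow>
      0 < prod_list (map (\<lambda>t. coef t (fst t)) L) * prims L (delta b) w) \<and>
    (mset L \<noteq> moved_tags w b \<longrightarrow> prims L (delta b) w = 0)"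
  using assms
proof (induction L arbitrary: w)
  case Nil
  then have "moved w b = {}" using finite_moved by auto
  then have "w = b" using Nil(2) by (intro nth_equalityI) (auto simp: moved_def)
  then show ?case using \<open>moved w b = {}\<close> by (simp add: prims_def moved_tags_def)
next
  case (Cons t L)
  let ?K = "{k \<in> moved w b. (w ! k, b ! k - w ! k) = t}"
  let ?p = "prod_list (map (\<lambda>t. coef t (fst t)) L)"
  have t: "t \<in> tags" using Cons.prems by simp
  have eq: "prims (t # L) (delta b) w = (\<Sum>k\<in>?K. coef t (fst t) * prims L (delta b) (w[k := b ! k]))"
    using Cons.prems by (intro prims_Cons_moved t) auto
  have step: "moved_tags w b = add_mset t (moved_tags (w[k := b ! k]) b)"
    "(mset L = moved_tags (w[k := b ! k]) b \<longrightarrow> 0 < ?p * prims L (delta b) (w[k := b ! k])) \<and>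
    (mset L \<noteq> moved_tags (w[k := b ! k]) b \<longrightarrow> prims L (delta b) (w[k := b ! k]) = 0)"
    if "k \<in> ?K" for k
  proof -
    have k: "k \<in> moved w b" "(w ! k, b ! k - w ! k) = t" using that by auto
    then have m: "moved (w[k := b ! k]) b = moved w b - {k}"
      by (auto simp: moved_def nth_list_update)
    have "mset_set (moved w b) = add_mset k (mset_set (moved w b - {k}))"
      using k finite_moved by (metis mset_set.remove)
    then show "moved_tags w b = add_mset t (moved_tags (w[k := b ! k]) b)"
      using k(2) finite_moved[of w b]
      by (auto simp: moved_tags_def m intro!: image_mset_cong arg_cong2[where f = add_mset])
    show "(mset L = moved_tags (w[k := b ! k]) b \<longrightarrow> 0 < ?p * prims L (delta b) (w[k := b ! k])) \<and>
      (mset L \<noteq> moved_tags (w[k := b ! k]) b \<longrightarrow> prims L (delta b) (w[k := b ! k]) = 0)"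
    proof (rule Cons.IH)
      show "length L = card (moved (w[k := b ! k]) b)"
        using Cons.prems(3) k(1) finite_moved[of w b] by (simp add: m)
    next
      fix l assume "l \<in> moved (w[k := b ! k]) b"
      then show "((w[k := b ! k]) ! l, b ! l - (w[k := b ! k]) ! l) \<in> tags"
        using Cons.prems(4)[of l] unfolding m by simp
    qed (use Cons.prems in auto)
  qed
  show ?case
  proof (intro conjI impI)
    assume M: "mset (t # L) = moved_tags w b"
    then have "t \<in># moved_tags w b" by (metis list.set_intros(1) set_mset_mset)
    then have "?K \<noteq> {}" using finite_moved by (auto simp: moved_tags_def)
    moreover have "0 < ?p * prims L (delta b) (w[k := b ! k])" if "k \<in> ?K" for k
      using step[OF that] M by simp
    ultimately have "0 < (\<Sum>k\<in>?K. ?p * prims L (delta b) (w[k := b ! k]))"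
      using finite_moved by (intro sum_pos) auto
    moreover have "0 < coef t (fst t) * coef t (fst t)"
      using coef_self[OF t] by (auto simp: zero_less_mult_iff)
    ultimately have "0 < (coef t (fst t) * coef t (fst t)) * (\<Sum>k\<in>?K. ?p * prims L (delta b) (w[k
        := b ! k]))"
      by (rule mult_pos_pos[rotated])
    also have "\<dots> = prod_list (map (\<lambda>t. coef t (fst t)) (t # L)) * prims (t # L) (delta b) w"
      unfolding eq by (simp add: sum_distrib_left mult.assoc mult.left_commute)
    finally show "0 < prod_list (map (\<lambda>t. coef t (fst t)) (t # L)) * prims (t # L) (delta b) w" .
  next
    assume "mset (t # L) \<noteq> moved_tags w b"
    then have "prims L (delta b) (w[k := b ! k]) = 0" if "k \<in> ?K" for k
      using step[OF that] by auto
    then show "prims (t # L) (delta b) w = 0"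
      unfolding eq by (intro sum.neutral) auto
  qed
qed

section \<open>Functionals dual to the ordered products\<close>

fun pbw_tags :: "nat list \<times> nat list \<times> nat list \<Rightarrow> (int \<times> int) list" where
  "pbw_tags (ms, ss, ns) = map (\<lambda>m. (0, 2 * int m
      + 1)) ms @ map (\<lambda>s. (1, 2 * int s)) ss @ map (\<lambda>n. (1, 2 * int n + 1)) ns"

text \<open>One letter for each factor of \<open>y\<close>; \<open>target\<close> moves each letter
  by the shift of its factor.\<close>

definition start :: "nat list \<times> nat list \<times> nat list \<Rightarrow> int list" where
  "start y = map fst (pbw_tags y)"

definition target :: "nat list \<times> nat list \<times> nat list \<Rightarrow> int list" where
  "target y = map (\<lambda>t. fst t + snd t) (pbw_tags y)"

lemma pbw_tags_subset: "x \<in> pbw_index \<Longrightarrow> set (pbw_tags x) \<subseteq> tags"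
  by (cases x) (auto simp: pbw_index_def tags_def)

lemma poly_q_act_prod_list:
  "list_all2 (\<lambda>z t. acts_prim z (coef t) (snd t)) zs L \<Longrightarrow>
    poly (q_act (prod_list zs) f u) 1 = prims L (\<lambda>u. poly (f u) 1) u"
proof (induction zs L arbitrary: u rule: list_all2_induct)
  case Nil
  then show ?case by (simp add: prims_def q_act_simps)
next
  case (Cons z zs t L)
  then show ?case by (simp add: q_act_simps acts_prim_def) (simp add: prims_def)
qed

lemma acts_prim_tags:
  "acts_prim (q_P m) (coef (0, 2 * int m + 1)) (2 * int m + 1)"
  "acts_prim (q_I m) (coef (1, 2 * int m + 1)) (2 * int m + 1)"
  "1 \<le> s \<Longrightarrow> acts_prim (q_R s) (coef (1, 2 * int s)) (2 * int s)"
proof -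
  have "coef (0, 2 * int m + 1) = (\<lambda>a. (- 2) ^ m * of_bool (even a))"
    "coef (1, 2 * int m + 1) = (\<lambda>a. (- 2) ^ m * of_bool (odd a))"
    by (auto simp: coef_def)
  then show "acts_prim (q_P m) (coef (0, 2 * int m + 1)) (2 * int m + 1)"
    "acts_prim (q_I m) (coef (1, 2 * int m + 1)) (2 * int m + 1)"
    using acts_prim_P acts_prim_I by simp_all
  assume s: "1 \<le> s"
  have "nat ((2 * int s - 1) div 2) = s - 1" using s by simp
  then have "coef (1, 2 * int s) = (\<lambda>a. (- 2) ^ (s - 1) * (if odd a then 1 else - 1))"
    by (auto simp: coef_def)
  then show "acts_prim (q_R s) (coef (1, 2 * int s)) (2 * int s)"
    using acts_prim_R[OF s] by simp
qed

lemma poly_q_act_pbw: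
  assumes "x \<in> pbw_index"
  shows "poly (q_act (q_pbw x) f u) 1 = prims (pbw_tags x) (\<lambda>u. poly (f u) 1) u"
proof -
  obtain ms ss ns where x: "x = (ms, ss, ns)" by (cases x)
  have eq: "q_pbw x = prod_list (map q_P ms @ map q_R ss @ map q_I ns)"
    by (simp add: x q_pbw_def mult.assoc)
  have la: "list_all2 (\<lambda>z t. acts_prim z (coef t) (snd t)) (map q_P ms @ map q_R ss @ map q_I ns)
      (pbw_tags x)"
    using assms acts_prim_tags unfolding x pbw_tags.simps
    by (intro list_all2_appendI) (auto simp: list_all2_map1 list_all2_map2 list_all2_same
        pbw_index_def)
  show ?thesis unfolding eq by (rule poly_q_act_prod_list[OF la])
qed

definition pairing :: "nat list \<times> nat list \<times> nat list \<Rightarrow> comp_alg_q \<Rightarrow> rat poly" where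
  "pairing y z = q_act z (\<lambda>u. of_bool (u = target y)) (start y)"

lemma poly_pairing: "x \<in> pbw_index \<Longrightarrow> poly (pairing y (q_pbw x)) 1 =
    prims (pbw_tags x) (delta (target y)) (start y)"
proof -
  have "(\<lambda>u. poly (of_bool (u = target y)) 1) = (delta (target y) :: _ \<Rightarrow> rat)" by auto
  then show "x \<in> pbw_index \<Longrightarrow> ?thesis" by (simp add: pairing_def poly_q_act_pbw)
qed

lemma moved_start:
  assumes "y \<in> pbw_index"
  shows "moved (start y) (target y) = {..<length (pbw_tags y)}" "moved_tags (start y) (target y) =
      mset (pbw_tags y)"
proof -
  have "snd (pbw_tags y ! k) \<noteq> 0" if "k < length (pbw_tags y)" for k
    using pbw_tags_subset[OF assms] nth_mem[OF that] by (auto simp: tags_def)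
  then show m: "moved (start y) (target y) = {..<length (pbw_tags y)}"
    by (auto simp: moved_def start_def target_def)
  have "moved_tags (start y) (target y) =
      image_mset (\<lambda>k. pbw_tags y ! k) (mset_set {..<length (pbw_tags y)})"
    unfolding moved_tags_def m by (intro image_mset_cong) (auto simp: start_def target_def)
  also have "\<dots> = mset (map (\<lambda>k. pbw_tags y ! k) [0..<length (pbw_tags y)])"
    by (simp add: atLeast0LessThan del: map_nth)
  finally show "moved_tags (start y) (target y) = mset (pbw_tags y)" by (simp add: map_nth)
qed

lemma sorted_unique:
  assumes "sorted_wrt (\<le>) xs" "sorted_wrt (\<le>) ys" "mset xs = mset (ys :: nat list)"
  shows "xs = ys"
  using assms by (metis properties_for_sort)

lemma sorted_desc_unique:
  assumes "sorted_wrt (\<ge>) xs" "sorted_wrt (\<ge>) ys" "mset xs = mset (ys :: nat list)"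
  shows "xs = ys"
proof -
  have "rev xs = rev ys" using assms by (intro sorted_unique) (simp_all add: sorted_wrt_rev)
  then show ?thesis by simp
qed

text \<open>The first component separates \<open>P\<close> from the rest, the parity of the shift
  separates \<open>R\<close> from \<open>I\<close>, half the shift is the index, and sorted lists
  are determined by their multisets.\<close>

lemma pbw_tags_inj:
  assumes "x \<in> pbw_index" "y \<in> pbw_index" "mset (pbw_tags x) = mset (pbw_tags y)"
  shows "x = y"
proof -
  obtain ms ss ns ms' ss' ns' where x: "x = (ms, ss, ns)" and y: "y = (ms', ss', ns')"
    by (cases x; cases y)
  have P: "image_mset (\<lambda>t. nat (snd t div 2)) (filter_mset (\<lambda>t. fst t =
      0) (mset (pbw_tags (ms, ss, ns)))) = mset ms"
    and R: "image_mset (\<lambda>t. nat (snd t div 2)) (filter_mset (\<lambda>t. fst t = 1 \<and>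
        even (snd t)) (mset (pbw_tags (ms, ss, ns)))) = mset ss"
    and I: "image_mset (\<lambda>t. nat (snd t div 2)) (filter_mset (\<lambda>t. fst t = 1 \<and>
        odd (snd t)) (mset (pbw_tags (ms, ss, ns)))) = mset ns"
    for ms ss ns
    by (simp_all add: filter_mset_image_mset image_mset.compositionality comp_def)
  have e: "mset (pbw_tags (ms, ss, ns)) = mset (pbw_tags (ms', ss', ns'))"
    using assms(3) by (simp only: x y)
  have "mset ms = mset ms'" "mset ss = mset ss'" "mset ns = mset ns'"
    using P[of ms ss ns] P[of ms' ss' ns'] R[of ms ss ns] R[of ms' ss' ns'] I[of ms ss ns] I[of
        ms' ss' ns']
    unfolding e by (auto simp only:)
  then show ?thesis
    using assms(1,2) sorted_unique sorted_desc_unique by (auto simp: x y pbw_index_def)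
qed

text \<open>Triangularity in the number of factors: too few factors cannot move every letter of
  \<open>start y\<close>, and equally many do so only if the tags agree.\<close>

lemma pairing_at_1:
  assumes "x \<in> pbw_index" "y \<in> pbw_index" "length (pbw_tags x) \<le> length (pbw_tags y)"
  shows "poly (pairing y (q_pbw x)) 1 = 0 \<longleftrightarrow> x \<noteq> y"
proof (cases "length (pbw_tags x) = length (pbw_tags y)")
  case False
  then show ?thesis
    using assms by (auto simp: poly_pairing moved_start intro!: prims_few)
next
  case True
  have "(start y ! k, target y ! k - start y ! k) \<in> tags" if "k \<in> moved (start y) (target y)" for k
  proof -
    have k: "k < length (pbw_tags y)" using that unfolding moved_start[OF assms(2)] by simp
    then have "pbw_tags y ! k \<in> tags" using pbw_tags_subset[OF assms(2)] nth_mem by blast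
    then show ?thesis using k by (simp add: start_def target_def)
  qed
  then have "(mset (pbw_tags x) = mset (pbw_tags y) \<longrightarrow>
      0 < prod_list (map (\<lambda>t. coef t (fst t)) (pbw_tags x)) * poly (pairing y (q_pbw x)) 1) \<and>
    (mset (pbw_tags x) \<noteq> mset (pbw_tags y) \<longrightarrow> poly (pairing y (q_pbw x)) 1 = 0)"
    unfolding poly_pairing[OF assms(1)] moved_start(2)[OF assms(2), symmetric]
    using pbw_tags_subset[OF assms(1)] True
    by (intro prims_exact) (simp_all add: moved_start[OF assms(2)], simp add: start_def target_def)
  then show ?thesis
    using pbw_tags_inj[OF assms(1,2)] by (cases "x = y") auto
qed

text \<open>The grading by the sum of letters. It holds for every \<open>q\<close>, not only at 1,
  and so confines each functional to the finitely many ordered products of one degree.\<close>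

definition homogeneous :: "comp_alg_q \<Rightarrow> int \<Rightarrow> bool" where
  "homogeneous z n \<longleftrightarrow> (\<forall>f S u. (\<forall>u. sum_list u \<noteq> S \<longrightarrow> f u = 0) \<longrightarrow> sum_list u + n \<noteq> S \<longrightarrow> q_act z f u =
      0)"

lemma homogeneousD:
  "homogeneous z n \<Longrightarrow> (\<And>u. sum_list u \<noteq> S \<Longrightarrow> f u = 0) \<Longrightarrow> sum_list u + n \<noteq> S \<Longrightarrow> q_act z f u = 0"
  unfolding homogeneous_def by blast

lemma op_homogeneous:
  assumes "\<And>u. sum_list u \<noteq> S \<Longrightarrow> f u = 0" "sum_list w + 1 \<noteq> S"
  shows "opi q f w = 0 \<and> opj q f w = 0"
  using assms
proof (induction w arbitrary: f S)
  case (Cons a w)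
  have "opi q (\<lambda>u. f (a # u)) w = 0 \<and> opj q (\<lambda>u. f (a # u)) w = 0"
    using Cons.prems by (intro Cons.IH[of "S - a"]) auto
  then show ?case
    using Cons.prems by simp
qed simp

lemma homogeneous_simps:
  "homogeneous (q_gen v) 1"
  "homogeneous 1 0"
  "homogeneous z n \<Longrightarrow> homogeneous z' n' \<Longrightarrow> m = n + n' \<Longrightarrow> homogeneous (z * z') m"
  "homogeneous z n \<Longrightarrow> homogeneous z' n \<Longrightarrow> homogeneous (z - z') n"
  "homogeneous z n \<Longrightarrow> homogeneous (q_scale c z) n"
proof -
  show "homogeneous (q_gen v) 1"
    unfolding homogeneous_def
  proof (intro allI impI)
    fix f :: "int list \<Rightarrow> rat poly" and S u
    assume "\<forall>u. sum_list u \<noteq> S \<longrightarrow> f u = 0" "sum_list u + 1 \<noteq> S"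
    then have "opi pX f u = 0 \<and> opj pX f u = 0" by (intro op_homogeneous) auto
    then show "q_act (q_gen v) f u = 0" by (cases v) (simp_all add: q_act_simps)
  qed
  assume z: "homogeneous z n"
  show "homogeneous (z * z') m" if z': "homogeneous z' n'" and "m = n + n'"
    unfolding homogeneous_def
  proof (intro allI impI)
    fix f :: "int list \<Rightarrow> rat poly" and S u
    assume "\<forall>u. sum_list u \<noteq> S \<longrightarrow> f u = 0" "sum_list u + m \<noteq> S"
    then have f: "sum_list v \<noteq> S \<Longrightarrow> f v = 0" and u: "sum_list u + n \<noteq> S - n'" for v
      using \<open>m = n + n'\<close> by auto
    have "q_act z' f v = 0" if "sum_list v \<noteq> S - n'" for v
      using homogeneousD[OF z', of S f v] f that by auto
    then have "q_act z (q_act z' f) u = 0"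
      using u by (intro homogeneousD[OF z, of "S - n'"]) auto
    then show "q_act (z * z') f u = 0" by (simp add: q_act_simps)
  qed
qed (auto simp: homogeneous_def q_act_simps)

lemma homogeneous_R1: "homogeneous q_R1 2"
  unfolding q_R1_def by (rule homogeneous_simps(4); rule homogeneous_simps(3)[OF
      homogeneous_simps(1) homogeneous_simps(1)]; simp)

lemma homogeneous_P: "homogeneous (q_P m) (2 * int m + 1)"
proof (induction m)
  case (Suc m)
  show ?case unfolding q_P.simps
    by (intro homogeneous_simps(4,5) homogeneous_simps(3)[OF homogeneous_R1 Suc]
        homogeneous_simps(3)[OF Suc homogeneous_R1]) simp_all
qed (use homogeneous_simps(1) in simp)

lemma homogeneous_I: "homogeneous (q_I m) (2 * int m + 1)"
proof (induction m)
  case (Suc m)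
  show ?case unfolding q_I.simps
    by (intro homogeneous_simps(4,5) homogeneous_simps(3)[OF homogeneous_R1 Suc]
        homogeneous_simps(3)[OF Suc homogeneous_R1]) simp_all
qed (use homogeneous_simps(1) in simp)

lemma homogeneous_R: "1 \<le> s \<Longrightarrow> homogeneous (q_R s) (2 * int s)"
  unfolding q_R_def
  by (intro homogeneous_simps(4,5) homogeneous_simps(3)[OF homogeneous_simps(1) homogeneous_P]
      homogeneous_simps(3)[OF homogeneous_P homogeneous_simps(1)]) simp_all

definition pbw_deg :: "nat list \<times> nat list \<times> nat list \<Rightarrow> int" where
  "pbw_deg x = sum_list (map snd (pbw_tags x))"

lemma homogeneous_prod_list:
  "list_all2 (\<lambda>z t. homogeneous z (snd t)) zs L \<Longrightarrow> homogeneous (prod_list zs) (sum_list (map snd L))"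
  by (induction rule: list_all2_induct) (auto intro: homogeneous_simps)

lemma homogeneous_pbw:
  assumes "x \<in> pbw_index"
  shows "homogeneous (q_pbw x) (pbw_deg x)"
proof -
  obtain ms ss ns where x: "x = (ms, ss, ns)" by (cases x)
  have eq: "q_pbw x = prod_list (map q_P ms @ map q_R ss @ map q_I ns)"
    by (simp add: x q_pbw_def mult.assoc)
  have la: "list_all2 (\<lambda>z t. homogeneous z (snd t)) (map q_P ms @ map q_R ss @ map q_I ns)
      (pbw_tags x)"
    using assms homogeneous_P homogeneous_I homogeneous_R unfolding x pbw_tags.simps
    by (intro list_all2_appendI) (auto simp: list_all2_map1 list_all2_map2 list_all2_same
        pbw_index_def)
  show ?thesis unfolding eq pbw_deg_def by (rule homogeneous_prod_list[OF la])
qed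

lemma pairing_deg:
  assumes "x \<in> pbw_index" "pbw_deg x \<noteq> pbw_deg y"
  shows "pairing y (q_pbw x) = 0"
proof -
  have "sum_list (target y) = sum_list (start y) + pbw_deg y"
    by (simp add: target_def start_def pbw_deg_def sum_list_addf)
  then have "sum_list (start y) + pbw_deg x \<noteq> sum_list (target y)" using assms(2) by simp
  then show ?thesis
    unfolding pairing_def by (rule homogeneousD[OF homogeneous_pbw[OF assms(1)], rotated]) auto
qed

lemma positive_sum_list:
  assumes "\<And>d. d \<in> set L \<Longrightarrow> 0 < (d :: int)"
  shows "int (length L) \<le> sum_list L \<and> (\<forall>d \<in> set L. d \<le> sum_list L)"
  using assms
proof (induction L)
  case (Cons a L)
  then have "0 < a" "int (length L) \<le> sum_list L" "\<forall>d \<in> set L. d \<le> sum_list L" by auto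
  then show ?case by auto
qed simp

lemma finite_pbw_deg: "finite {x \<in> pbw_index. pbw_deg x = D}"
proof -
  let ?L = "{xs. set xs \<subseteq> {..nat D} \<and> length xs \<le> nat D}"
  have "x \<in> ?L \<times> ?L \<times> ?L" if "x \<in> pbw_index" "pbw_deg x = D" for x
  proof -
    obtain ms ss ns where x: "x = (ms, ss, ns)" by (cases x)
    have pos: "0 < d" if "d \<in> set (map snd (pbw_tags x))" for d
      using pbw_tags_subset[OF \<open>x \<in> pbw_index\<close>] that by (auto simp: tags_def)
    have le: "d \<le> D" if "d \<in> set (map snd (pbw_tags x))" for d
      using positive_sum_list[of "map snd (pbw_tags x)", OF pos] that \<open>pbw_deg x = D\<close>
          unfolding pbw_deg_def by blast
    have "int (length (pbw_tags x)) \<le> D"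
      using positive_sum_list[of "map snd (pbw_tags x)", OF pos] \<open>pbw_deg x = D\<close>
          unfolding pbw_deg_def by simp
    then have "length ms \<le> nat D" "length ss \<le> nat D" "length ns \<le> nat D"
      by (simp_all add: x)
    moreover have "m \<le> nat D" if "m \<in> set ms" for m
      using le[of "2 * int m + 1"] that by (simp add: x)
    moreover have "m \<le> nat D" if "m \<in> set ss" for m
      using le[of "2 * int m"] that by (simp add: x)
    moreover have "m \<le> nat D" if "m \<in> set ns" for m
      using le[of "2 * int m + 1"] that by (simp add: x)
    ultimately show ?thesis
      by (simp add: x subset_iff)
  qed
  then have "{x \<in> pbw_index. pbw_deg x = D} \<subseteq> ?L \<times> ?L \<times> ?L" by (intro subsetI) simp
  moreover have L: "finite ?L" by (rule finite_lists_length_le) simp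
  have "finite (?L \<times> ?L \<times> ?L)" by (intro finite_SigmaI L)
  ultimately show ?thesis by (rule finite_subset)
qed

text \<open>In a nontrivial combination take \<open>y\<close> with the largest number of factors
  among those with nonzero coefficient; the equation for \<open>y\<close> then has \<open>y\<close>
  as its only nonzero term.\<close>

lemma pairing_independent_at_1:
  assumes "finite X" "X \<subseteq> pbw_index" "\<And>y. y \<in> X \<Longrightarrow> (\<Sum>x\<in>X. c x * poly (pairing y (q_pbw x)) 1) = 0"
    and "x \<in> X"
  shows "c x = 0"
proof (rule ccontr)
  assume "c x \<noteq> 0"
  let ?Y = "{x \<in> X. c x \<noteq> 0}" and ?l = "\<lambda>x. length (pbw_tags x)"
  have "finite ?Y" using assms(1) by simp
  moreover have "?Y \<noteq> {}" using assms(4) \<open>c x \<noteq> 0\<close> by blast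
  ultimately have "Max (?l ` ?Y) \<in> ?l ` ?Y" by (intro Max_in) simp_all
  then obtain y where "Max (?l ` ?Y) = ?l y" "y \<in> ?Y" by (rule imageE)
  then have y: "y \<in> X" "c y \<noteq> 0" "?l y = Max (?l ` ?Y)" by simp_all
  have max: "?l x \<le> ?l y" if "x \<in> X" "c x \<noteq> 0" for x
    unfolding y(3)
  proof (rule Max_ge)
    show "finite (?l ` ?Y)" using assms(1) by simp
    show "?l x \<in> ?l ` ?Y" using that by (intro imageI) simp
  qed
  have "(\<Sum>x\<in>X. c x * poly (pairing y (q_pbw x)) 1) = (\<Sum>x\<in>{y}. c x * poly (pairing y (q_pbw x)) 1)"
  proof (rule sum.mono_neutral_right)
    show "\<forall>x\<in>X - {y}. c x * poly (pairing y (q_pbw x)) 1 = 0"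
    proof
      fix x assume "x \<in> X - {y}"
      then show "c x * poly (pairing y (q_pbw x)) 1 = 0"
        using pairing_at_1[of x y] max[of x] assms(2) y(1) by (cases "c x = 0") auto
    qed
  qed (use assms y in auto)
  also have "\<dots> \<noteq> 0"
    using pairing_at_1[of y y] y assms(2) by auto
  finally show False using assms(3)[OF y(1)] by simp
qed

text \<open>A nontrivial solution may be divided by \<open>q - 1\<close> until it is nontrivial at \<open>q = 1\<close>.\<close>

lemma polynomial_combination_zero:
  fixes A :: "'y \<Rightarrow> 'x \<Rightarrow> rat poly"
  assumes indep: "\<And>c :: 'x \<Rightarrow> rat. (\<And>y. y \<in> Y \<Longrightarrow> (\<Sum>x\<in>X. c x * poly (A y x) 1) = 0) \<Longrightarrow> \<forall>x\<in>X. c x = 0"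
    and zero: "\<And>y. y \<in> Y \<Longrightarrow> (\<Sum>x\<in>X. c x * A y x) = 0" and "x0 \<in> X"
  shows "c x0 = 0"
  using zero
proof (induction "degree (c x0)" arbitrary: c rule: less_induct)
  case less
  show ?case
  proof (rule ccontr)
    assume nz: "c x0 \<noteq> 0"
    have "\<forall>x\<in>X. poly (c x) 1 = 0"
    proof (rule indep)
      fix y assume "y \<in> Y"
      then have "poly (\<Sum>x\<in>X. c x * A y x) 1 = 0" using less.prems by simp
      then show "(\<Sum>x\<in>X. poly (c x) 1 * poly (A y x) 1) = 0" by (simp add: poly_sum)
    qed
    then have "\<forall>x\<in>X. \<exists>d. c x = [:- 1, 1:] * d"
      using poly_eq_0_iff_dvd[of _ 1] by (metis dvd_def)
    then obtain d where d: "\<And>x. x \<in> X \<Longrightarrow> c x = [:- 1, 1:] * d x" by metis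
    have "d x0 \<noteq> 0" using d[OF \<open>x0 \<in> X\<close>] nz by auto
    then have "degree (c x0) = Suc (degree (d x0))"
      unfolding d[OF \<open>x0 \<in> X\<close>] by (subst degree_mult_eq) auto
    moreover have "(\<Sum>x\<in>X. d x * A y x) = 0" if "y \<in> Y" for y
    proof -
      have "[:- 1, 1:] * (\<Sum>x\<in>X. d x * A y x) = (\<Sum>x\<in>X. c x * A y x)"
        unfolding sum_distrib_left by (intro sum.cong) (simp_all only: d mult.assoc)
      then have "[:- 1, 1:] * (\<Sum>x\<in>X. d x * A y x) = 0" using less.prems[OF that] by (simp only:)
      then show ?thesis unfolding mult_eq_0_iff by auto
    qed
    ultimately have "d x0 = 0" using less.hyps by simp
    then show False using \<open>d x0 \<noteq> 0\<close> by simp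
  qed
qed

lemma common_denominator:
  fixes k :: "'x \<Rightarrow> rat poly fract"
  assumes "finite X"
  shows "\<exists>d p. d \<noteq> 0 \<and> (\<forall>x\<in>X. to_fract d * k x = to_fract (p x))"
  using assms
proof (induction X)
  case empty
  show ?case by (rule exI[of _ 1]) simp
next
  case (insert a X)
  then obtain d p where d: "d \<noteq> 0" "\<forall>x\<in>X. to_fract d * k x = to_fract (p x)" by auto
  obtain r t where k: "k a = Fract r t" "t \<noteq> 0" by (cases "k a")
  then have "to_fract t * k a = to_fract r" by (simp add: to_fract_def eq_fract)
  then have "to_fract (d * t) * k x = to_fract (if x = a then d * r else t * p x)"
      if "x \<in> insert a X" for x
    using d(2) that by (auto simp: mult.assoc mult.left_commute)
  then show ?case using d(1) k(2) by (intro exI[of _ "d * t"] exI[of _ "\<lambda>x. if x =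
      a then d * r else t * p x"]) auto
qed

definition fun_scale :: "'k::field \<Rightarrow> ('y \<Rightarrow> 'k) \<Rightarrow> 'y \<Rightarrow> 'k" where
  "fun_scale c f = (\<lambda>y. c * f y)"

lemma vector_space_pair_fun_scale: "vector_space_pair (fun_scale :: 'k::field \<Rightarrow> ('y \<Rightarrow> 'k) \<Rightarrow> _)
    ((*) :: 'k \<Rightarrow> 'k \<Rightarrow> 'k)"
  by unfold_locales (auto simp: fun_scale_def fun_eq_iff algebra_simps)

text \<open>Independence allows a linear functional on all functions with the prescribed values on
  the \<open>v x\<close>. As these are supported in the finite set \<open>Y\<close>, its values at
  the unit vectors give \<open>u\<close>.\<close>

lemma dual_vector:
  fixes v :: "'x \<Rightarrow> 'y \<Rightarrow> 'k::field"
  assumes "finite X" "finite Y"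
    and supp: "\<And>x y. x \<in> X \<Longrightarrow> y \<notin> Y \<Longrightarrow> v x y = 0"
    and indep: "\<And>c. (\<And>y. y \<in> Y \<Longrightarrow> (\<Sum>x\<in>X. c x * v x y) = 0) \<Longrightarrow> \<forall>x\<in>X. c x = 0"
    and "x0 \<in> X"
  shows "\<exists>u. \<forall>x\<in>X. (\<Sum>y\<in>Y. u y * v x y) = (if x = x0 then 1 else 0)"
proof -
  interpret vector_space_pair "fun_scale :: 'k \<Rightarrow> ('y \<Rightarrow> 'k) \<Rightarrow> _" "(*) :: 'k \<Rightarrow> 'k \<Rightarrow> 'k"
    by (rule vector_space_pair_fun_scale)
  have sum_apply: "(\<Sum>a\<in>A. g a) y = (\<Sum>a\<in>A. g a y)" for A :: "'z set" and g :: "'z \<Rightarrow> 'y \<Rightarrow> 'k" and y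
    by (induction A rule: infinite_finite_induct) auto
  have inj: "inj_on v X"
  proof (rule inj_onI, rule ccontr)
    fix x x' assume x: "x \<in> X" "x' \<in> X" "v x = v x'" "x \<noteq> x'"
    let ?c = "\<lambda>z. if z = x then 1 else if z = x' then - 1 else (0 :: 'k)"
    have "(\<Sum>z\<in>X. ?c z * v z y) = (\<Sum>z\<in>{x, x'}. ?c z * v z y)" for y
      using x assms(1) by (intro sum.mono_neutral_right) auto
    then have "\<forall>z\<in>X. ?c z = 0" using x by (intro indep) simp
    then show False using x(1) by (metis one_neq_zero)
  qed
  have "vs1.independent (v ` X)"
  proof -
    have "\<forall>x\<in>X. c (v x) = 0" if "(\<Sum>w\<in>v ` X. fun_scale (c w) w) = 0" for c
    proof (rule indep)
      fix y assume "y \<in> Y"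
      have "(\<Sum>x\<in>X. c (v x) * v x y) = (\<Sum>w\<in>v ` X. fun_scale (c w) w) y"
        by (simp add: sum_apply sum.reindex[OF inj] fun_scale_def)
      then show "(\<Sum>x\<in>X. c (v x) * v x y) = 0" using that by simp
    qed
    then show ?thesis
      using vs1.dependent_finite[of "v ` X"] assms(1) by auto
  qed
  then obtain g where g: "Vector_Spaces.linear fun_scale (*) g" "\<forall>w\<in>v ` X. g w = (if w =
      v x0 then 1 else 0)"
    using linear_independent_extend[of "v ` X" "\<lambda>w. if w = v x0 then 1 else 0"] by auto
  interpret g: Vector_Spaces.linear fun_scale "(*)" g by (rule g)
  let ?d = "\<lambda>y z. if z = y then 1 else (0 :: 'k)"
  have "(\<Sum>y\<in>Y. g (?d y) * v x y) = (if x = x0 then 1 else 0)" if "x \<in> X" for x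
  proof -
    have "v x = (\<Sum>y\<in>Y. fun_scale (v x y) (?d y))"
      using supp[OF that] assms(2)
          by (auto simp: fun_eq_iff sum_apply fun_scale_def if_distrib cong: if_cong)
    then have "g (v x) = g (\<Sum>y\<in>Y. fun_scale (v x y) (?d y))" by simp
    also have "\<dots> = (\<Sum>y\<in>Y. g (?d y) * v x y)"
      by (simp add: g.sum g.scale mult.commute)
    finally show ?thesis
      using g(2) that inj \<open>x0 \<in> X\<close> by (auto simp: inj_on_eq_iff)
  qed
  then show ?thesis by (intro exI[of _ "\<lambda>y. g (?d y)"] ballI)
qed

text \<open>The dual vector exists over the fraction field, and \<open>d\<close> is the common
  denominator of its coefficients; nothing prevents \<open>q\<close> from dividing it.\<close>

lemma dual_functional:
  assumes "x0 \<in> pbw_index"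
  shows "\<exists>X u d. finite X \<and> d \<noteq> 0 \<and>
    (\<forall>x\<in>pbw_index. (\<Sum>y\<in>X. u y * pairing y (q_pbw x)) = (if x = x0 then d else 0))"
proof -
  define X where "X = {x \<in> pbw_index. pbw_deg x = pbw_deg x0}"
  have X: "finite X" "X \<subseteq> pbw_index" "x0 \<in> X"
    using finite_pbw_deg assms by (auto simp: X_def)
  define v where "v x y = (if y \<in> X then to_fract (pairing y (q_pbw x)) else 0)" for x y
  have indep: "\<forall>x\<in>X. c x = 0" if c: "\<And>y. y \<in> X \<Longrightarrow> (\<Sum>x\<in>X. c x * v x y) = 0" for c
  proof
    fix x1 assume "x1 \<in> X"
    obtain d p where d: "d \<noteq> 0" "\<And>x. x \<in> X \<Longrightarrow> to_fract d * c x = to_fract (p x)"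
      using common_denominator[OF X(1), of c] by auto
    have "p x1 = 0"
    proof (rule polynomial_combination_zero[where A = "\<lambda>y x. pairing y (q_pbw x)"
        and X = X and Y = X and c = p])
      fix y assume y: "y \<in> X"
      have "to_fract (\<Sum>x\<in>X. p x * pairing y (q_pbw x)) = (\<Sum>x\<in>X. to_fract d * c x * v x y)"
        using y by (simp add: to_fract_sum d v_def)
      also have "\<dots> = to_fract d * (\<Sum>x\<in>X. c x * v x y)"
        by (simp add: sum_distrib_left mult.assoc)
      finally show "(\<Sum>x\<in>X. p x * pairing y (q_pbw x)) = 0"
        unfolding c[OF y] by (simp only: mult_zero_right to_fract_eq_0_iff)
    next
      show "\<forall>x\<in>X. a x = 0" if "\<And>y. y \<in> X \<Longrightarrow> (\<Sum>x\<in>X. a x * poly (pairing y (q_pbw x)) 1) = 0" for a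
        using pairing_independent_at_1[OF X(1,2) that] by blast
    qed (rule \<open>x1 \<in> X\<close>)
    then show "c x1 = 0" using d(1) d(2)[OF \<open>x1 \<in> X\<close>] by simp
  qed
  have "\<exists>u. \<forall>x\<in>X. (\<Sum>y\<in>X. u y * v x y) = (if x = x0 then 1 else 0)"
    by (rule dual_vector[OF X(1) X(1) _ indep X(3)]) (simp_all add: v_def)
  then obtain u where u: "\<And>x. x \<in> X \<Longrightarrow> (\<Sum>y\<in>X. u y * v x y) = (if x = x0 then 1 else 0)"
    by blast
  obtain d p where d: "d \<noteq> 0" "\<And>x. x \<in> X \<Longrightarrow> to_fract d * u x = to_fract (p x)"
    using common_denominator[OF X(1), of u] by auto
  have "(\<Sum>y\<in>X. p y * pairing y (q_pbw x)) = (if x = x0 then d else 0)" if x: "x \<in> pbw_index" for x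
  proof (cases "x \<in> X")
    case True
    have "to_fract (\<Sum>y\<in>X. p y * pairing y (q_pbw x)) = (\<Sum>y\<in>X. to_fract d * u y * v x y)"
      by (simp add: to_fract_sum d v_def)
    also have "\<dots> = to_fract d * (\<Sum>y\<in>X. u y * v x y)"
      by (simp add: sum_distrib_left mult.assoc)
    also have "\<dots> = to_fract (if x = x0 then d else 0)"
      using u[OF True] by simp
    finally show ?thesis by (simp only: to_fract_eq_iff)
  next
    case False
    then have "pairing y (q_pbw x) = 0" if "y \<in> X" for y
      using x that by (intro pairing_deg) (auto simp: X_def)
    then show ?thesis using False X(3) by (auto intro!: sum.neutral)
  qed
  then show ?thesis using X(1) d(1) by blast
qed

section \<open>The basis\<close>

lemma pbw_sums_subset_span: "comp0.pbw_sums \<subseteq> C0.span (pbw_elt ` pbw_index)"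
proof
  fix x assume "x \<in> comp0.pbw_sums"
  then show "x \<in> C0.span (pbw_elt ` pbw_index)"
    by (induction rule: comp0.pbw_sums.induct) (auto simp: comp0_eqs intro: C0.span_zero
        C0.span_add C0.span_base)
qed

lemma gen0_mult_span:
  assumes "s \<in> C0.span (pbw_elt ` pbw_index)"
  shows "gen0 v * s \<in> C0.span (pbw_elt ` pbw_index)"
  using assms
proof (induction rule: C0.span_induct_alt)
  case (step c x y)
  have "gen0 v * x \<in> C0.span (pbw_elt ` pbw_index)"
    using step(1) comp0.i_mult_pbw comp0.j_mult_pbw pbw_sums_subset_span unfolding comp0_eqs
    by (cases v) auto
  then show ?case
    using step(2) by (simp add: distrib_left scale0_mult_right C0.span_add C0.span_scale)
qed (simp add: C0.span_zero)

lemma comp_alg_q_induct: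
  assumes gen: "\<And>v. Q (q_gen v)" and one: "Q 1"
    and add: "\<And>x y. Q x \<Longrightarrow> Q y \<Longrightarrow> Q (x + y)" and mult: "\<And>x y. Q x \<Longrightarrow> Q y \<Longrightarrow> Q (x * y)"
    and scale: "\<And>c x. Q x \<Longrightarrow> Q (q_scale c x)"
  shows "Q z"
proof -
  have "x \<in> generic_comp_alg \<Longrightarrow> Rep_comp_alg_q z = x \<Longrightarrow> Q z" for x
  proof (induction arbitrary: z rule: generic_comp_alg.induct)
    case (gen v)
    then have "z = q_gen v" by (simp add: q_gen.rep_eq flip: Rep_comp_alg_q_inject)
    then show ?case using assms(1) by simp
  next
    case one
    then have "z = 1" by (simp add: one_comp_alg_q.rep_eq flip: Rep_comp_alg_q_inject)
    then show ?case using assms(2) by simp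
  next
    case (add x y)
    then have "z = Abs_comp_alg_q x + Abs_comp_alg_q y"
      by (simp add: plus_comp_alg_q.rep_eq Abs_comp_alg_q_inverse flip: Rep_comp_alg_q_inject)
    then show ?case using assms(3) add by (simp add: Abs_comp_alg_q_inverse)
  next
    case (mult x y)
    then have "z = Abs_comp_alg_q x * Abs_comp_alg_q y"
      by (simp add: times_comp_alg_q.rep_eq Abs_comp_alg_q_inverse flip: Rep_comp_alg_q_inject)
    then show ?case using assms(4) mult by (simp add: Abs_comp_alg_q_inverse)
  next
    case (scale x c)
    then have "z = q_scale c (Abs_comp_alg_q x)"
      by (simp add: q_scale.rep_eq Abs_comp_alg_q_inverse flip: Rep_comp_alg_q_inject)
    then show ?case using assms(5) scale by (simp add: Abs_comp_alg_q_inverse)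
  qed
  then show ?thesis using Rep_comp_alg_q by blast
qed

lemma comp_alg_0_induct:
  assumes "\<And>v. Q (gen0 v)" "Q 1"
    and "\<And>x y. Q x \<Longrightarrow> Q y \<Longrightarrow> Q (x + y)" "\<And>x y. Q x \<Longrightarrow> Q y \<Longrightarrow> Q (x * y)"
    and "\<And>c x. Q x \<Longrightarrow> Q (scale0 c x)"
  shows "Q x"
proof (induction x)
  fix z show "Q (abs_comp_alg_0 z)"
  proof (induction z rule: comp_alg_q_induct)
    fix v show "Q (abs_comp_alg_0 (q_gen v))" using assms(1)[of v] by (simp add: gen0.abs_eq)
  next
    show "Q (abs_comp_alg_0 1)" using assms(2) by (simp add: one_comp_alg_0.abs_eq)
  qed (use assms(3-5) in \<open>simp_all add: abs_q_scale flip: abs_comp_alg_0_simps\<close>)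
qed

text \<open>The span is stable under left multiplication by the generators, hence by everything, and
  it contains 1.\<close>

lemma span_pbw: "C0.span (pbw_elt ` pbw_index) = UNIV"
proof -
  let ?S = "C0.span (pbw_elt ` pbw_index)"
  have "\<forall>s\<in>?S. x * s \<in> ?S" for x
    by (induction x rule: comp_alg_0_induct)
      (auto simp: gen0_mult_span distrib_right mult.assoc scale0_mult_left intro: C0.span_add
          C0.span_scale)
  moreover have "1 \<in> ?S"
  proof -
    have "pbw_elt ([], [], []) = 1" "([], [], []) \<in> pbw_index"
      by (simp_all add: pbw_elt_def pbw_index_def)
    then show ?thesis by (metis C0.span_base imageI)
  qed
  ultimately have "x \<in> ?S" for x by (metis mult_1_right)
  then show ?thesis by blast
qed

lemma abs_comp_alg_0_sum: "abs_comp_alg_0 (sum f A) = (\<Sum>a\<in>A. abs_comp_alg_0 (f a))"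
  by (induction A rule: infinite_finite_induct) (simp_all add: zero_comp_alg_0.abs_eq flip:
      abs_comp_alg_0_simps)

lemma pbw_expansion:
  "\<exists>F a z'. finite F \<and> F \<subseteq> pbw_index \<and> z = (\<Sum>x\<in>F. q_scale [:a x:] (q_pbw x)) + q_scale pX z'"
proof -
  have "abs_comp_alg_0 z \<in> C0.span (pbw_elt ` pbw_index)" by (simp add: span_pbw)
  then obtain t r where t: "finite t" "t \<subseteq> pbw_elt ` pbw_index" "abs_comp_alg_0 z =
      (\<Sum>a\<in>t. scale0 (r a) a)"
    unfolding C0.span_explicit by blast
  obtain F where F: "F \<subseteq> pbw_index" "inj_on pbw_elt F" "t = pbw_elt ` F"
    using t(2) subset_image_inj by metis
  have "finite F" using t(1) F(2,3) by (simp add: finite_image_iff)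
  let ?w = "\<Sum>x\<in>F. q_scale [:r (pbw_elt x):] (q_pbw x)"
  have "abs_comp_alg_0 ?w = (\<Sum>x\<in>F. scale0 (r (pbw_elt x)) (pbw_elt x))"
    unfolding abs_comp_alg_0_sum using F(1)
        by (intro sum.cong) (auto simp: abs_q_scale abs_q_pbw subset_iff)
  also have "\<dots> = abs_comp_alg_0 z"
    unfolding t(3) F(3) by (simp add: sum.reindex[OF F(2)])
  finally have "z - ?w \<in> q_multiples"
    by (simp add: comp_alg_0.abs_eq_iff[symmetric])
  then obtain z' where "z - ?w = q_scale pX z'" by (auto simp: q_multiples_def)
  then have "z = ?w + q_scale pX z'" by (simp add: algebra_simps)
  then show ?thesis using \<open>finite F\<close> F(1)
      by (intro exI[of _ F] exI[of _ "\<lambda>x. r (pbw_elt x)"] exI[of _ z']) simp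
qed

lemma pbw_family_independent:
  assumes T: "finite T" "T \<subseteq> pbw_index" "(\<Sum>x\<in>T. scale0 (c x) (pbw_elt x)) = 0" and "x0 \<in> T"
  shows "c x0 = 0"
proof (rule ccontr)
  assume c0: "c x0 \<noteq> 0"
  have x0: "x0 \<in> pbw_index" using T(2) \<open>x0 \<in> T\<close> by blast
  obtain X u d where X: "finite X" "d \<noteq> 0"
    and u: "\<And>x. x \<in> pbw_index \<Longrightarrow> (\<Sum>y\<in>X. u y * pairing y (q_pbw x)) = (if x = x0 then d else 0)"
    using dual_functional[OF x0] by blast
  define l where "l z = (\<Sum>y\<in>X. u y * pairing y z)" for z
  have l_add: "l (x + y) = l x + l y" for x y
    by (simp add: l_def pairing_def q_act_simps distrib_left sum.distrib)
  have l_scale: "l (q_scale g x) = g * l x" for g x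
    by (simp add: l_def pairing_def q_act_simps sum_distrib_left mult.left_commute)
  have l_0: "l 0 = 0" using l_scale[of 0 0] by simp
  have l_sum: "l (sum z A) = (\<Sum>a\<in>A. l (z a))"
      for z :: "nat list \<times> nat list \<times> nat list \<Rightarrow> comp_alg_q" and A
    by (induction A rule: infinite_finite_induct) (simp_all add: l_0 l_add)
  have l_pbw: "l (\<Sum>x\<in>F. q_scale [:a x:] (q_pbw x)) = (if x0 \<in> F then [:a x0:] * d else 0)"
    if "finite F" "F \<subseteq> pbw_index" for F a
  proof -
    have "l (\<Sum>x\<in>F. q_scale [:a x:] (q_pbw x)) = (\<Sum>x\<in>F. if x = x0 then [:a x0:] * d else 0)"
      unfolding l_sum l_scale using that(2) u by (intro sum.cong) (auto simp: l_def subset_iff)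
    then show ?thesis using that(1) by simp
  qed
  have "(\<Sum>x\<in>T. q_scale [:c x:] (q_pbw x)) \<in> q_multiples"
  proof -
    have "abs_comp_alg_0 (\<Sum>x\<in>T. q_scale [:c x:] (q_pbw x)) = (\<Sum>x\<in>T. scale0 (c x) (pbw_elt x))"
      unfolding abs_comp_alg_0_sum using T(2)
          by (intro sum.cong) (auto simp: abs_q_scale abs_q_pbw subset_iff)
    also have "\<dots> = abs_comp_alg_0 0" by (simp add: T(3) zero_comp_alg_0.abs_eq)
    finally show ?thesis by (simp add: comp_alg_0.abs_eq_iff)
  qed
  then obtain y where y: "(\<Sum>x\<in>T. q_scale [:c x:] (q_pbw x)) = q_scale pX y"
    by (auto simp: q_multiples_def)
  have "[:c x0:] * d = pX * l y"
    using l_pbw[OF T(1,2), of c] \<open>x0 \<in> T\<close> unfolding y l_scale by simp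
  moreover have "[:inverse (c x0):] * ([:c x0:] * d) = d" using c0 by simp
  ultimately have d: "d = pX * ([:inverse (c x0):] * l y)" by (metis mult.left_commute)
  \<comment> \<open>By \<open>pbw_expansion\<close>, \<open>l z\<close> is a rational multiple of
    \<open>d\<close>, or 0, plus \<open>q\<close> times a value of \<open>l\<close>; and
    \<open>d\<close> is by now \<open>q\<close> times a value of \<open>l\<close> as well.\<close>
  have step: "\<exists>z'. l z = pX * l z'" for z
  proof -
    obtain F a z' where F: "finite F" "F \<subseteq> pbw_index"
        "z = (\<Sum>x\<in>F. q_scale [:a x:] (q_pbw x)) + q_scale pX z'"
      using pbw_expansion[of z] by (elim exE conjE) (rule that)
    have "l z = (if x0 \<in> F then [:a x0:] * d else 0) + pX * l z'"
      unfolding F(3) l_add l_scale l_pbw[OF F(1,2)] by (rule refl)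
    also have "\<dots> = pX * l (q_scale (if x0 \<in> F then [:a x0:] * [:inverse (c x0):] else 0) y + z')"
      unfolding l_add l_scale by (subst (1) d) (simp only: distrib_left mult.assoc
          mult.left_commute split: if_split, simp)
    finally show ?thesis by blast
  qed
  have "pX ^ k dvd l z" for k z
  proof (induction k arbitrary: z)
    case (Suc k)
    then show ?case using step[of z] by (metis dvd_refl mult_dvd_mono power_Suc)
  qed simp
  then have "pX ^ Suc (degree (l z)) dvd l z" for z by blast
  then have "l z = 0" for z
    by (metis degree_linear_power dvd_imp_degree_le not_less_eq_eq order_refl)
  moreover have "l (q_pbw x0) = d" using u[OF x0] by (simp add: l_def)
  ultimately show False using X(2) by simp
qed

lemma inj_on_pbw: "inj_on pbw_elt pbw_index"
proof (rule inj_onI, rule ccontr)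
  fix x y assume xy: "x \<in> pbw_index" "y \<in> pbw_index" "pbw_elt x = pbw_elt y" "x \<noteq> y"
  have "(\<Sum>z\<in>{x, y}. scale0 (if z = x then 1 else - 1) (pbw_elt z)) = 0"
    using xy(3,4) by simp
  then have "(if x = x then 1 else - 1 :: rat) = 0"
    using xy by (intro pbw_family_independent[of "{x, y}"]) auto
  then show False by simp
qed

lemma independent_pbw: "C0.independent (pbw_elt ` pbw_index)"
  unfolding C0.independent_explicit_module
proof (intro allI impI)
  fix t u v assume t: "finite t" "t \<subseteq> pbw_elt ` pbw_index" "(\<Sum>v\<in>t. scale0 (u v) v) = 0" "v \<in> t"
  obtain F where F: "F \<subseteq> pbw_index" "inj_on pbw_elt F" "t = pbw_elt ` F"
    using t(2) subset_image_inj by metis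
  have "finite F" using t(1) F(2,3) by (simp add: finite_image_iff)
  have "(\<Sum>x\<in>F. scale0 (u (pbw_elt x)) (pbw_elt x)) = 0"
    using t(3) unfolding F(3) by (simp add: sum.reindex[OF F(2)])
  moreover obtain x where "x \<in> F" "v = pbw_elt x" using t(4) F(3) by blast
  ultimately show "u v = 0"
    using pbw_family_independent[OF \<open>finite F\<close> F(1)] by simp
qed

section \<open>The presentation\<close>

lemma lookup_power_zero: "Poly_Mapping.lookup (p ^ n) 0 = Poly_Mapping.lookup p 0 ^ n"
  for p :: "('a, 'k::ring_1) free_algebra"
  by (induction n) (simp_all add: lookup_mult_zero lookup_one)

lemma kronecker_ideal_lookup_zero:
  "x \<in> ideal_gen kronecker_relations \<Longrightarrow> Poly_Mapping.lookup x 0 = 0"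
  by (induction rule: ideal_gen.induct)
    (auto simp: kronecker_relations_def Let_def lookup_add lookup_minus lookup_mult_zero
        lookup_power_zero)

quotient_type kron_alg = "(vertex, rat) free_algebra"
    / "\<lambda>x y. x - y \<in> ideal_gen kronecker_relations"
proof (rule equivpI)
  show "reflp (\<lambda>x y. x - y \<in> ideal_gen kronecker_relations)"
    by (auto intro!: reflpI ideal_gen.zero)
  show "symp (\<lambda>x y. x - y \<in> ideal_gen kronecker_relations)"
    by (rule sympI, drule ideal_gen_uminus) simp
  show "transp (\<lambda>x y. x - y \<in> ideal_gen kronecker_relations)"
    by (rule transpI, drule (1) ideal_gen.add) simp
qed

instantiation kron_alg :: ring_1
begin

lift_definition zero_kron_alg :: kron_alg is 0 .

lift_definition one_kron_alg :: kron_alg is 1 .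

lift_definition plus_kron_alg :: "kron_alg \<Rightarrow> kron_alg \<Rightarrow> kron_alg" is "(+)"
  by (drule (1) ideal_gen.add) (simp add: algebra_simps)

lift_definition uminus_kron_alg :: "kron_alg \<Rightarrow> kron_alg" is uminus
  by (drule ideal_gen_uminus) simp

lift_definition minus_kron_alg :: "kron_alg \<Rightarrow> kron_alg \<Rightarrow> kron_alg" is "(-)"
  by (drule (1) ideal_gen_diff) (simp add: algebra_simps)

lift_definition times_kron_alg :: "kron_alg \<Rightarrow> kron_alg \<Rightarrow> kron_alg" is "(*)"
proof -
  fix x x' y y' :: "(vertex, rat) free_algebra"
  assume "x - x' \<in> ideal_gen kronecker_relations" "y - y' \<in> ideal_gen kronecker_relations"
  then have "(x - x') * y + x' * (y - y') \<in> ideal_gen kronecker_relations"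
    by (intro ideal_gen.add ideal_gen.mult_left ideal_gen.mult_right)
  then show "x * y - x' * y' \<in> ideal_gen kronecker_relations"
    by (simp add: algebra_simps)
qed

instance
proof
  show "(0 :: kron_alg) \<noteq> 1"
    by transfer (auto dest: kronecker_ideal_lookup_zero simp: lookup_minus lookup_one)
qed (transfer; simp add: algebra_simps ideal_gen.zero)+

end

lemma abs_kron_alg_simps:
  "abs_kron_alg x + abs_kron_alg y = abs_kron_alg (x + y)"
  "abs_kron_alg x - abs_kron_alg y = abs_kron_alg (x - y)"
  "abs_kron_alg x * abs_kron_alg y = abs_kron_alg (x * y)"
  "abs_kron_alg x ^ n = abs_kron_alg (x ^ n)"
  by (induction n) (simp_all add: plus_kron_alg.abs_eq minus_kron_alg.abs_eq times_kron_alg.abs_eq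
      one_kron_alg.abs_eq)

lemma abs_kron_alg_prod_list: "prod_list (map (\<lambda>x. abs_kron_alg (f x)) xs) =
    abs_kron_alg (prod_list (map f xs))"
  by (induction xs) (simp_all add: one_kron_alg.abs_eq abs_kron_alg_simps)

abbreviation (input) "ai \<equiv> fa_gen VI :: (vertex, rat) free_algebra"
abbreviation (input) "aj \<equiv> fa_gen VJ :: (vertex, rat) free_algebra"

interpretation free: two_gen ai aj .

interpretation kron: kron_rels "abs_kron_alg ai" "abs_kron_alg aj"
proof
  have rel: "abs_kron_alg x = abs_kron_alg y" if "x - y \<in> kronecker_relations" for x y
    using ideal_gen.gen[OF that] by (simp add: kron_alg.abs_eq_iff)
  fix m n :: nat
  show "abs_kron_alg ai ^ m * abs_kron_alg aj ^ (m + 1) * abs_kron_alg ai ^ (m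
      + 1) * abs_kron_alg aj ^ (m + 2) =
      abs_kron_alg ai ^ (2 * m + 1) * abs_kron_alg aj ^ (2 * m + 3)"
    unfolding abs_kron_alg_simps by (rule rel) (unfold kronecker_relations_def Let_def, blast)
  show "abs_kron_alg ai ^ (n + 2) * abs_kron_alg aj ^ (n + 1) * abs_kron_alg ai ^ (n
      + 1) * abs_kron_alg aj ^ n =
      abs_kron_alg ai ^ (2 * n + 3) * abs_kron_alg aj ^ (2 * n + 1)"
    unfolding abs_kron_alg_simps by (rule rel) (unfold kronecker_relations_def Let_def, blast)
  show "abs_kron_alg ai ^ m * abs_kron_alg aj ^ m * (abs_kron_alg ai ^ n * abs_kron_alg aj ^ n) =
      abs_kron_alg ai ^ n * abs_kron_alg aj ^ n * (abs_kron_alg ai ^ m * abs_kron_alg aj ^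
          m)" if "1 \<le> m" "1 \<le> n"
    unfolding abs_kron_alg_simps using that
        by (intro rel) (unfold kronecker_relations_def Let_def, blast)
qed

lemma kron_pbw: "kron.pbw x = abs_kron_alg (free.pbw x)"
proof -
  have R: "kron.R = abs_kron_alg free.R"
    by (simp add: kron.R_def free.R_def abs_kron_alg_simps)
  have "kron.P = (\<lambda>m. abs_kron_alg (free.P m))" "kron.I = (\<lambda>m. abs_kron_alg (free.I m))"
      "kron.Rs = (\<lambda>s. abs_kron_alg (free.Rs s))"
    by (auto simp: fun_eq_iff kron.P_def free.P_def kron.I_def free.I_def kron.Rs_def free.Rs_def
        R abs_kron_alg_simps)
  then show ?thesis
    by (cases x) (simp add: kron.pbw_def free.pbw_def abs_kron_alg_simps abs_kron_alg_prod_list)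
qed

interpretation fa: vector_space "fa_scale :: rat \<Rightarrow> (vertex, rat) free_algebra \<Rightarrow> _"
  by (rule vector_space_fa_scale)

lemma kron_pbw_sums:
  "x \<in> kron.pbw_sums \<Longrightarrow> \<exists>y\<in>fa.span (free.pbw ` pbw_index). x = abs_kron_alg y"
proof (induction rule: kron.pbw_sums.induct)
  case zero
  then show ?case by (intro bexI[of _ 0]) (simp_all add: zero_kron_alg.abs_eq fa.span_zero)
next
  case (add x y)
  then obtain z where "z \<in> fa.span (free.pbw ` pbw_index)" "y = abs_kron_alg z" by blast
  then show ?case
    using add.hyps(1) by (intro bexI[of _ "free.pbw x + z"]) (auto simp: kron_pbw
        abs_kron_alg_simps intro: fa.span_add fa.span_base)
qed

lemma single_eq_prod_list:
  "Poly_Mapping.single w 1 = prod_list (map fa_gen (letters w))"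
proof (cases w)
  case (Free_Monoid xs)
  have "Poly_Mapping.single (Free_Monoid xs) 1 = prod_list (map fa_gen xs)" for xs :: "'a list"
  proof (induction xs)
    case Nil
    show ?case by (simp flip: single_one zero_free_monoid_def)
  next
    case (Cons a xs)
    show ?case
      unfolding list.map prod_list.Cons Cons[symmetric]
      by (simp add: fa_gen_def mult_single plus_free_monoid_def)
  qed
  then show ?thesis by (simp add: Free_Monoid)
qed

lemma free_algebra_mod_ideal:
  "\<exists>y\<in>fa.span (free.pbw ` pbw_index). p - y \<in> ideal_gen kronecker_relations"
proof (induction p rule: free_algebra_induct)
  case (single w c)
  have "case_vertex (abs_kron_alg ai) (abs_kron_alg aj) = (\<lambda>v. abs_kron_alg (fa_gen v))"
    by (auto split: vertex.split)
  then have "prod_list (map (case_vertex (abs_kron_alg ai) (abs_kron_alg aj)) (letters w)) =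
      abs_kron_alg (Poly_Mapping.single w 1)"
    by (simp add: single_eq_prod_list abs_kron_alg_prod_list)
  then obtain y where y: "y \<in> fa.span (free.pbw ` pbw_index)"
      "abs_kron_alg (Poly_Mapping.single w 1) = abs_kron_alg y"
    using kron_pbw_sums kron.word_in_pbw_sums by metis
  then have "fa_scale c (Poly_Mapping.single w 1 - y) \<in> ideal_gen kronecker_relations"
    unfolding fa_scale_def by (intro ideal_gen.mult_left) (simp add: kron_alg.abs_eq_iff)
  also have "fa_scale c (Poly_Mapping.single w 1 - y) = Poly_Mapping.single w c - fa_scale c y"
    by (simp add: fa_scale_def right_diff_distrib mult_single)
  finally show ?case using y(1) fa.span_scale by blast
next
  case (add p r)
  then obtain y z where "y \<in> fa.span (free.pbw ` pbw_index)" "p - y \<in> ideal_gen kronecker_relations"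
    "z \<in> fa.span (free.pbw ` pbw_index)" "r - z \<in> ideal_gen kronecker_relations" by blast
  then show ?case
    using ideal_gen.add[of "p - y" _ "r - z"]
        by (intro bexI[of _ "y + z"] fa.span_add) (simp_all add: algebra_simps)
qed

definition comp0_hom :: "(vertex, rat) free_algebra \<Rightarrow> comp_alg_0" where
  "comp0_hom = lin_ext scale0 (\<lambda>w. prod_list (map gen0 w))"

lemma module_scale0: "module scale0" by unfold_locales

lemma comp0_hom_simps:
  "comp0_hom (p + r) = comp0_hom p + comp0_hom r"
  "comp0_hom (p - r) = comp0_hom p - comp0_hom r"
  "comp0_hom 0 = 0"
  "comp0_hom (fa_scale c p) = scale0 c (comp0_hom p)"
  "comp0_hom (Poly_Mapping.single w c) = scale0 c (prod_list (map gen0 (letters w)))"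
  "comp0_hom (fa_gen v) = gen0 v"
  "comp0_hom 1 = 1"
  unfolding comp0_hom_def fa_gen_def single_one[symmetric]
  by (simp_all add: lin_ext_add[OF module_scale0] lin_ext_diff[OF module_scale0] lin_ext_0[OF
      module_scale0]
    lin_ext_scale[OF module_scale0] lin_ext_single[OF module_scale0] zero_free_monoid_def)

lemma comp0_hom_mult: "comp0_hom (p * r) = comp0_hom p * comp0_hom r"
proof (induction p rule: free_algebra_induct)
  case (single w c)
  show ?case
  proof (induction r rule: free_algebra_induct)
    case (single v d)
    show ?case
      by (simp add: mult_single comp0_hom_simps plus_free_monoid_def scale0_mult_left
          scale0_mult_right mult.commute)
  qed (simp add: comp0_hom_simps distrib_left)
qed (simp add: comp0_hom_simps distrib_right)

lemma comp0_hom_power: "comp0_hom (p ^ n) = comp0_hom p ^ n"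
  by (induction n) (simp_all add: comp0_hom_simps comp0_hom_mult)

lemma comp0_hom_prod_list: "comp0_hom (prod_list ps) = prod_list (map comp0_hom ps)"
  by (induction ps) (simp_all add: comp0_hom_simps comp0_hom_mult)

lemma comp0_hom_pbw: "comp0_hom (free.pbw x) = pbw_elt x"
proof -
  have R: "comp0_hom free.R = R1"
    by (simp add: R1_def free.R_def comp0_hom_simps comp0_hom_mult)
  have "comp0_hom \<circ> free.P = elt_P" "comp0_hom \<circ> free.I = elt_I" "comp0_hom \<circ> free.Rs = elt_R"
    by (auto simp: fun_eq_iff elt_P_def free.P_def elt_I_def free.I_def elt_R_def free.Rs_def R
        comp0_hom_simps comp0_hom_mult comp0_hom_power)
  then show ?thesis
    by (cases x) (simp add: pbw_elt_def free.pbw_def comp0_hom_mult comp0_hom_prod_list)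
qed

lemma comp0_hom_ideal: "p \<in> ideal_gen kronecker_relations \<Longrightarrow> comp0_hom p = 0"
proof (induction rule: ideal_gen.induct)
  case (gen p)
  then show ?case
    using comp0.rel1 comp0.rel2 comp0.rel3 unfolding kronecker_relations_def Let_def
    by (elim UnE CollectE exE conjE) (simp_all only: comp0_hom_simps comp0_hom_mult
        comp0_hom_power right_minus_eq)
qed (simp_all add: comp0_hom_simps comp0_hom_mult)

text \<open>Modulo the ideal every element is a combination of formal ordered products, and since
  their images are independent, the combination of an element of the kernel has only zero
  coefficients.\<close>

lemma comp0_hom_kernel: "{p. comp0_hom p = 0} = ideal_gen kronecker_relations"
proof (intro equalityI subsetI CollectI; (drule CollectD)?)
  fix p assume p: "comp0_hom p = 0"
  obtain y where y: "y \<in> fa.span (free.pbw ` pbw_index)" "p - y \<in> ideal_gen kronecker_relations"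
    using free_algebra_mod_ideal by blast
  then have "comp0_hom y = 0" using p comp0_hom_ideal[of "p - y"] by (simp add: comp0_hom_simps)
  obtain t r where t: "finite t" "t \<subseteq> free.pbw ` pbw_index" "y = (\<Sum>a\<in>t. fa_scale (r a) a)"
    using y(1) unfolding fa.span_explicit by blast
  obtain F where F: "F \<subseteq> pbw_index" "inj_on free.pbw F" "t = free.pbw ` F"
    using t(2) subset_image_inj by metis
  have "finite F" using t(1) F(2,3) by (simp add: finite_image_iff)
  have y': "y = (\<Sum>x\<in>F. fa_scale (r (free.pbw x)) (free.pbw x))"
    unfolding t(3) F(3) by (simp add: sum.reindex[OF F(2)])
  have "comp0_hom (sum f A) = (\<Sum>a\<in>A. comp0_hom (f a))"
      for f :: "nat list \<times> nat list \<times> nat list \<Rightarrow> _" and A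
    by (induction A rule: infinite_finite_induct) (simp_all add: comp0_hom_simps)
  then have "(\<Sum>x\<in>F. scale0 (r (free.pbw x)) (pbw_elt x)) = 0"
    using \<open>comp0_hom y = 0\<close> unfolding y' by (simp add: comp0_hom_simps comp0_hom_pbw)
  then have "r (free.pbw x) = 0" if "x \<in> F" for x
    using pbw_family_independent[OF \<open>finite F\<close> F(1), of "\<lambda>x. r (free.pbw x)"] that by simp
  then have "y = 0" unfolding y' by (intro sum.neutral) simp
  then show "p \<in> ideal_gen kronecker_relations" using y(2) by simp
qed (rule comp0_hom_ideal)

lemma surj_comp0_hom: "surj comp0_hom"
proof -
  have "\<exists>p. comp0_hom p = x" for x
  proof (induction x rule: comp_alg_0_induct)
    case (3 x y)
    then obtain p r where "comp0_hom p = x" "comp0_hom r = y" by blast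
    then show ?case by (intro exI[of _ "p + r"]) (simp add: comp0_hom_simps)
  next
    case (4 x y)
    then obtain p r where "comp0_hom p = x" "comp0_hom r = y" by blast
    then show ?case by (intro exI[of _ "p * r"]) (simp add: comp0_hom_mult)
  next
    case (5 c x)
    then obtain p where "comp0_hom p = x" by blast
    then show ?case by (intro exI[of _ "fa_scale c p"]) (simp add: comp0_hom_simps)
  qed (rule exI, rule comp0_hom_simps)+
  then show ?thesis by (metis surjI someI_ex)
qed

lemma is_algebra_hom_comp0_hom: "is_algebra_hom fa_scale scale0 comp0_hom"
proof -
  have "Vector_Spaces.linear fa_scale scale0 comp0_hom"
    unfolding Vector_Spaces.linear_iff
    by (simp add: comp0_hom_simps vector_space_fa_scale C0.vector_space_axioms)
  then show ?thesis by (simp add: is_algebra_hom_def comp0_hom_simps comp0_hom_mult)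
qed

theorem theorem6:
  shows "(\<exists>\<phi> :: (vertex, rat) free_algebra \<Rightarrow> comp_alg_0.
      is_algebra_hom fa_scale scale0 \<phi>
      \<and> \<phi> (fa_gen VI) = gen0 VI \<and> \<phi> (fa_gen VJ) = gen0 VJ
      \<and> surj \<phi>
      \<and> {p. \<phi> p = 0} = ideal_gen kronecker_relations)
    \<and> inj_on pbw_elt pbw_index
    \<and> C0.independent (pbw_elt ` pbw_index)
    \<and> C0.span (pbw_elt ` pbw_index) = UNIV"
  using is_algebra_hom_comp0_hom comp0_hom_simps(6) surj_comp0_hom comp0_hom_kernel inj_on_pbw
      independent_pbw span_pbw
  by blast

end
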